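(* Let $\alpha\in(0,1)$, $p\ge1$, let $F^*$ be a probability distribution on $\mathbb{R}^{d+1}$ (the data-generating distribution of $(\mathbf{X},Y)$), and suppose $\Gamma:=\mathbb{E}^{F^*}[\|(\mathbf{X},Y)\|^r]<\infty$ for some $r>2$. Let $\eta\in(0,1)$ and $\lambda=c_{\alpha,p}\,\varepsilon_N(\eta)$, where $$\varepsilon_N(\eta)=\frac{\alpha\vee(1-\alpha)}{\alpha\wedge(1-\alpha)}\left(360\sqrt{d+2}+2\sqrt{2\log\Big(\frac3\eta\Big)}+\sqrt{\frac{3\Gamma}{\eta}}\,\frac{32}{r-2}\sqrt{\log\Big(\frac{24}{\eta}\Big)+2(d+2)}\right)\frac{(\log(2N+1))^{1/r}}{\sqrt N}.$$ Let $(\widetilde{\boldsymbol\beta}_N,\widetilde s_N)$ be a minimizer of the regularized quantile regression problem $$\inf_{(\boldsymbol\beta,s)\in\mathbb{R}^{d+1}}\Big\{\mathbb{E}^{\widehat F_N}[\ell_\alpha(Y-\boldsymbol\beta^\top\mathbf{X}-s)]+\lambda\|(\boldsymbol\beta,-1)\|_*\Big\},$$ let $\widetilde J_N(\lambda)$ be its optimal value, $\widetilde J_N(\lambda)=\mathbb{E}^{\widehat F_N}[\ell_\alpha(Y-\widetilde{\boldsymbol\beta}_N^\top\mathbf{X}-\widetilde s_N)]+\lambda\|(\widetilde{\boldsymbol\beta}_N,-1)\|_*$, and let $\widetilde J_{\rm oos}(\lambda)=\mathbb{E}^{F^*}[\ell_\alpha(Y-\widetilde{\boldsymbol\beta}_N^\top\mathbf{X}-\widetilde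 s_N)]$. Then $$\mathbb{P}^N\Big(\widetilde J_{\rm oos}(\lambda)\le\widetilde J_N(\lambda)+\rho(\widetilde{\boldsymbol\beta}_N)\,\lambda\Big)\ge1-\eta,\qquad \rho(\widetilde{\boldsymbol\beta}_N):=\max\{\alpha,1-\alpha\}\,\|(-\widetilde{\boldsymbol\beta}_N,1)\|_*.$$
   Context: The check loss is $\ell_\alpha(u)=u(\alpha-\mathbf{1}_{\{u<0\}})$. $\widehat F_N$ is the empirical distribution of $N$ i.i.d. samples of $(\mathbf{X},Y)\in\mathbb{R}^d\times\mathbb{R}$ drawn from $F^*$, and $\mathbb{P}^N$ is the probability over these samples; in $\widetilde J_{\rm oos}$ the expectation is over $(\mathbf{X},Y)\sim F^*$ with the sample held fixed. $\|\cdot\|$ is a fixed norm on $\mathbb{R}^{d+1}$ with dual norm $\|\mathbf{y}\|_*=\sup_{\|\mathbf{x}\|\le1}\mathbf{x}^\top\mathbf{y}$. With $q$ the Hölder conjugate of $p$, $c_{\alpha,1}=\max\{\alpha,1-\alpha\}$, $c_{\alpha,p}=(\alpha^q(1-\alpha)+\alpha(1-\alpha)^q)^{1/q}$ for $p\in(1,\infty)$, and $c_{\alpha,\infty}=2\alpha(1-\alpha)$. $a\vee b=\max\{a,b\}$, $a\wedge b=\min\{a,b\}$. *)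

theory Defs
  imports "HOL-Probability.Probability"
begin

text \<open>Points of \<open>\<real>\<^sup>d\<^sup>+\<^sup>1\<close> are pairs \<open>(x, y)\<close> of type \<^typ>\<open>(real ^ 'd) \<times> real\<close>, so that \<open>d\<close> is
  \<^term>\<open>CARD('d)\<close>, the inner product is the usual one, and a distribution on \<open>\<real>\<^sup>d\<^sup>+\<^sup>1\<close> is a
  probability measure on the Borel sets of this type.\<close>

definition is_norm :: "('a::real_vector \<Rightarrow> real) \<Rightarrow> bool" where
  "is_norm \<nu> \<longleftrightarrow>
     (\<forall>x. \<nu> x = 0 \<longleftrightarrow> x = 0) \<and>
     (\<forall>x y. \<nu> (x + y) \<le> \<nu> x + \<nu> y) \<and>
     (\<forall>c x. \<nu> (c *\<^sub>R x) = \<bar>c\<bar> * \<nu> x)"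

definition dual_norm :: "('a::real_inner \<Rightarrow> real) \<Rightarrow> 'a \<Rightarrow> real" where
  "dual_norm \<nu> y = (SUP x\<in>{x. \<nu> x \<le> 1}. x \<bullet> y)"

definition check_loss :: "real \<Rightarrow> real \<Rightarrow> real" where
  "check_loss \<alpha> u = u * (\<alpha> - (if u < 0 then 1 else 0))"

definition expected_loss ::
  "real \<Rightarrow> ((real ^ 'd) \<times> real) measure \<Rightarrow> real ^ 'd \<Rightarrow> real \<Rightarrow> real" where
  "expected_loss \<alpha> F \<beta> s = (\<integral>(x, y). check_loss \<alpha> (y - \<beta> \<bullet> x - s) \<partial>F)"

text \<open>A sample of size \<open>N\<close> is a function \<open>\<omega>\<close> on the index set \<open>{..<N}\<close>. Its empirical distribution
  is the law of \<open>\<omega> i\<close> for a uniformly chosen index \<open>i\<close>; it is a probability measure for \<open>N > 0\<close>.\<close>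

definition empirical :: "nat \<Rightarrow> (nat \<Rightarrow> 'a::topological_space) \<Rightarrow> 'a measure" where
  "empirical N \<omega> = distr (uniform_count_measure {..<N}) borel \<omega>"

definition iid_sample :: "nat \<Rightarrow> 'a measure \<Rightarrow> (nat \<Rightarrow> 'a) measure" where
  "iid_sample N F = (\<Pi>\<^sub>M i\<in>{..<N}. F)"

definition regularized_loss ::
  "real \<Rightarrow> ((real ^ 'd) \<times> real \<Rightarrow> real) \<Rightarrow> real \<Rightarrow> ((real ^ 'd) \<times> real) measure \<Rightarrow>
   real ^ 'd \<Rightarrow> real \<Rightarrow> real" where
  "regularized_loss \<alpha> \<nu> lam F \<beta> s = expected_loss \<alpha> F \<beta> s + lam * dual_norm \<nu> (\<beta>, - 1)"

text \<open>The exponent \<open>p\<close> ranges over \<open>[1, \<infinity>]\<close>; in the middle case \<open>q\<close> is its Hoelder conjugate, i.e.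
  \<open>1/p + 1/q = 1\<close>.\<close>

definition c_const :: "real \<Rightarrow> ereal \<Rightarrow> real" where
  "c_const \<alpha> p =
     (if p = 1 then max \<alpha> (1 - \<alpha>)
      else if p = \<infinity> then 2 * \<alpha> * (1 - \<alpha>)
      else let q = real_of_ereal p / (real_of_ereal p - 1)
           in (\<alpha> powr q * (1 - \<alpha>) + \<alpha> * (1 - \<alpha>) powr q) powr (1 / q))"

definition eps_radius :: "real \<Rightarrow> real \<Rightarrow> real \<Rightarrow> nat \<Rightarrow> nat \<Rightarrow> real \<Rightarrow> real" where
  "eps_radius \<alpha> r \<Gamma> d N \<eta> =
     max \<alpha> (1 - \<alpha>) / min \<alpha> (1 - \<alpha>) *
     (360 * sqrt (real d + 2) + 2 * sqrt (2 * ln (3 / \<eta>)) +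
      sqrt (3 * \<Gamma> / \<eta>) * (32 / (r - 2)) * sqrt (ln (24 / \<eta>) + 2 * (real d + 2))) *
     (ln (2 * real N + 1) powr (1 / r) / sqrt (real N))"

lemma expected_loss_empirical:
  assumes "N > 0"
  shows "expected_loss \<alpha> (empirical N \<omega>) \<beta> s =
    (\<Sum>i<N. check_loss \<alpha> (snd (\<omega> i) - \<beta> \<bullet> fst (\<omega> i) - s)) / real N"
proof -
  let ?f = "\<lambda>z. check_loss \<alpha> (snd z - \<beta> \<bullet> fst z - s)"
  have f: "?f \<in> borel_measurable borel"
    unfolding check_loss_def borel_prod[symmetric] by measurable
  have om: "\<omega> \<in> measurable (uniform_count_measure {..<N}) borel"
    by (auto simp: measurable_def space_uniform_count_measure sets_uniform_count_measure)
  have "expected_loss \<alpha> (empirical N \<omega>) \<beta> s = (\<integral>i. ?f (\<omega> i) \<partial>uniform_count_measure {..<N})"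
    unfolding expected_loss_def empirical_def case_prod_beta
    by (rule integral_distr[OF om f])
  also have "\<dots> = (\<Sum>i<N. ?f (\<omega> i)) / real N"
    unfolding uniform_count_measure_def
    by (subst lebesgue_integral_point_measure_finite) (auto simp: sum_divide_distrib)
  finally show ?thesis .
qed

end

theory Submission
  imports Defs
begin

text \<open>
  The inequality is a one-sided uniform law of large numbers for check losses of hyperplanes. Put
  \<open>m = max \<alpha> (1 - \<alpha>)\<close> and, for \<open>w\<close> in the unit ball of the dual norm and any intercept \<open>s\<close>,
  \<open>f(z) = \<ell>\<^sub>\<alpha>(w \<bullet> z - s) - \<ell>\<^sub>\<alpha>(- s)\<close>. Suppose that with probability at least \<open>1 - \<eta>\<close> the mean of
  \<open>f\<close> under \<open>F\<close> exceeds its sample mean by at most \<open>(1 + m) \<lambda>\<close>, simultaneously for all \<open>(w, s)\<close>. The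
  check loss is positively homogeneous, so scaling turns this into an excess of at most
  \<open>(1 + m) \<lambda> \<parallel>(-\<beta>, 1)\<parallel>\<^sub>*\<close> for all \<open>\<beta>\<close> and \<open>s\<close>, hence for the estimated ones; the part \<open>\<lambda> \<parallel>(-\<beta>, 1)\<parallel>\<^sub>*\<close>
  is the penalty and the rest is the correction term \<open>\<rho> \<lambda>\<close>.

  The uniform bound splits into the mean of the largest deviation and its fluctuation.

  For the mean, \<open>integral_symmetrization_le\<close> passes to random signs and \<open>sign_avg_contraction\<close>
  removes the Lipschitz function \<open>\<ell>\<^sub>\<alpha>\<close>. Two classes remain. The linear functions \<open>w \<bullet> z\<close> are controlled
  by a net of at most \<open>5\<^sup>D\<close> points, \<open>D\<close> being the dimension of the data space, in the dual ball
  (\<open>sign_avg_Max_inner_le\<close>). The intercepts range over an unbounded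
  set, but the loss at \<open>z\<close> depends on \<open>s\<close>, up to a
  constant, only through its sign and \<open>min \<bar>s\<bar> \<parallel>z\<parallel>\<close>; writing the latter as an integral of
  indicators bounds all \<open>s\<close> at once by an integral whose tail converges because \<open>r > 2\<close>
  (\<open>sign_avg_Max_truncation_le\<close>).

  For the fluctuation, each observation is projected radially onto the unit ball. The projected part
  has bounded differences, and \<open>McDiarmid\<close> gives the term in \<open>sqrt (ln (3 / \<eta>))\<close>. What is cut off has
  norm \<open>max 0 (\<parallel>z\<parallel> - 1) \<le> 2 / (r - 2) * \<parallel>z\<parallel> powr (r / 2)\<close>, hence a second moment of order
  \<open>\<Gamma> / (r - 2)\<^sup>2\<close>; a variance bound on product spaces (\<open>variance_le_of_weighted_differences\<close>) and
  Chebyshev's inequality give a term in \<open>sqrt (\<Gamma> / \<eta>) / (r - 2)\<close>.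

  All this is done for finitely many parameters, where maxima are measurable, and carried over to all
  of them by a countable dense set (\<open>uniform_dev_le\<close>). Finally \<open>c_const \<alpha> p \<ge> 2 \<alpha> (1 - \<alpha>)\<close> by
  convexity of powers, and the logarithmic factor of the radius is at least 1, so that \<open>\<lambda>\<close> is large
  enough for every \<open>p\<close> (\<open>lam_dominates\<close>).
\<close>

section \<open>Averages over random signs\<close>

text \<open>
  The expectation of \<open>h e\<close> over independent fair signs
  \<open>e 0, \<dots>, e (n - 1)\<close>, the remaining entries of \<open>e\<close> being 0. The recursion
  exposes one sign at a time, which is the form in which contraction and symmetrization are proved.
\<close>

primrec sign_avg :: "nat \<Rightarrow> ((nat \<Rightarrow> real) \<Rightarrow> real) \<Rightarrow> real" where
  "sign_avg 0 h = h (\<lambda>_. 0)"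
| "sign_avg (Suc n) h =
     (sign_avg n (\<lambda>e. h (e(n := 1))) + sign_avg n (\<lambda>e. h (e(n := -1)))) / 2"

lemma sign_avg_mono: "(\<And>e. g e \<le> h e) \<Longrightarrow> sign_avg n g \<le> sign_avg n h"
proof (induction n arbitrary: g h)
  case (Suc n)
  show ?case
    by (auto intro!: divide_right_mono add_mono Suc)
qed simp

lemma sign_avg_const [simp]: "sign_avg n (\<lambda>_. c) = c"
  by (induction n) auto

lemma sign_avg_add: "sign_avg n (\<lambda>e. g e + h e) = sign_avg n g + sign_avg n h"
proof (induction n arbitrary: g h)
  case (Suc n)
  show ?case unfolding sign_avg.simps Suc.IH by (simp add: field_simps)
qed simp

lemma sign_avg_cmult: "sign_avg n (\<lambda>e. c * h e) = c * sign_avg n h"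
proof (induction n arbitrary: h)
  case (Suc n)
  show ?case unfolding sign_avg.simps Suc.IH by (simp add: field_simps)
qed simp

lemma sign_avg_sum: "sign_avg n (\<lambda>e. \<Sum>i\<in>I. h i e) = (\<Sum>i\<in>I. sign_avg n (h i))"
proof (induction I rule: infinite_finite_induct)
  case (insert i I)
  show ?case unfolding sum.insert[OF insert.hyps] sign_avg_add insert.IH ..
qed simp_all

lemma sum_upd_top [simp]: "(\<Sum>i<n. (e(n := c)) i * x i) = (\<Sum>i<n. e i * x i)"
  for x :: "nat \<Rightarrow> real"
  by (rule sum.cong) auto

lemma sign_avg_flip: "sign_avg n (\<lambda>e. h (\<lambda>i. - e i)) = sign_avg n h"
proof (induction n arbitrary: h)
  case (Suc n)
  have *: "(\<lambda>i. - (e(n := c)) i) = (\<lambda>i. - e i)(n := - c)" for e :: "nat \<Rightarrow> real" and c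
    by auto
  show ?case
    using Suc[of "\<lambda>e. h (e(n := 1))"] Suc[of "\<lambda>e. h (e(n := -1))"]
    by (simp add: * del: fun_upd_apply)
qed (simp add: fun_eq_iff)

lemma integrable_sign_avg:
  assumes "\<And>e. integrable M (h e)"
  shows "integrable M (\<lambda>x. sign_avg n (\<lambda>e. h e x))"
  using assms
proof (induction n arbitrary: h)
  case (Suc n)
  show ?case
    unfolding sign_avg.simps
    by (intro integrable_divide Bochner_Integration.integrable_add Suc.IH Suc.prems)
qed simp

lemma integral_sign_avg:
  assumes "\<And>e. integrable M (h e)"
  shows "(\<integral>x. sign_avg n (\<lambda>e. h e x) \<partial>M) = sign_avg n (\<lambda>e. \<integral>x. h e x \<partial>M)"
  using assms
proof (induction n arbitrary: h)
  case (Suc n)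
  show ?case
    using Suc integrable_sign_avg[of M] by (simp add: Bochner_Integration.integral_add)
qed simp

lemma sign_avg_square:
  "sign_avg n (\<lambda>e. (c + (\<Sum>i<n. e i * x i))\<^sup>2) = c\<^sup>2 + (\<Sum>i<n. (x i)\<^sup>2)"
proof (induction n arbitrary: c)
  case (Suc n)
  have "sign_avg (Suc n) (\<lambda>e. (c + (\<Sum>i<Suc n. e i * x i))\<^sup>2)
    = (sign_avg n (\<lambda>e. ((c + x n) + (\<Sum>i<n. e i * x i))\<^sup>2)
      + sign_avg n (\<lambda>e. ((c - x n) + (\<Sum>i<n. e i * x i))\<^sup>2)) / 2"
    by (simp add: algebra_simps)
  also have "\<dots> = c\<^sup>2 + (\<Sum>i<Suc n. (x i)\<^sup>2)"
    unfolding Suc by (simp add: power2_eq_square field_simps)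
  finally show ?case .
qed simp

text \<open>
  The signs are orthonormal, so the second moment is exact; the passage to the first moment is
  \<open>\<bar>y\<bar> \<le> y\<^sup>2 / (2 v) + v / 2\<close> with \<open>v\<close> the root of that
  second moment.
\<close>

lemma sign_avg_abs_le: "sign_avg n (\<lambda>e. \<bar>\<Sum>i<n. e i * x i\<bar>) \<le> sqrt (\<Sum>i<n. (x i)\<^sup>2)"
proof (cases "(\<Sum>i<n. (x i)\<^sup>2) = 0")
  case True
  then have "\<forall>i\<in>{..<n}. x i = 0"
    by (subst (asm) sum_nonneg_eq_0_iff) auto
  then have "(\<Sum>i<n. e i * x i) = 0" for e :: "nat \<Rightarrow> real"
    by simp
  then show ?thesis by (simp add: sum_nonneg)
next
  case False
  define v where "v = sqrt (\<Sum>i<n. (x i)\<^sup>2)"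
  have "(\<Sum>i<n. (x i)\<^sup>2) \<ge> 0" by (intro sum_nonneg) auto
  with False have v: "v > 0" "v\<^sup>2 = (\<Sum>i<n. (x i)\<^sup>2)"
    by (auto simp: v_def)
  have le: "\<bar>y\<bar> \<le> (1 / (2 * v)) * y\<^sup>2 + v / 2" for y
  proof -
    have "0 \<le> (\<bar>y\<bar> - v)\<^sup>2" by simp
    then have "2 * v * \<bar>y\<bar> \<le> y\<^sup>2 + v\<^sup>2" by (simp add: power2_eq_square algebra_simps)
    then show ?thesis using v(1) by (simp add: field_simps power2_eq_square)
  qed
  have "sign_avg n (\<lambda>e. \<bar>\<Sum>i<n. e i * x i\<bar>)
      \<le> sign_avg n (\<lambda>e. (1 / (2 * v)) * (0 + (\<Sum>i<n. e i * x i))\<^sup>2 + v / 2)"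
    by (intro sign_avg_mono) (use le in simp)
  also have "\<dots> = (1 / (2 * v)) * v\<^sup>2 + v / 2"
    unfolding sign_avg_add sign_avg_cmult sign_avg_square v(2) by simp
  also have "\<dots> = v" using v(1) by (simp add: power2_eq_square)
  finally show ?thesis by (simp add: v_def)
qed

text \<open>
  Hoeffding's lemma for a fair coin with values \<open>\<plusminus> x\<close>, in the analytic form with
  \<open>p = 1 / 2\<close> and step \<open>2 x\<close>.
\<close>

lemma cosh_le_exp_half_square: "(exp x + exp (- x)) / 2 \<le> exp (x\<^sup>2 / 2)" for x :: real
proof -
  have pos: "(exp x + exp (- x)) / 2 \<le> exp (x\<^sup>2 / 2)" if "x \<ge> 0" for x :: real
  proof -
    have "- (2 * x) * (1 / 2) + ln (1 + (1 / 2) * (exp (2 * x) - 1)) \<le> (2 * x)\<^sup>2 / 8"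
      using Hoeffdings_lemma_aux[of "2 * x" "1 / 2"] that by simp
    then have "ln ((exp (2 * x) + 1) / 2) \<le> x + x\<^sup>2 / 2"
      by (simp add: power2_eq_square field_simps)
    then have "exp (ln ((exp (2 * x) + 1) / 2)) \<le> exp (x + x\<^sup>2 / 2)"
      by simp
    moreover have "exp (ln ((exp (2 * x) + 1) / 2)) = (exp (2 * x) + 1) / 2"
      by (intro exp_ln) (auto intro!: add_pos_pos)
    ultimately have "(exp (2 * x) + 1) / 2 \<le> exp x * exp (x\<^sup>2 / 2)"
      by (simp add: exp_add)
    then have "exp (- x) * ((exp (2 * x) + 1) / 2) \<le> exp (- x) * (exp x * exp (x\<^sup>2 / 2))"
      by (intro mult_left_mono) auto
    also have "exp (- x) * (exp x * exp (x\<^sup>2 / 2)) = exp (x\<^sup>2 / 2)"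
      by (simp flip: exp_add)
    also have "exp (- x) * ((exp (2 * x) + 1) / 2) = (exp (- x) * exp (2 * x) + exp (- x)) / 2"
      by (simp add: ring_distribs)
    also have "exp (- x) * exp (2 * x) = exp x"
      by (simp flip: exp_add)
    finally show ?thesis .
  qed
  show ?thesis using pos[of x] pos[of "- x"] by (cases "x \<ge> 0") (auto simp: add.commute)
qed

lemma sign_avg_exp_le:
  "sign_avg n (\<lambda>e. exp (\<Sum>i<n. e i * x i)) \<le> exp ((\<Sum>i<n. (x i)\<^sup>2) / 2)"
proof (induction n)
  case (Suc n)
  have "sign_avg (Suc n) (\<lambda>e. exp (\<Sum>i<Suc n. e i * x i))
    = (exp (x n) + exp (- x n)) / 2 * sign_avg n (\<lambda>e. exp (\<Sum>i<n. e i * x i))"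
    by (simp add: exp_add mult.commute[of "exp (sum _ _)"] sign_avg_cmult
        del: fun_upd_apply) (simp add: algebra_simps add_divide_distrib sign_avg_cmult exp_diff exp_minus)
  also have "\<dots> \<le> exp ((x n)\<^sup>2 / 2) * exp ((\<Sum>i<n. (x i)\<^sup>2) / 2)"
    by (intro mult_mono cosh_le_exp_half_square Suc) (auto intro: order_trans[OF _ sign_avg_mono[of "\<lambda>_. 0"]])
  finally show ?case by (simp add: add_divide_distrib exp_add mult.commute)
qed simp

lemma MAX_attained:
  assumes "finite T" "T \<noteq> {}"
  shows "\<exists>t\<in>T. (MAX t\<in>T. f t) = f t"
proof -
  have "Max (f ` T) \<in> f ` T" using assms by (intro Max_in) auto
  then obtain t where "t \<in> T" "Max (f ` T) = f t" by (elim imageE)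
  then show ?thesis by (intro bexI)
qed

text \<open>
  Massart's finite class lemma: the exponential of the maximum is at most the sum of the exponentials, each of
  which is subgaussian.
\<close>

lemma sign_avg_Max_le:
  fixes x :: "'u \<Rightarrow> nat \<Rightarrow> real"
  assumes U: "finite U" "U \<noteq> {}" and b: "exp b \<ge> card U" "b > 0" and V: "V > 0"
    and x: "\<And>u. u \<in> U \<Longrightarrow> (\<Sum>i<n. (x u i)\<^sup>2) \<le> V"
  shows "sign_avg n (\<lambda>e. MAX u\<in>U. \<Sum>i<n. e i * x u i) \<le> sqrt (2 * b * V)"
proof -
  \<comment> \<open>\<open>l\<close> minimizes \<open>(b + l\<^sup>2 V / 2) / l\<close>, and \<open>c\<close> is the value of the numerator there\<close>
  define l where "l = sqrt (2 * b / V)"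
  define c where "c = 2 * b"
  have l: "l > 0" "l\<^sup>2 = 2 * b / V" using b V by (auto simp: l_def)
  have le: "l * (MAX u\<in>U. \<Sum>i<n. e i * x u i)
      \<le> exp (- c) * (\<Sum>u\<in>U. exp (\<Sum>i<n. e i * (l * x u i))) + (c - 1)" for e
  proof -
    obtain u where u: "u \<in> U" "(MAX u\<in>U. \<Sum>i<n. e i * x u i) = (\<Sum>i<n. e i * x u i)"
      using MAX_attained[OF U, of "\<lambda>u. \<Sum>i<n. e i * x u i"] by blast
    define y where "y = (\<Sum>i<n. e i * (l * x u i))"
    \<comment> \<open>the tangent line of \<open>exp\<close> at \<open>c\<close> takes the place of Jensen's inequality for the logarithm\<close>
    have "y - c + 1 \<le> exp (- c) * exp y"
      using exp_ge_add_one_self[of "y - c"] exp_add[of "- c" y] by (simp add: algebra_simps)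
    also have "\<dots> \<le> exp (- c) * (\<Sum>u\<in>U. exp (\<Sum>i<n. e i * (l * x u i)))"
      unfolding y_def using U u by (intro mult_left_mono member_le_sum) auto
    finally show ?thesis by (simp add: u y_def sum_distrib_left algebra_simps)
  qed
  have "l * sign_avg n (\<lambda>e. MAX u\<in>U. \<Sum>i<n. e i * x u i)
      \<le> sign_avg n (\<lambda>e. exp (- c) * (\<Sum>u\<in>U. exp (\<Sum>i<n. e i * (l * x u i))) + (c - 1))"
    unfolding sign_avg_cmult[symmetric] by (intro sign_avg_mono le)
  also have "\<dots> = exp (- c) * (\<Sum>u\<in>U. sign_avg n (\<lambda>e. exp (\<Sum>i<n. e i * (l * x u i)))) + (c - 1)"
    unfolding sign_avg_add sign_avg_cmult sign_avg_sum by simp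
  also have "\<dots> \<le> exp (- c) * (\<Sum>u\<in>U. exp b) + (c - 1)"
  proof (intro add_right_mono mult_left_mono sum_mono)
    fix u assume u: "u \<in> U"
    have "sign_avg n (\<lambda>e. exp (\<Sum>i<n. e i * (l * x u i))) \<le> exp ((\<Sum>i<n. (l * x u i)\<^sup>2) / 2)"
      by (rule sign_avg_exp_le)
    also have "(\<Sum>i<n. (l * x u i)\<^sup>2) = l\<^sup>2 * (\<Sum>i<n. (x u i)\<^sup>2)"
      by (simp add: sum_distrib_left power_mult_distrib)
    also have "\<dots> \<le> l\<^sup>2 * V" by (intro mult_left_mono x u) auto
    also have "\<dots> = 2 * b" using V by (simp add: l)
    finally show "sign_avg n (\<lambda>e. exp (\<Sum>i<n. e i * (l * x u i))) \<le> exp b" by simp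
  qed auto
  also have "\<dots> \<le> exp (- c) * (exp b * exp b) + (c - 1)"
    using b by (intro add_right_mono mult_left_mono) auto
  also have "\<dots> = 2 * b" by (simp add: c_def flip: exp_add)
  finally have "sign_avg n (\<lambda>e. MAX u\<in>U. \<Sum>i<n. e i * x u i) \<le> 2 * b / l"
    using l by (simp add: field_simps)
  also have "2 * b / l = sqrt (2 * b * V)"
  proof -
    have "sqrt (2 * b * V) * l = sqrt ((2 * b * V) * (2 * b / V))"
      unfolding l_def by (rule real_sqrt_mult[symmetric])
    also have "(2 * b * V) * (2 * b / V) = (2 * b)\<^sup>2" using V by (simp add: power2_eq_square)
    also have "sqrt \<dots> = 2 * b" using b by (intro real_sqrt_unique) auto
    finally show ?thesis using l by (simp add: field_simps)
  qed
  finally show ?thesis .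
qed

text \<open>
  Only the values of \<open>\<phi>\<close> at the two maximizers \<open>p\<close> and \<open>q\<close> enter,
  and \<open>\<phi> (u p) - \<phi> (u q)\<close> is at most \<open>m \<bar>u p - u q\<bar>\<close>.
  According to the sign of \<open>u p - u q\<close>, the pair \<open>(p, q)\<close> or
  \<open>(q, p)\<close> is a competitor for the two maxima on the right.
\<close>

lemma Max_contraction_step:
  fixes A u :: "'t \<Rightarrow> real"
  assumes T: "finite T" "T \<noteq> {}" and \<phi>: "\<And>x y. \<bar>\<phi> x - \<phi> y\<bar> \<le> m * \<bar>x - y\<bar>"
  shows "(MAX t\<in>T. A t + \<phi> (u t)) + (MAX t\<in>T. A t - \<phi> (u t))
    \<le> (MAX t\<in>T. A t + m * u t) + (MAX t\<in>T. A t - m * u t)"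
proof -
  obtain p where p: "p \<in> T" "(MAX t\<in>T. A t + \<phi> (u t)) = A p + \<phi> (u p)"
    using MAX_attained[OF T, of "\<lambda>t. A t + \<phi> (u t)"] by (elim bexE)
  obtain q where q: "q \<in> T" "(MAX t\<in>T. A t - \<phi> (u t)) = A q - \<phi> (u q)"
    using MAX_attained[OF T, of "\<lambda>t. A t - \<phi> (u t)"] by (elim bexE)
  have M: "A t + m * u t \<le> (MAX t\<in>T. A t + m * u t)" "A t - m * u t \<le> (MAX t\<in>T. A t - m * u t)"
    if "t \<in> T" for t using that T by (intro Max_ge; simp)+
  have "\<phi> (u p) - \<phi> (u q) \<le> m * \<bar>u p - u q\<bar>" using \<phi>[of "u p" "u q"] by linarith
  moreover have "m * \<bar>u p - u q\<bar> = m * u p - m * u q \<or> m * \<bar>u p - u q\<bar> = m * u q - m * u p"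
    by (auto simp: abs_if algebra_simps)
  ultimately show ?thesis
    using M[OF p(1)] M[OF q(1)] p(2) q(2) by linarith
qed

text \<open>
  The Ledoux-Talagrand contraction principle. The signs are treated one at a time; the offset \<open>A\<close>
  absorbs the terms of the other signs, so it has to be arbitrary in the induction.
\<close>

lemma sign_avg_contraction:
  fixes A :: "'t \<Rightarrow> real" and u :: "'t \<Rightarrow> nat \<Rightarrow> real"
  assumes T: "finite T" "T \<noteq> {}" and \<phi>: "\<And>x y. \<bar>\<phi> x - \<phi> y\<bar> \<le> m * \<bar>x - y\<bar>"
  shows "sign_avg n (\<lambda>e. MAX t\<in>T. A t + (\<Sum>i<n. e i * \<phi> (u t i)))
    \<le> sign_avg n (\<lambda>e. MAX t\<in>T. A t + (\<Sum>i<n. e i * (m * u t i)))"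
proof (induction n arbitrary: A)
  case (Suc n)
  define B where "B e t = A t + (\<Sum>i<n. e i * (m * u t i))" for e t
  have upd: "(MAX t\<in>T. A t + (\<Sum>i<Suc n. (e(n := c)) i * w t i))
      = (MAX t\<in>T. (A t + c * w t n) + (\<Sum>i<n. e i * w t i))" for e c and w :: "'t \<Rightarrow> nat \<Rightarrow> real"
    unfolding sum.lessThan_Suc sum_upd_top by (simp add: ac_simps)
  have eq1: "(A t + 1 * v) + (\<Sum>i<n. e i * (m * u t i)) = B e t + v"
    and eq2: "(A t + (- 1) * v) + (\<Sum>i<n. e i * (m * u t i)) = B e t - v" for e t v
    by (simp_all add: B_def)
  have "sign_avg (Suc n) (\<lambda>e. MAX t\<in>T. A t + (\<Sum>i<Suc n. e i * \<phi> (u t i)))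
    = (sign_avg n (\<lambda>e. MAX t\<in>T. (A t + 1 * \<phi> (u t n)) + (\<Sum>i<n. e i * \<phi> (u t i)))
      + sign_avg n (\<lambda>e. MAX t\<in>T. (A t + (- 1) * \<phi> (u t n)) + (\<Sum>i<n. e i * \<phi> (u t i)))) / 2"
    unfolding sign_avg.simps upd ..
  also have "\<dots> \<le> (sign_avg n (\<lambda>e. MAX t\<in>T. (A t + 1 * \<phi> (u t n)) + (\<Sum>i<n. e i * (m * u t i)))
      + sign_avg n (\<lambda>e. MAX t\<in>T. (A t + (- 1) * \<phi> (u t n)) + (\<Sum>i<n. e i * (m * u t i)))) / 2"
    by (intro divide_right_mono add_mono Suc.IH) auto
  also have "\<dots> = (sign_avg n (\<lambda>e. MAX t\<in>T. B e t + \<phi> (u t n))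
      + sign_avg n (\<lambda>e. MAX t\<in>T. B e t - \<phi> (u t n))) / 2"
    unfolding eq1 eq2 ..
  also have "\<dots> \<le> (sign_avg n (\<lambda>e. MAX t\<in>T. B e t + m * u t n)
      + sign_avg n (\<lambda>e. MAX t\<in>T. B e t - m * u t n)) / 2"
    unfolding sign_avg_add[symmetric]
    by (intro divide_right_mono sign_avg_mono Max_contraction_step T \<phi>) auto
  also have "\<dots> = (sign_avg n (\<lambda>e. MAX t\<in>T. (A t + 1 * (m * u t n)) + (\<Sum>i<n. e i * (m * u t i)))
      + sign_avg n (\<lambda>e. MAX t\<in>T. (A t + (- 1) * (m * u t n)) + (\<Sum>i<n. e i * (m * u t i)))) / 2"
    unfolding eq1 eq2 ..
  also have "\<dots> = sign_avg (Suc n) (\<lambda>e. MAX t\<in>T. A t + (\<Sum>i<Suc n. e i * (m * u t i)))"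
    unfolding sign_avg.simps upd ..
  finally show ?case .
qed simp

section \<open>Norms, dual norms and nets\<close>

context
  fixes \<nu> :: "'a::real_vector \<Rightarrow> real"
  assumes \<nu>: "is_norm \<nu>"
begin

lemma is_norm_triangle: "\<nu> (x + y) \<le> \<nu> x + \<nu> y"
  using \<nu> by (auto simp: is_norm_def)

lemma is_norm_scale: "\<nu> (c *\<^sub>R x) = \<bar>c\<bar> * \<nu> x"
  using \<nu> by (auto simp: is_norm_def)

lemma is_norm_eq_0_iff: "\<nu> x = 0 \<longleftrightarrow> x = 0"
  using \<nu> by (auto simp: is_norm_def)

lemma is_norm_zero: "\<nu> 0 = 0"
  using is_norm_eq_0_iff by simp

lemma is_norm_uminus: "\<nu> (- x) = \<nu> x"
  using is_norm_scale[of "-1" x] by simp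

lemma is_norm_nonneg: "0 \<le> \<nu> x"
  using is_norm_triangle[of x "- x"] is_norm_uminus[of x] is_norm_zero by simp

lemma is_norm_pos: "x \<noteq> 0 \<Longrightarrow> 0 < \<nu> x"
  using is_norm_nonneg[of x] is_norm_eq_0_iff[of x] by linarith

end

lemma is_norm_continuous:
  fixes \<nu> :: "'a::euclidean_space \<Rightarrow> real"
  assumes \<nu>: "is_norm \<nu>"
  shows "continuous_on A \<nu>"
proof -
  have "convex_on UNIV \<nu>"
  proof (rule convex_onI)
    fix t x y
    assume "0 < t" "t < (1::real)"
    then show "\<nu> ((1 - t) *\<^sub>R x + t *\<^sub>R y) \<le> (1 - t) * \<nu> x + t * \<nu> y"
      using is_norm_triangle[OF \<nu>, of "(1 - t) *\<^sub>R x" "t *\<^sub>R y"] by (simp add: is_norm_scale[OF \<nu>])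
  qed auto
  then have "continuous_on UNIV \<nu>" by (intro convex_on_continuous) auto
  then show ?thesis by (rule continuous_on_subset) auto
qed

text \<open>
  Equivalence with the Euclidean norm, by compactness of the Euclidean sphere. It makes dual norms finite and
  unit balls bounded.
\<close>

lemma is_norm_lower_bound:
  fixes \<nu> :: "'a::euclidean_space \<Rightarrow> real"
  assumes \<nu>: "is_norm \<nu>"
  obtains c where "c > 0" "\<And>x. c * norm x \<le> \<nu> x"
proof -
  have "sphere (0::'a) 1 \<noteq> {}" by simp
  from continuous_attains_inf[OF compact_sphere this is_norm_continuous[OF \<nu>]]
  obtain x0 where x0: "x0 \<in> sphere 0 1" "\<And>y. y \<in> sphere 0 1 \<Longrightarrow> \<nu> x0 \<le> \<nu> y" by blast
  show ?thesis
  proof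
    show "\<nu> x0 > 0" using x0(1) by (intro is_norm_pos[OF \<nu>]) auto
    show "\<nu> x0 * norm x \<le> \<nu> x" for x
    proof (cases "x = 0")
      case False
      then have "\<nu> x0 \<le> \<nu> ((1 / norm x) *\<^sub>R x)" by (intro x0(2)) simp
      also have "\<dots> = \<nu> x / norm x" by (simp add: is_norm_scale[OF \<nu>])
      finally show ?thesis using False by (simp add: field_simps)
    qed (simp add: is_norm_zero[OF \<nu>])
  qed
qed

context
  fixes \<nu> :: "'a::euclidean_space \<Rightarrow> real"
  assumes \<nu>: "is_norm \<nu>"
begin

lemma bdd_above_dual: "bdd_above ((\<lambda>x. x \<bullet> y) ` {x. \<nu> x \<le> 1})"
proof -
  obtain c where c: "c > 0" "\<And>x. c * norm x \<le> \<nu> x" using is_norm_lower_bound[OF \<nu>] by blast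
  have "x \<bullet> y \<le> (1 / c) * norm y" if "\<nu> x \<le> 1" for x
  proof -
    have "norm x \<le> 1 / c" using c(1) c(2)[of x] that by (simp add: field_simps)
    then have "norm x * norm y \<le> (1 / c) * norm y" by (intro mult_right_mono) auto
    with norm_cauchy_schwarz[of x y] show ?thesis by linarith
  qed
  then show ?thesis by (intro bdd_aboveI2) auto
qed

lemma inner_le_dual_norm_unit: "\<nu> x \<le> 1 \<Longrightarrow> x \<bullet> y \<le> dual_norm \<nu> y"
  unfolding dual_norm_def by (intro cSUP_upper bdd_above_dual) auto

lemma dual_norm_nonneg: "0 \<le> dual_norm \<nu> y"
  using inner_le_dual_norm_unit[of 0 y] by (simp add: is_norm_zero[OF \<nu>])

lemma dual_norm_least: "(\<And>x. \<nu> x \<le> 1 \<Longrightarrow> x \<bullet> y \<le> C) \<Longrightarrow> dual_norm \<nu> y \<le> C"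
  unfolding dual_norm_def using is_norm_zero[OF \<nu>] by (intro cSUP_least) (auto intro: exI[of _ 0])

lemma inner_le_dual_norm: "x \<bullet> y \<le> \<nu> x * dual_norm \<nu> y"
proof (cases "x = 0")
  case False
  then have pos: "\<nu> x > 0" by (rule is_norm_pos[OF \<nu>])
  have "((1 / \<nu> x) *\<^sub>R x) \<bullet> y \<le> dual_norm \<nu> y"
    using pos by (intro inner_le_dual_norm_unit) (simp add: is_norm_scale[OF \<nu>])
  then show ?thesis using pos by (simp add: field_simps)
qed (simp add: is_norm_zero[OF \<nu>])

lemma abs_inner_le_dual_norm: "\<bar>x \<bullet> y\<bar> \<le> \<nu> x * dual_norm \<nu> y"
  using inner_le_dual_norm[of x y] inner_le_dual_norm[of "- x" y]
  by (simp add: is_norm_uminus[OF \<nu>] abs_le_iff)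

lemma is_norm_dual_norm: "is_norm (dual_norm \<nu>)"
  unfolding is_norm_def
proof (intro conjI allI)
  have scale_le: "dual_norm \<nu> (c *\<^sub>R y) \<le> \<bar>c\<bar> * dual_norm \<nu> y" for c y
  proof (rule dual_norm_least)
    fix x assume x: "\<nu> x \<le> 1"
    have "x \<bullet> (c *\<^sub>R y) \<le> \<bar>c\<bar> * \<bar>x \<bullet> y\<bar>"
      using abs_ge_self[of "c * (x \<bullet> y)"] by (simp add: abs_mult)
    also have "\<dots> \<le> \<bar>c\<bar> * (1 * dual_norm \<nu> y)"
    proof (rule mult_left_mono)
      show "\<bar>x \<bullet> y\<bar> \<le> 1 * dual_norm \<nu> y"
        using abs_inner_le_dual_norm[of x y] mult_right_mono[OF x dual_norm_nonneg[of y]] by linarith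
    qed simp
    finally show "x \<bullet> (c *\<^sub>R y) \<le> \<bar>c\<bar> * dual_norm \<nu> y" by simp
  qed
  show scale: "dual_norm \<nu> (c *\<^sub>R y) = \<bar>c\<bar> * dual_norm \<nu> y" for c y
  proof (rule antisym[OF scale_le])
    show "\<bar>c\<bar> * dual_norm \<nu> y \<le> dual_norm \<nu> (c *\<^sub>R y)"
    proof (cases "c = 0")
      case False
      then show ?thesis
        using scale_le[of "1 / c" "c *\<^sub>R y"] by (simp add: field_simps)
    qed (simp add: dual_norm_nonneg)
  qed
  show "dual_norm \<nu> (y + z) \<le> dual_norm \<nu> y + dual_norm \<nu> z" for y z
    by (rule dual_norm_least) (simp add: inner_add_right inner_le_dual_norm_unit add_mono)
  show "dual_norm \<nu> y = 0 \<longleftrightarrow> y = 0" for y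
  proof
    assume "dual_norm \<nu> y = 0"
    then have "y \<bullet> y \<le> 0" using inner_le_dual_norm[of y y] by simp
    then show "y = 0" using inner_ge_zero[of y] inner_eq_zero_iff[of y] by linarith
  next
    assume "y = 0"
    then show "dual_norm \<nu> y = 0" using scale[of 0 y] by simp
  qed
qed

end

text \<open>
  Volume comparison: the balls of radius \<open>1 / 4\<close> around the points are disjoint and lie in the
  ball of radius \<open>5 / 4\<close>.
\<close>

lemma card_le_of_separated:
  fixes \<mu> :: "'a::euclidean_space \<Rightarrow> real"
  assumes \<mu>: "is_norm \<mu>" and S: "finite S" "\<And>u. u \<in> S \<Longrightarrow> \<mu> u \<le> 1"
    and sep: "\<And>u v. u \<in> S \<Longrightarrow> v \<in> S \<Longrightarrow> u \<noteq> v \<Longrightarrow> \<mu> (u - v) > 1 / 2"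
  shows "card S \<le> 5 ^ DIM('a)"
proof -
  let ?n = "DIM('a)"
  define B where "B = {x. \<mu> x < 1}"
  obtain c where c: "c > 0" "\<And>x. c * norm x \<le> \<mu> x" using is_norm_lower_bound[OF \<mu>] by blast
  have "open B"
    unfolding B_def by (intro open_Collect_less is_norm_continuous[OF \<mu>] continuous_on_const)
  have "bounded B"
    unfolding bounded_iff
  proof (intro exI ballI)
    fix x assume "x \<in> B"
    then have "c * norm x < 1" using c(2)[of x] by (simp add: B_def)
    then show "norm x \<le> 1 / c" using c(1) by (simp add: field_simps)
  qed
  have B: "B \<in> lmeasurable"
    using \<open>bounded B\<close> \<open>open B\<close> by (rule lmeasurable_open)
  have "0 \<in> B" by (simp add: B_def is_norm_zero[OF \<mu>])
  then obtain r where r: "r > 0" "ball 0 r \<subseteq> B" using \<open>open B\<close> open_contains_ball by blast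
  have "0 < measure lebesgue (ball (0::'a) r)"
    using content_ball_pos[OF r(1)] by (simp add: measure_completion)
  also have "\<dots> \<le> measure lebesgue B" by (intro measure_mono_fmeasurable r B) auto
  finally have v: "measure lebesgue B > 0" .
  define f where "f a u x = a *\<^sub>R x + u" for a :: real and u x :: 'a
  have meas: "measure lebesgue (f a u ` B) = a ^ ?n * measure lebesgue B" if "a > 0" for a u
    using that measure_lebesgue_affine[of a u B] by (simp add: f_def)
  have in_f: "x \<in> f a u ` B \<longleftrightarrow> \<mu> (x - u) < a" if "a > 0" for a u x
  proof
    assume "x \<in> f a u ` B"
    then show "\<mu> (x - u) < a" using that by (auto simp: f_def B_def is_norm_scale[OF \<mu>])
  next
    assume "\<mu> (x - u) < a"
    then have "x = f a u ((1 / a) *\<^sub>R (x - u))" "(1 / a) *\<^sub>R (x - u) \<in> B"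
      using that by (auto simp: f_def B_def is_norm_scale[OF \<mu>])
    then show "x \<in> f a u ` B" by blast
  qed
  have lm: "f a u ` B \<in> lmeasurable" if "a > 0" for a u
  proof (rule fmeasurableI)
    have "f a u ` B = {x. \<mu> (x - u) < a}" using in_f[OF that] by blast
    moreover have "open {x. \<mu> (x - u) < a}"
      by (intro open_Collect_less continuous_on_const continuous_on_compose2[OF is_norm_continuous[OF \<mu>]]
          continuous_intros) auto
    ultimately show "f a u ` B \<in> sets lebesgue" by auto
    show "emeasure lebesgue (f a u ` B) < \<infinity>"
      using emeasure_lebesgue_affine[of a u B] fmeasurableD2[OF B]
      by (auto simp: f_def ennreal_mult_less_top less_top power_less_top_ennreal)
  qed
  have disj: "disjoint_family_on (\<lambda>u. f (1 / 4) u ` B) S"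
    unfolding disjoint_family_on_def
  proof (intro ballI impI, rule ccontr)
    fix u v assume uv: "u \<in> S" "v \<in> S" "u \<noteq> v" and "f (1 / 4) u ` B \<inter> f (1 / 4) v ` B \<noteq> {}"
    then obtain x where x: "\<mu> (x - u) < 1 / 4" "\<mu> (x - v) < 1 / 4" using in_f[of "1 / 4"] by auto
    have "\<mu> (u - v) \<le> \<mu> (x - v) + \<mu> (- (x - u))"
      using is_norm_triangle[OF \<mu>, of "x - v" "- (x - u)"] by simp
    with x sep[OF uv] show False by (simp only: is_norm_uminus[OF \<mu>])
  qed
  have "card S * ((1 / 4) ^ ?n * measure lebesgue B) = measure lebesgue (\<Union>u\<in>S. f (1 / 4) u ` B)"
  proof (subst measure_finite_Union[OF S(1) _ disj])
    show "(\<lambda>u. f (1 / 4) u ` B) ` S \<subseteq> sets lebesgue"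
      using fmeasurableD[OF lm[of "1 / 4"]] by auto
    show "emeasure lebesgue (f (1 / 4) u ` B) \<noteq> \<infinity>" for u
      using fmeasurableD2[OF lm[of "1 / 4"]] by simp
    show "card S * ((1 / 4) ^ ?n * measure lebesgue B) = (\<Sum>u\<in>S. measure lebesgue (f (1 / 4) u ` B))"
      by (simp only: meas[of "1 / 4"] sum_constant zero_less_divide_1_iff zero_less_numeral)
  qed
  also have "\<dots> \<le> measure lebesgue (f (5 / 4) 0 ` B)"
  proof (intro measure_mono_fmeasurable lm)
    show "(\<Union>u\<in>S. f (1 / 4) u ` B) \<subseteq> f (5 / 4) 0 ` B"
    proof
      fix x assume "x \<in> (\<Union>u\<in>S. f (1 / 4) u ` B)"
      then obtain u where u: "u \<in> S" "\<mu> (x - u) < 1 / 4" using in_f[of "1 / 4"] by auto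
      have "\<mu> x \<le> \<mu> (x - u) + \<mu> u" using is_norm_triangle[OF \<mu>, of "x - u" u] by simp
      also have "\<dots> < 5 / 4" using u S(2)[of u] by simp
      finally show "x \<in> f (5 / 4) 0 ` B" by (simp add: in_f)
    qed
    show "(\<Union>u\<in>S. f (1 / 4) u ` B) \<in> sets lebesgue"
      by (intro sets.finite_UN S(1) fmeasurableD[OF lm]) simp
  qed auto
  also have "\<dots> = (5 / 4) ^ ?n * measure lebesgue B" by (rule meas) simp
  finally have "card S * (1 / 4) ^ ?n \<le> (5 / 4 :: real) ^ ?n" using v by simp
  then have "real (card S) \<le> 5 ^ ?n" by (simp add: field_simps power_divide)
  then show ?thesis by (metis of_nat_le_iff of_nat_power of_nat_numeral)
qed

text \<open>
  A separated subset of the unit ball with as many points as possible is a net, since any uncovered point could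
  be added to it.
\<close>

lemma exists_half_net:
  fixes \<mu> :: "'a::euclidean_space \<Rightarrow> real"
  assumes \<mu>: "is_norm \<mu>"
  obtains U where "finite U" "U \<noteq> {}" "card U \<le> 5 ^ DIM('a)" "\<And>u. u \<in> U \<Longrightarrow> \<mu> u \<le> 1"
    "\<And>w. \<mu> w \<le> 1 \<Longrightarrow> \<exists>u\<in>U. \<mu> (w - u) \<le> 1 / 2"
proof -
  define sep where "sep S \<longleftrightarrow> finite S \<and> (\<forall>u\<in>S. \<mu> u \<le> 1) \<and>
    (\<forall>u\<in>S. \<forall>v\<in>S. u \<noteq> v \<longrightarrow> \<mu> (u - v) > 1 / 2)" for S
  have le: "card S \<le> 5 ^ DIM('a)" if "sep S" for S
    using that unfolding sep_def by (intro card_le_of_separated[OF \<mu>]) auto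
  have "sep {0}" by (simp add: sep_def is_norm_zero[OF \<mu>])
  then obtain U where U: "sep U" "\<And>S. sep S \<Longrightarrow> card S \<le> card U"
    using ex_has_greatest_nat[of sep "{0}" card "Suc (5 ^ DIM('a))"] le by (auto simp: less_Suc_eq_le)
  show thesis
  proof
    show fin: "finite U" and "\<And>u. u \<in> U \<Longrightarrow> \<mu> u \<le> 1" using U(1) by (auto simp: sep_def)
    show "card U \<le> 5 ^ DIM('a)" using le U(1) .
    show "U \<noteq> {}" using U(2)[OF \<open>sep {0}\<close>] by auto
    fix w assume w: "\<mu> w \<le> 1"
    show "\<exists>u\<in>U. \<mu> (w - u) \<le> 1 / 2"
    proof (rule ccontr)
      assume *: "\<not> (\<exists>u\<in>U. \<mu> (w - u) \<le> 1 / 2)"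
      then have "w \<notin> U" using is_norm_zero[OF \<mu>] by force
      have far: "\<mu> (w - u) > 1 / 2" "\<mu> (u - w) > 1 / 2" if "u \<in> U" for u
        using * that is_norm_uminus[OF \<mu>, of "w - u"] by (auto simp: not_le)
      have "sep (insert w U)" using U(1) w far unfolding sep_def by auto
      from U(2)[OF this] show False using fin \<open>w \<notin> U\<close> by simp
    qed
  qed
qed

text \<open>
  The supremum of \<open>v \<bullet> x\<close> over the dual ball is at most twice the maximum over a
  \<open>1 / 2\<close>-net: the error of replacing \<open>v\<close> by a net point is at most half of the same
  supremum. The net has at most \<open>5 ^ D \<le> exp (2 D)\<close> points, \<open>D = DIM('a)\<close>,
  so the finite class lemma costs a factor \<open>2 sqrt D\<close>. This is where the dimension enters, with
  the rate \<open>sqrt D\<close> for an arbitrary norm.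
\<close>

lemma sign_avg_Max_inner_le:
  fixes \<nu> :: "'a::euclidean_space \<Rightarrow> real" and z :: "nat \<Rightarrow> 'a"
  assumes \<nu>: "is_norm \<nu>" and T: "finite T" "T \<noteq> {}" and w: "\<And>t. t \<in> T \<Longrightarrow> dual_norm \<nu> (w t) \<le> 1"
  shows "sign_avg n (\<lambda>e. MAX t\<in>T. \<Sum>i<n. e i * (w t \<bullet> z i))
    \<le> 4 * sqrt DIM('a) * sqrt (\<Sum>i<n. (\<nu> (z i))\<^sup>2)"
proof -
  let ?\<mu> = "dual_norm \<nu>" and ?V = "\<Sum>i<n. (\<nu> (z i))\<^sup>2"
  have \<mu>: "is_norm ?\<mu>" by (rule is_norm_dual_norm[OF \<nu>])
  obtain U where U: "finite U" "U \<noteq> {}" "card U \<le> 5 ^ DIM('a)" "\<And>u. u \<in> U \<Longrightarrow> ?\<mu> u \<le> 1"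
    "\<And>w. ?\<mu> w \<le> 1 \<Longrightarrow> \<exists>u\<in>U. ?\<mu> (w - u) \<le> 1 / 2"
    using exists_half_net[OF \<mu>] by blast
  have net: "v \<bullet> x \<le> 2 * (MAX u\<in>U. u \<bullet> x)" if "?\<mu> v \<le> 1" for v x
  proof -
    define S where "S = (SUP v\<in>{v. ?\<mu> v \<le> 1}. v \<bullet> x)"
    have bdd: "bdd_above ((\<lambda>v. v \<bullet> x) ` {v. ?\<mu> v \<le> 1})" by (rule bdd_above_dual[OF \<mu>])
    have le_S: "v \<bullet> x \<le> S" if "?\<mu> v \<le> 1" for v
      unfolding S_def by (intro cSUP_upper bdd) (use that in auto)
    have "v \<bullet> x \<le> (MAX u\<in>U. u \<bullet> x) + S / 2" if v: "?\<mu> v \<le> 1" for v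
    proof -
      obtain u where u: "u \<in> U" "?\<mu> (v - u) \<le> 1 / 2" using U(5)[OF v] by blast
      have "?\<mu> (2 *\<^sub>R (v - u)) \<le> 1" using u(2) by (simp add: is_norm_scale[OF \<mu>])
      then have "2 * ((v - u) \<bullet> x) \<le> S" using le_S by fastforce
      moreover have "u \<bullet> x \<le> (MAX u\<in>U. u \<bullet> x)" using U(1) u(1) by (intro Max_ge) auto
      ultimately show ?thesis by (simp add: inner_diff_left)
    qed
    then have "S \<le> (MAX u\<in>U. u \<bullet> x) + S / 2"
      unfolding S_def[symmetric] using is_norm_zero[OF \<mu>]
      by (subst S_def, intro cSUP_least) (auto intro: exI[of _ 0])
    with le_S[OF that] show ?thesis by simp
  qed
  show ?thesis
  proof (cases "?V = 0")
    case True
    then have "\<forall>i\<in>{..<n}. z i = 0"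
      by (subst (asm) sum_nonneg_eq_0_iff) (auto simp: is_norm_eq_0_iff[OF \<nu>])
    then have "(\<Sum>i<n. e i * (w t \<bullet> z i)) = 0" for e :: "nat \<Rightarrow> real" and t by simp
    then show ?thesis using T True by simp
  next
    case False
    then have V: "?V > 0" by (intro order_neq_le_trans sum_nonneg) auto
    have "sign_avg n (\<lambda>e. MAX t\<in>T. \<Sum>i<n. e i * (w t \<bullet> z i))
        \<le> sign_avg n (\<lambda>e. 2 * (MAX u\<in>U. \<Sum>i<n. e i * (u \<bullet> z i)))"
    proof (rule sign_avg_mono)
      fix e :: "nat \<Rightarrow> real"
      have eq: "(\<Sum>i<n. e i * (u \<bullet> z i)) = u \<bullet> (\<Sum>i<n. e i *\<^sub>R z i)" for u
        by (simp add: inner_sum_right)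
      show "(MAX t\<in>T. \<Sum>i<n. e i * (w t \<bullet> z i)) \<le> 2 * (MAX u\<in>U. \<Sum>i<n. e i * (u \<bullet> z i))"
        unfolding eq using T by (intro Max.boundedI) (auto intro: net w)
    qed
    also have "\<dots> = 2 * sign_avg n (\<lambda>e. MAX u\<in>U. \<Sum>i<n. e i * (u \<bullet> z i))"
      by (rule sign_avg_cmult)
    also have "\<dots> \<le> 2 * sqrt (2 * (2 * real DIM('a)) * ?V)"
    proof (intro mult_left_mono sign_avg_Max_le U(1,2) V)
      have "(5::real) \<le> exp 2" using exp_lower_Taylor_quadratic[of 2] by simp
      have "real (card U) \<le> real (5 ^ DIM('a))" using U(3) by (simp only: of_nat_le_iff)
      also have "\<dots> = 5 ^ DIM('a)" by simp
      also have "(5::real) ^ DIM('a) \<le> exp 2 ^ DIM('a)" by (intro power_mono \<open>5 \<le> exp 2\<close>) auto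
      also have "\<dots> = exp (2 * real DIM('a))" by (simp add: exp_of_nat2_mult)
      finally show "real (card U) \<le> exp (2 * real DIM('a))" .
      fix u assume u: "u \<in> U"
      have "\<bar>u \<bullet> z i\<bar> \<le> \<nu> (z i)" for i
      proof -
        have "\<bar>z i \<bullet> u\<bar> \<le> \<nu> (z i) * ?\<mu> u" by (rule abs_inner_le_dual_norm[OF \<nu>])
        also have "\<dots> \<le> \<nu> (z i) * 1" by (intro mult_left_mono U(4) u is_norm_nonneg[OF \<nu>])
        finally show ?thesis by (simp add: inner_commute)
      qed
      then show "(\<Sum>i<n. (u \<bullet> z i)\<^sup>2) \<le> ?V"
        by (intro sum_mono) (metis abs_ge_zero power2_abs power_mono)
    qed auto
    also have "sqrt (2 * (2 * real DIM('a)) * ?V) = 2 * sqrt DIM('a) * sqrt ?V"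
      by (simp add: real_sqrt_mult)
    finally show ?thesis by simp
  qed
qed

section \<open>Rademacher averages of the check loss\<close>

text \<open>
  With \<open>v = r / 2 - 1\<close> one has
  \<open>x powr (r / 2) = x * exp (v * ln x) \<ge> v * (x * ln x) \<ge> v * (x - 1)\<close>
  for \<open>x \<ge> 1\<close>. This inequality trades a norm for the square root of the \<open>r\<close>-th
  moment at the price of the factor \<open>2 / (r - 2)\<close>.
\<close>

lemma diff_one_le_powr:
  fixes x r :: real
  assumes "r > 2" "x \<ge> 0"
  shows "x - 1 \<le> 2 / (r - 2) * x powr (r / 2)"
proof (cases "x \<ge> 1")
  case True
  define v where "v = r / 2 - 1"
  have v: "v > 0" using assms by (simp add: v_def)
  have "ln (1 / x) \<le> 1 / x - 1" using True by (intro ln_le_minus_one) auto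
  then have "x * (1 - 1 / x) \<le> x * ln x" using True by (intro mult_left_mono) (auto simp: ln_div)
  moreover have "x * (1 - 1 / x) = x - 1" using True by (simp add: field_simps)
  ultimately have lnx: "x - 1 \<le> x * ln x" by simp
  have "v * (x - 1) \<le> x * (v * ln x)" using lnx v by (simp add: mult.left_commute)
  also have "\<dots> \<le> x * exp (v * ln x)"
  proof (rule mult_left_mono)
    show "v * ln x \<le> exp (v * ln x)" using exp_ge_add_one_self[of "v * ln x"] by linarith
  qed (use True in simp)
  also have "\<dots> = x powr (1 + v)" using True by (simp add: powr_def algebra_simps exp_add)
  finally show ?thesis using assms by (simp add: v_def field_simps)
next
  case False
  then have "x - 1 \<le> 0" by simp
  also have "\<dots> \<le> 2 / (r - 2) * x powr (r / 2)" using assms by simp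
  finally show ?thesis .
qed

lemma powr_half_square: "(x powr (r / 2))\<^sup>2 = x powr r" for x r :: real
  by (simp add: power2_eq_square flip: powr_add)

text \<open>
  Minkowski's inequality applied to \<open>a i \<le> 1 + 2 / (r - 2) * a i powr (r / 2)\<close>.
\<close>

lemma sqrt_sum_square_le:
  fixes a :: "nat \<Rightarrow> real"
  assumes r: "r > 2" and a: "\<And>i. a i \<ge> 0"
  shows "sqrt (\<Sum>i<n. (a i)\<^sup>2) \<le> sqrt n + 2 / (r - 2) * sqrt (\<Sum>i<n. a i powr r)"
proof -
  let ?k = "2 / (r - 2)"
  have "L2_set a {..<n} \<le> L2_set (\<lambda>i. 1 + ?k * a i powr (r / 2)) {..<n}"
    using diff_one_le_powr[OF r a] a by (intro L2_set_mono) (auto simp: algebra_simps)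
  also have "\<dots> \<le> L2_set (\<lambda>_. 1) {..<n} + L2_set (\<lambda>i. ?k * a i powr (r / 2)) {..<n}"
    by (rule L2_set_triangle_ineq)
  also have "L2_set (\<lambda>i. ?k * a i powr (r / 2)) {..<n} = ?k * L2_set (\<lambda>i. a i powr (r / 2)) {..<n}"
    using r by (intro L2_set_right_distrib[symmetric]) auto
  finally show ?thesis by (simp add: L2_set_def powr_half_square)
qed

lemma has_bochner_integral_powr_tail:
  fixes c :: real
  assumes "c > 1"
  shows "has_bochner_integral lborel (\<lambda>x. indicator {1..} x * x powr - c) (1 / (c - 1))"
proof (rule has_bochner_integral_nn_integral)
  have "(\<integral>\<^sup>+x. ennreal (x powr - c) * indicator {1..} x \<partial>lborel) = 0 - (1 powr (1 - c) / (1 - c))"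
  proof (rule nn_integral_FTC_atLeast[where F = "\<lambda>x. x powr (1 - c) / (1 - c)" and T = 0])
    fix x :: real assume x: "1 \<le> x"
    have "((\<lambda>x. x powr (1 - c)) has_real_derivative (1 - c) * x powr (1 - c - 1)) (at x)"
      using x by (intro has_real_derivative_powr) auto
    from DERIV_cdivide[OF this, of "1 - c"]
    show "((\<lambda>x. x powr (1 - c) / (1 - c)) has_real_derivative x powr - c) (at x)"
      using assms by simp
  next
    have "((\<lambda>x. x powr (1 - c)) \<longlongrightarrow> 0) at_top"
      using assms by (intro tendsto_neg_powr filterlim_ident) auto
    from tendsto_divide[OF this tendsto_const[of "1 - c"]] assms
    show "((\<lambda>x. x powr (1 - c) / (1 - c)) \<longlongrightarrow> 0) at_top" by simp
  qed auto
  also have "0 - (1 powr (1 - c) / (1 - c)) = 1 / (c - 1)"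
    using assms by (simp add: field_simps)
  finally have "(\<integral>\<^sup>+x. ennreal (x powr - c) * indicator {1..} x \<partial>lborel) = ennreal (1 / (c - 1))" .
  then show "(\<integral>\<^sup>+x. ennreal (indicator {1..} x * x powr - c) \<partial>lborel) = ennreal (1 / (c - 1))"
    by (simp add: indicator_mult_ennreal mult.commute)
qed (use assms in auto)

text \<open>
  For \<open>a \<ge> 0\<close>, \<open>min \<bar>s\<bar> a\<close> is the integral of the indicator of
  \<open>x < a\<close> over \<open>0 \<le> x < \<bar>s\<bar>\<close>. Hence the integral over all
  \<open>x \<ge> 0\<close> of the absolute value of the sum of the signs with \<open>a i > x\<close>
  dominates the left-hand side for all \<open>s\<close> simultaneously, without a union bound. The average of
  that absolute value is at most the root of the number of indices with \<open>a i > x\<close>, that is, at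
  most \<open>sqrt n\<close>, and for large \<open>x\<close> at most \<open>x powr (- r / 2)\<close> times
  the root of the sum of the \<open>a i powr r\<close>; since \<open>r > 2\<close> the latter is integrable
  at infinity.
\<close>

lemma sign_avg_Max_truncation_le:
  fixes a :: "nat \<Rightarrow> real"
  assumes r: "r > 2" and a: "\<And>i. a i \<ge> 0" and T: "finite T" "T \<noteq> {}"
  shows "sign_avg n (\<lambda>e. MAX t\<in>T. \<bar>\<Sum>i<n. e i * min \<bar>s t\<bar> (a i)\<bar>)
    \<le> sqrt n + 2 / (r - 2) * sqrt (\<Sum>i<n. a i powr r)"
proof -
  define q where "q i = (indicator {0..<a i} :: real \<Rightarrow> real)" for i
  define P where "P = (\<Sum>i<n. a i powr r)"
  have P: "P \<ge> 0" by (simp add: P_def sum_nonneg)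
  have q_int: "integrable lborel (q i)" for i
    unfolding q_def using a[of i] by (intro integrable_real_indicator) auto
  have abs_int: "integrable lborel (\<lambda>x. \<bar>\<Sum>i<n. e i * q i x\<bar>)" for e
    using q_int by (intro integrable_abs integrable_sum integrable_mult_right) auto
  have le: "\<bar>\<Sum>i<n. e i * min \<bar>c\<bar> (a i)\<bar> \<le> (\<integral>x. \<bar>\<Sum>i<n. e i * q i x\<bar> \<partial>lborel)" for e c
  proof -
    have int: "integrable lborel (\<lambda>x. e i * indicator {0..<min \<bar>c\<bar> (a i)} x)" for i
      using a[of i] by (intro integrable_mult_right integrable_real_indicator) auto
    have "(\<Sum>i<n. e i * min \<bar>c\<bar> (a i)) = (\<Sum>i<n. \<integral>x. e i * indicator {0..<min \<bar>c\<bar> (a i)} x \<partial>lborel)"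
      using a by (intro sum.cong) auto
    also have "\<dots> = (\<integral>x. (\<Sum>i<n. e i * indicator {0..<min \<bar>c\<bar> (a i)} x) \<partial>lborel)"
      using int by (intro Bochner_Integration.integral_sum[symmetric]) auto
    finally have "\<bar>\<Sum>i<n. e i * min \<bar>c\<bar> (a i)\<bar>
        \<le> (\<integral>x. \<bar>\<Sum>i<n. e i * indicator {0..<min \<bar>c\<bar> (a i)} x\<bar> \<partial>lborel)"
      by (simp only: integral_abs_bound)
    also have "\<dots> \<le> (\<integral>x. \<bar>\<Sum>i<n. e i * q i x\<bar> \<partial>lborel)"
    proof (rule integral_mono)
      show "integrable lborel (\<lambda>x. \<bar>\<Sum>i<n. e i * indicator {0..<min \<bar>c\<bar> (a i)} x\<bar>)"
        by (intro integrable_abs Bochner_Integration.integrable_sum int)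
      fix x :: real
      have "(\<Sum>i<n. e i * indicator {0..<min \<bar>c\<bar> (a i)} x) = indicator {..<\<bar>c\<bar>} x * (\<Sum>i<n. e i * q i x)"
        unfolding sum_distrib_left by (intro sum.cong) (auto simp: q_def indicator_def)
      then show "\<bar>\<Sum>i<n. e i * indicator {0..<min \<bar>c\<bar> (a i)} x\<bar> \<le> \<bar>\<Sum>i<n. e i * q i x\<bar>"
        by (simp add: indicator_def)
    qed (rule abs_int)
    finally show ?thesis .
  qed
  define b where "b x = sqrt n * indicator {0..1} x + sqrt P * (indicator {1..} x * x powr - (r / 2))" for x :: real
  have b_int: "has_bochner_integral lborel b (sqrt n * 1 + sqrt P * (1 / (r / 2 - 1)))"
    unfolding b_def using r
    by (intro has_bochner_integral_add has_bochner_integral_mult_right has_bochner_integral_powr_tail)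
      (auto simp: has_bochner_integral_iff)
  have le_b: "sign_avg n (\<lambda>e. \<bar>\<Sum>i<n. e i * q i x\<bar>) \<le> b x" for x
  proof -
    have "sign_avg n (\<lambda>e. \<bar>\<Sum>i<n. e i * q i x\<bar>) \<le> sqrt (\<Sum>i<n. (q i x)\<^sup>2)"
      by (rule sign_avg_abs_le)
    also have "\<dots> \<le> b x"
    proof -
      consider "x < 0" | "0 \<le> x" "x \<le> 1" | "x > 1" by linarith
      then show ?thesis
      proof cases
        case 1
        then show ?thesis by (simp add: q_def b_def)
      next
        case 2
        have "(\<Sum>i<n. (q i x)\<^sup>2) \<le> (\<Sum>i<n. 1)"
          by (intro sum_mono) (auto simp: q_def indicator_def)
        then have "sqrt (\<Sum>i<n. (q i x)\<^sup>2) \<le> sqrt n" by simp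
        also have "\<dots> \<le> b x" using 2 P by (simp add: b_def)
        finally show ?thesis .
      next
        case 3
        have "(\<Sum>i<n. (q i x)\<^sup>2) \<le> (\<Sum>i<n. a i powr r * x powr - r)"
        proof (rule sum_mono)
          fix i
          have "1 \<le> a i powr r * x powr - r" if "x < a i"
          proof -
            have "x powr r \<le> a i powr r" using that 3 r by (intro powr_mono2) auto
            then show ?thesis using 3 by (simp add: powr_minus field_simps)
          qed
          then show "(q i x)\<^sup>2 \<le> a i powr r * x powr - r" by (auto simp: q_def indicator_def)
        qed
        also have "\<dots> = P * (x powr - (r / 2))\<^sup>2"
          unfolding P_def sum_distrib_right using powr_half_square[of x "- r"] by simp
        finally have "sqrt (\<Sum>i<n. (q i x)\<^sup>2) \<le> sqrt (P * (x powr - (r / 2))\<^sup>2)"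
          by (rule real_sqrt_le_mono)
        also have "\<dots> = b x" using 3 by (simp add: b_def real_sqrt_mult)
        finally show ?thesis .
      qed
    qed
    finally show ?thesis .
  qed
  have "sign_avg n (\<lambda>e. MAX t\<in>T. \<bar>\<Sum>i<n. e i * min \<bar>s t\<bar> (a i)\<bar>)
      \<le> sign_avg n (\<lambda>e. \<integral>x. \<bar>\<Sum>i<n. e i * q i x\<bar> \<partial>lborel)"
    using T le by (intro sign_avg_mono Max.boundedI) auto
  also have "\<dots> = (\<integral>x. sign_avg n (\<lambda>e. \<bar>\<Sum>i<n. e i * q i x\<bar>) \<partial>lborel)"
    by (rule integral_sign_avg[symmetric]) (rule abs_int)
  also have "\<dots> \<le> (\<integral>x. b x \<partial>lborel)"
    using b_int le_b by (intro integral_mono integrable_sign_avg abs_int) (auto simp: has_bochner_integral_iff)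
  also have "\<dots> = sqrt n * 1 + sqrt P * (1 / (r / 2 - 1))"
    using b_int by (simp add: has_bochner_integral_iff)
  also have "1 / (r / 2 - 1) = 2 / (r - 2)" using r by (simp add: field_simps)
  finally show ?thesis by (simp add: P_def mult.commute)
qed

lemma check_loss_eq_max:
  assumes "0 < \<alpha>" "\<alpha> < 1"
  shows "check_loss \<alpha> u = max (\<alpha> * u) (- (1 - \<alpha>) * u)"
  using assms by (auto simp: check_loss_def max_def algebra_simps)

lemma continuous_on_check_loss:
  assumes "0 < \<alpha>" "\<alpha> < 1" "continuous_on A f"
  shows "continuous_on A (\<lambda>x. check_loss \<alpha> (f x))"
  unfolding check_loss_eq_max[OF assms(1,2)] by (intro continuous_intros assms(3))

lemma check_loss_lipschitz:
  assumes "0 < \<alpha>" "\<alpha> < 1"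
  shows "\<bar>check_loss \<alpha> u - check_loss \<alpha> v\<bar> \<le> max \<alpha> (1 - \<alpha>) * \<bar>u - v\<bar>"
proof -
  have "\<bar>\<alpha> * u - \<alpha> * v\<bar> \<le> max \<alpha> (1 - \<alpha>) * \<bar>u - v\<bar>"
    "\<bar>- (1 - \<alpha>) * u - - (1 - \<alpha>) * v\<bar> \<le> max \<alpha> (1 - \<alpha>) * \<bar>u - v\<bar>"
    using assms by (auto simp flip: right_diff_distrib simp: abs_mult intro!: mult_right_mono)
  then show ?thesis unfolding check_loss_eq_max[OF assms] by linarith
qed

lemma check_loss_scale: "c > 0 \<Longrightarrow> check_loss \<alpha> (c * u) = c * check_loss \<alpha> u"
  by (auto simp: check_loss_def mult_less_0_iff)

text \<open>
  The loss at residual \<open>w \<bullet> z - s\<close>, where \<open>t = (w, s)\<close>, minus its value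
  at \<open>z = 0\<close>. The offset does not affect deviations from the mean, and without it the loss would
  be unbounded in \<open>s\<close>.
\<close>

definition shifted_loss :: "real \<Rightarrow> 'a::real_inner \<times> real \<Rightarrow> 'a \<Rightarrow> real" where
  "shifted_loss \<alpha> t z = check_loss \<alpha> (fst t \<bullet> z - snd t) - check_loss \<alpha> (- snd t)"

text \<open>
  If \<open>\<bar>s\<bar> > a\<close> then \<open>u - s\<close> has the same sign for all admissible
  \<open>u\<close>, and the check loss is linear there. So the intercept may be clipped to
  \<open>[-a, a]\<close> inside the loss, at the price of an explicit term that depends on \<open>s\<close>
  only through its sign and \<open>min \<bar>s\<bar> a\<close>.
\<close>

lemma check_loss_shift_decomp:
  assumes "\<bar>u\<bar> \<le> a"
  shows "check_loss \<alpha> (u - s) - check_loss \<alpha> (- s)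
    = check_loss \<alpha> (u - sgn s * min \<bar>s\<bar> a) - (if s \<ge> 0 then 1 - \<alpha> else \<alpha>) * min \<bar>s\<bar> a"
  using assms by (auto simp: check_loss_def sgn_if min_def abs_if algebra_simps split: if_splits)

text \<open>
  With \<open>a i = \<nu> (z i)\<close>, the decomposition of the loss leaves a Lipschitz function of the
  clipped residual, to which contraction applies, and a multiple of \<open>min \<bar>s\<bar> (a i)\<close>.
  The clipped residual is again a linear term plus a multiple of \<open>min \<bar>s\<bar> (a i)\<close>. The
  linear term contributes \<open>4 sqrt D\<close> and the two truncation terms contribute the 2.
\<close>

lemma sign_avg_Max_shifted_loss_le:
  fixes \<nu> :: "'a::euclidean_space \<Rightarrow> real" and z :: "nat \<Rightarrow> 'a"
  assumes \<alpha>: "0 < \<alpha>" "\<alpha> < 1" and \<nu>: "is_norm \<nu>" and r: "r > 2"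
    and T: "finite T" "T \<noteq> {}" "\<And>t. t \<in> T \<Longrightarrow> dual_norm \<nu> (fst t) \<le> 1"
  shows "sign_avg n (\<lambda>e. MAX t\<in>T. \<Sum>i<n. e i * shifted_loss \<alpha> t (z i))
    \<le> max \<alpha> (1 - \<alpha>) * ((4 * sqrt DIM('a) + 2) *
       (sqrt n + 2 / (r - 2) * sqrt (\<Sum>i<n. \<nu> (z i) powr r)))"
proof -
  define m where "m = max \<alpha> (1 - \<alpha>)"
  define a where "a i = \<nu> (z i)" for i
  define B where "B = sqrt n + 2 / (r - 2) * sqrt (\<Sum>i<n. a i powr r)"
  define u where "u t i = fst t \<bullet> z i - sgn (snd t) * min \<bar>snd t\<bar> (a i)" for t :: "'a \<times> real" and i
  define k where "k t = (if snd t \<ge> 0 then 1 - \<alpha> else \<alpha>)" for t :: "'a \<times> real"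
  define Y where "Y e t = (\<Sum>i<n. e i * min \<bar>snd t\<bar> (a i))" for e and t :: "'a \<times> real"
  define L where "L e t = (\<Sum>i<n. e i * (fst t \<bullet> z i))" for e and t :: "'a \<times> real"
  have a: "a i \<ge> 0" for i by (simp add: a_def is_norm_nonneg[OF \<nu>])
  have m: "m \<ge> 0" using \<alpha> by (simp add: m_def)
  have inner_le: "\<bar>fst t \<bullet> z i\<bar> \<le> a i" if "t \<in> T" for t i
  proof -
    have "\<bar>z i \<bullet> fst t\<bar> \<le> a i * dual_norm \<nu> (fst t)"
      unfolding a_def by (rule abs_inner_le_dual_norm[OF \<nu>])
    also have "\<dots> \<le> a i * 1" by (intro mult_left_mono T(3) that a)
    finally show ?thesis by (simp add: inner_commute)
  qed
  have Y_le: "c * Y e t \<le> m * (MAX t\<in>T. \<bar>Y e t\<bar>)" if "t \<in> T" "\<bar>c\<bar> \<le> m" for c e t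
  proof -
    have "c * Y e t \<le> \<bar>c\<bar> * \<bar>Y e t\<bar>" by (metis abs_ge_self abs_mult)
    also have "\<dots> \<le> m * (MAX t\<in>T. \<bar>Y e t\<bar>)"
      using that T m by (intro mult_mono Max_ge) auto
    finally show ?thesis .
  qed
  have "sign_avg n (\<lambda>e. MAX t\<in>T. \<Sum>i<n. e i * shifted_loss \<alpha> t (z i))
      \<le> sign_avg n (\<lambda>e. (MAX t\<in>T. 0 + (\<Sum>i<n. e i * check_loss \<alpha> (u t i))) + m * (MAX t\<in>T. \<bar>Y e t\<bar>))"
  proof (intro sign_avg_mono Max.boundedI)
    fix e :: "nat \<Rightarrow> real" and x
    assume "x \<in> (\<lambda>t. \<Sum>i<n. e i * shifted_loss \<alpha> t (z i)) ` T"
    then obtain t where t: "t \<in> T" and x: "x = (\<Sum>i<n. e i * shifted_loss \<alpha> t (z i))" by blast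
    have "shifted_loss \<alpha> t (z i) = check_loss \<alpha> (u t i) - k t * min \<bar>snd t\<bar> (a i)" for i
      unfolding shifted_loss_def u_def k_def using inner_le[OF t] by (rule check_loss_shift_decomp)
    then have "x = (\<Sum>i<n. e i * check_loss \<alpha> (u t i)) - k t * Y e t"
      unfolding x Y_def by (simp add: right_diff_distrib sum_subtractf sum_distrib_left mult.left_commute)
    then have "x = (\<Sum>i<n. e i * check_loss \<alpha> (u t i)) + (- k t) * Y e t" by simp
    also have "\<dots> \<le> (MAX t\<in>T. 0 + (\<Sum>i<n. e i * check_loss \<alpha> (u t i))) + m * (MAX t\<in>T. \<bar>Y e t\<bar>)"
    proof (rule add_mono)
      show "(\<Sum>i<n. e i * check_loss \<alpha> (u t i)) \<le> (MAX t\<in>T. 0 + (\<Sum>i<n. e i * check_loss \<alpha> (u t i)))"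
        using T(1) t by (intro Max_ge) auto
      show "(- k t) * Y e t \<le> m * (MAX t\<in>T. \<bar>Y e t\<bar>)"
        using t \<alpha> by (intro Y_le) (auto simp: k_def m_def)
    qed
    finally show "x \<le> (MAX t\<in>T. 0 + (\<Sum>i<n. e i * check_loss \<alpha> (u t i))) + m * (MAX t\<in>T. \<bar>Y e t\<bar>)" .
  qed (use T in auto)
  also have "\<dots> = sign_avg n (\<lambda>e. MAX t\<in>T. 0 + (\<Sum>i<n. e i * check_loss \<alpha> (u t i)))
      + m * sign_avg n (\<lambda>e. MAX t\<in>T. \<bar>Y e t\<bar>)"
    by (simp only: sign_avg_add sign_avg_cmult)
  also have "sign_avg n (\<lambda>e. MAX t\<in>T. 0 + (\<Sum>i<n. e i * check_loss \<alpha> (u t i)))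
      \<le> sign_avg n (\<lambda>e. MAX t\<in>T. 0 + (\<Sum>i<n. e i * (m * u t i)))"
    unfolding m_def by (intro sign_avg_contraction T check_loss_lipschitz \<alpha>)
  also have "sign_avg n (\<lambda>e. MAX t\<in>T. 0 + (\<Sum>i<n. e i * (m * u t i)))
      \<le> sign_avg n (\<lambda>e. m * (MAX t\<in>T. L e t) + m * (MAX t\<in>T. \<bar>Y e t\<bar>))"
  proof (intro sign_avg_mono Max.boundedI)
    fix e :: "nat \<Rightarrow> real" and x
    assume "x \<in> (\<lambda>t. 0 + (\<Sum>i<n. e i * (m * u t i))) ` T"
    then obtain t where t: "t \<in> T" and x: "x = (\<Sum>i<n. e i * (m * u t i))" by auto
    have "x = m * L e t - (m * sgn (snd t)) * Y e t"
      unfolding x u_def Y_def L_def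
      by (simp add: right_diff_distrib sum_subtractf sum_distrib_left mult.left_commute mult.assoc)
    then have "x = m * L e t + (- m * sgn (snd t)) * Y e t" by simp
    also have "\<dots> \<le> m * (MAX t\<in>T. L e t) + m * (MAX t\<in>T. \<bar>Y e t\<bar>)"
    proof (rule add_mono)
      show "m * L e t \<le> m * (MAX t\<in>T. L e t)"
        using T(1) t m by (intro mult_left_mono Max_ge) auto
      show "(- m * sgn (snd t)) * Y e t \<le> m * (MAX t\<in>T. \<bar>Y e t\<bar>)"
        using t m by (intro Y_le) (auto simp: abs_mult sgn_if)
    qed
    finally show "x \<le> m * (MAX t\<in>T. L e t) + m * (MAX t\<in>T. \<bar>Y e t\<bar>)" .
  qed (use T in auto)
  also have "\<dots> = m * sign_avg n (\<lambda>e. MAX t\<in>T. L e t) + m * sign_avg n (\<lambda>e. MAX t\<in>T. \<bar>Y e t\<bar>)"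
    by (simp only: sign_avg_add sign_avg_cmult)
  finally have "sign_avg n (\<lambda>e. MAX t\<in>T. \<Sum>i<n. e i * shifted_loss \<alpha> t (z i))
      \<le> m * sign_avg n (\<lambda>e. MAX t\<in>T. L e t) + m * sign_avg n (\<lambda>e. MAX t\<in>T. \<bar>Y e t\<bar>)
        + m * sign_avg n (\<lambda>e. MAX t\<in>T. \<bar>Y e t\<bar>)" by simp
  moreover have "m * sign_avg n (\<lambda>e. MAX t\<in>T. \<bar>Y e t\<bar>) \<le> m * B"
    using m by (rule mult_left_mono[rotated])
      (unfold B_def Y_def, intro sign_avg_Max_truncation_le r a T(1,2))
  moreover have "m * sign_avg n (\<lambda>e. MAX t\<in>T. L e t) \<le> m * (4 * sqrt DIM('a) * B)"
    using m
  proof (rule mult_left_mono[rotated])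
    have "sign_avg n (\<lambda>e. MAX t\<in>T. L e t) \<le> 4 * sqrt DIM('a) * sqrt (\<Sum>i<n. (a i)\<^sup>2)"
      unfolding L_def a_def by (intro sign_avg_Max_inner_le \<nu> T)
    also have "\<dots> \<le> 4 * sqrt DIM('a) * B"
      unfolding B_def by (intro mult_left_mono sqrt_sum_square_le r a) auto
    finally show "sign_avg n (\<lambda>e. MAX t\<in>T. L e t) \<le> 4 * sqrt DIM('a) * B" .
  qed
  ultimately show ?thesis
    unfolding m_def[symmetric] a_def[symmetric] B_def[symmetric] by (simp add: algebra_simps)
qed

section \<open>Peeling one observation off an i.i.d. sample\<close>

context prob_space
begin

lemma prob_space_iid: "prob_space (iid_sample n M)"
  unfolding iid_sample_def by (intro prob_space_PiM prob_space_axioms)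

lemma iid_sample_Suc:
  "iid_sample (Suc n) M =
    distr (M \<Otimes>\<^sub>M iid_sample n M) (iid_sample (Suc n) M) (\<lambda>(x, \<xi>). \<xi>(n := x))"
  using distr_pair_PiM_eq_PiM[of "{..<n}" "\<lambda>_. M" n] prob_space_axioms
  by (simp add: iid_sample_def lessThan_Suc)

lemma measurable_snoc [measurable]:
  "(\<lambda>(x, \<xi>). \<xi>(n := x)) \<in> measurable (M \<Otimes>\<^sub>M iid_sample n M) (iid_sample (Suc n) M)"
  unfolding iid_sample_def lessThan_Suc by measurable

lemma measurable_snoc_comp:
  assumes h: "h \<in> borel_measurable (iid_sample (Suc n) M)" and \<xi>: "\<xi> \<in> space (iid_sample n M)"
  shows "(\<lambda>x. h (\<xi>(n := x))) \<in> borel_measurable M"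
proof -
  have "(\<lambda>x. (x, \<xi>)) \<in> measurable M (M \<Otimes>\<^sub>M iid_sample n M)" using \<xi> by measurable
  from measurable_compose[OF measurable_compose[OF this measurable_snoc] h] show ?thesis by simp
qed

lemma measurable_integral_snoc:
  fixes h :: "(nat \<Rightarrow> 'a) \<Rightarrow> real"
  assumes "h \<in> borel_measurable (iid_sample (Suc n) M)"
  shows "(\<lambda>\<xi>. \<integral>x. h (\<xi>(n := x)) \<partial>M) \<in> borel_measurable (iid_sample n M)"
proof -
  have "(\<lambda>(x, \<xi>). h (\<xi>(n := x))) \<in> borel_measurable (M \<Otimes>\<^sub>M iid_sample n M)"
    using measurable_compose[OF measurable_snoc assms] by (simp add: case_prod_beta)
  then have "(\<lambda>(\<xi>, x). h (\<xi>(n := x))) \<in> borel_measurable (iid_sample n M \<Otimes>\<^sub>M M)"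
    using measurable_pair_swap by fastforce
  then show ?thesis by (intro borel_measurable_lebesgue_integral)
qed

text \<open>
  Fubini for the last observation, in both orders: symmetrization argues with the last observation frozen as
  well as with the first \<open>n\<close> frozen.
\<close>

lemma
  fixes h :: "(nat \<Rightarrow> 'a) \<Rightarrow> real"
  assumes h: "integrable (iid_sample (Suc n) M) h"
  shows integral_iid_Suc_outer: "(\<integral>\<xi>. h \<xi> \<partial>iid_sample (Suc n) M) = (\<integral>x. \<integral>\<xi>. h (\<xi>(n := x)) \<partial>iid_sample n M \<partial>M)"
    and integral_iid_Suc_inner: "(\<integral>\<xi>. h \<xi> \<partial>iid_sample (Suc n) M) = (\<integral>\<xi>. \<integral>x. h (\<xi>(n := x)) \<partial>M \<partial>iid_sample n M)"
    and integrable_iid_Suc_outer: "integrable M (\<lambda>x. \<integral>\<xi>. h (\<xi>(n := x)) \<partial>iid_sample n M)"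
    and integrable_iid_Suc_inner: "integrable (iid_sample n M) (\<lambda>\<xi>. \<integral>x. h (\<xi>(n := x)) \<partial>M)"
proof -
  interpret I: prob_space "iid_sample n M" by (rule prob_space_iid)
  interpret P: pair_sigma_finite M "iid_sample n M" ..
  let ?u = "\<lambda>(x, \<xi>). \<xi>(n := x)"
  have hm: "h \<in> borel_measurable (iid_sample (Suc n) M)" using h by simp
  have int: "integrable (M \<Otimes>\<^sub>M iid_sample n M) (\<lambda>z. h (?u z))"
    using h integrable_distr_eq[OF measurable_snoc hm] iid_sample_Suc[of n] by simp
  then have int': "integrable (M \<Otimes>\<^sub>M iid_sample n M) (case_prod (\<lambda>x \<xi>. h (\<xi>(n := x))))"
    by (simp add: case_prod_beta')
  have eq: "(\<integral>\<xi>. h \<xi> \<partial>iid_sample (Suc n) M)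
      = (\<integral>z. (case z of (x, \<xi>) \<Rightarrow> h (\<xi>(n := x))) \<partial>(M \<Otimes>\<^sub>M iid_sample n M))"
    using integral_distr[OF measurable_snoc hm] iid_sample_Suc[of n] by (simp add: case_prod_beta)
  show "(\<integral>\<xi>. h \<xi> \<partial>iid_sample (Suc n) M) = (\<integral>x. \<integral>\<xi>. h (\<xi>(n := x)) \<partial>iid_sample n M \<partial>M)"
    unfolding eq using P.integral_fst[OF int'] by simp
  show "(\<integral>\<xi>. h \<xi> \<partial>iid_sample (Suc n) M) = (\<integral>\<xi>. \<integral>x. h (\<xi>(n := x)) \<partial>M \<partial>iid_sample n M)"
    unfolding eq using P.integral_snd[OF int'] by simp
  show "integrable M (\<lambda>x. \<integral>\<xi>. h (\<xi>(n := x)) \<partial>iid_sample n M)"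
    using P.integrable_fst[OF int'] by simp
  show "integrable (iid_sample n M) (\<lambda>\<xi>. \<integral>x. h (\<xi>(n := x)) \<partial>M)"
    using P.integrable_snd[OF int'] by simp
qed

lemma
  fixes h :: "'a \<Rightarrow> real"
  assumes i: "i < n"
  shows measurable_iid_component: "(\<lambda>\<xi>. \<xi> i) \<in> measurable (iid_sample n M) M"
    and integrable_iid_component: "integrable M h \<Longrightarrow> integrable (iid_sample n M) (\<lambda>\<xi>. h (\<xi> i))"
    and integral_iid_component: "h \<in> borel_measurable M \<Longrightarrow> (\<integral>\<xi>. h (\<xi> i) \<partial>iid_sample n M) = (\<integral>x. h x \<partial>M)"
proof -
  show m: "(\<lambda>\<xi>. \<xi> i) \<in> measurable (iid_sample n M) M"
    unfolding iid_sample_def using i by (intro measurable_component_singleton) auto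
  have d: "distr (iid_sample n M) M (\<lambda>\<xi>. \<xi> i) = M"
    unfolding iid_sample_def using i prob_space_axioms by (intro distr_PiM_component) auto
  show "integrable M h \<Longrightarrow> integrable (iid_sample n M) (\<lambda>\<xi>. h (\<xi> i))"
    using integrable_distr[OF m, of h] d by simp
  show "h \<in> borel_measurable M \<Longrightarrow> (\<integral>\<xi>. h (\<xi> i) \<partial>iid_sample n M) = (\<integral>x. h x \<partial>M)"
    using integral_distr[OF m, of h] d by simp
qed

end

lemma integrable_MAX:
  fixes f :: "'t \<Rightarrow> 'a \<Rightarrow> real"
  assumes "finite T" "T \<noteq> {}" "\<And>t. t \<in> T \<Longrightarrow> integrable M (f t)"
  shows "integrable M (\<lambda>x. MAX t\<in>T. f t x)"
  using assms
proof (induction T rule: finite_ne_induct)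
  case (insert t T)
  have "(\<lambda>x. MAX t\<in>insert t T. f t x) = (\<lambda>x. max (f t x) (MAX t\<in>T. f t x))"
    using insert.hyps by (simp add: Max_insert)
  then show ?case using insert by simp
qed simp

section \<open>Symmetrization\<close>

context prob_space
begin

text \<open>
  Let \<open>t\<close> attain the maximum at \<open>x\<close>. Then
  \<open>B t + (E f\<^sub>t - f\<^sub>t(x))\<close> is the average of
  \<open>B t + 2 E f\<^sub>t\<close>, the mean of \<open>B t + 2 f\<^sub>t\<close> and so at most the
  mean of the maximum, and of \<open>B t - 2 f\<^sub>t(x)\<close>. The two signs appear without an
  independent copy of the sample.
\<close>

lemma integral_MAX_deviation_le:
  fixes f :: "'t \<Rightarrow> 'a \<Rightarrow> real"
  assumes T: "finite T" "T \<noteq> {}" and f: "\<And>t. t \<in> T \<Longrightarrow> integrable M (f t)"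
  shows "(\<integral>x. (MAX t\<in>T. B t + ((\<integral>y. f t y \<partial>M) - f t x)) \<partial>M)
    \<le> ((\<integral>x. (MAX t\<in>T. B t + 1 * (2 * f t x)) \<partial>M) + (\<integral>x. (MAX t\<in>T. B t + (- 1) * (2 * f t x)) \<partial>M)) / 2"
proof -
  let ?c = "\<integral>x. (MAX t\<in>T. B t + 1 * (2 * f t x)) \<partial>M"
  have int: "integrable M (\<lambda>x. MAX t\<in>T. B t + c * (2 * f t x))" for c
    using T f by (intro integrable_MAX) auto
  have "(\<integral>x. (MAX t\<in>T. B t + ((\<integral>y. f t y \<partial>M) - f t x)) \<partial>M)
      \<le> (\<integral>x. (?c + (MAX t\<in>T. B t + (- 1) * (2 * f t x))) / 2 \<partial>M)"
  proof (rule integral_mono)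
    show "integrable M (\<lambda>x. MAX t\<in>T. B t + ((\<integral>y. f t y \<partial>M) - f t x))"
      using T f by (intro integrable_MAX) auto
    show "integrable M (\<lambda>x. (?c + (MAX t\<in>T. B t + (- 1) * (2 * f t x))) / 2)"
      using int[of "- 1"] by simp
    fix x
    obtain t where t: "t \<in> T" "(MAX t\<in>T. B t + ((\<integral>y. f t y \<partial>M) - f t x)) = B t + ((\<integral>y. f t y \<partial>M) - f t x)"
      using MAX_attained[OF T, of "\<lambda>t. B t + ((\<integral>y. f t y \<partial>M) - f t x)"] by blast
    have "B t + 2 * (\<integral>y. f t y \<partial>M) = (\<integral>y. B t + 1 * (2 * f t y) \<partial>M)"
      using f[OF t(1)] by (simp add: prob_space)
    also have "\<dots> \<le> ?c"
      using T t f[OF t(1)] by (intro integral_mono int Max_ge) auto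
    finally have 1: "B t + 2 * (\<integral>y. f t y \<partial>M) \<le> ?c" .
    have "B t + (- 1) * (2 * f t x) \<le> (MAX t\<in>T. B t + (- 1) * (2 * f t x))"
      using T t by (intro Max_ge) auto
    with 1 show "(MAX t\<in>T. B t + ((\<integral>y. f t y \<partial>M) - f t x))
        \<le> (?c + (MAX t\<in>T. B t + (- 1) * (2 * f t x))) / 2"
      unfolding t(2) by simp
  qed
  also have "\<dots> = (?c + (\<integral>x. (MAX t\<in>T. B t + (- 1) * (2 * f t x)) \<partial>M)) / 2"
    using int[of "- 1"] by (simp add: prob_space)
  finally show ?thesis .
qed

text \<open>
  The induction hypothesis symmetrizes the first \<open>n\<close> observations while the last one is frozen
  inside the offset \<open>A\<close>; exchanging the order of integration, the one-observation inequality then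
  symmetrizes the last one while the others are frozen.
\<close>

lemma integral_symmetrization_le:
  fixes f :: "'t \<Rightarrow> 'a \<Rightarrow> real"
  assumes T: "finite T" "T \<noteq> {}" and f: "\<And>t. t \<in> T \<Longrightarrow> integrable M (f t)"
  shows "(\<integral>\<xi>. (MAX t\<in>T. A t + (\<Sum>i<n. (\<integral>y. f t y \<partial>M) - f t (\<xi> i))) \<partial>iid_sample n M)
    \<le> (\<integral>\<xi>. sign_avg n (\<lambda>e. MAX t\<in>T. A t + (\<Sum>i<n. e i * (2 * f t (\<xi> i)))) \<partial>iid_sample n M)"
proof (induction n arbitrary: A)
  case (Suc n)
  define \<mu> where "\<mu> t = (\<integral>y. f t y \<partial>M)" for t
  define S where "S e \<xi> t = (\<Sum>i<n. e i * (2 * f t (\<xi> i)))" for e :: "nat \<Rightarrow> real" and \<xi> t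
  have int_comp: "integrable (iid_sample k M) (\<lambda>\<xi>. f t (\<xi> i))" if "t \<in> T" "i < k" for t i k
    using integrable_iid_component[OF that(2) f[OF that(1)]] .
  have int_S: "integrable (iid_sample k M) (\<lambda>\<xi>. S e \<xi> t)" if "t \<in> T" "n \<le> k" for e t k
    unfolding S_def using that by (intro Bochner_Integration.integrable_sum integrable_mult_right int_comp) auto
  \<comment> \<open>the hybrid: all observations but the last are symmetrized\<close>
  define H where "H \<xi> = sign_avg n (\<lambda>e. MAX t\<in>T. (A t + (\<mu> t - f t (\<xi> n))) + S e \<xi> t)" for \<xi>
  interpret I: prob_space "iid_sample n M" by (rule prob_space_iid)
  interpret I': prob_space "iid_sample (Suc n) M" by (rule prob_space_iid)
  have int_H: "integrable (iid_sample (Suc n) M) H"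
    unfolding H_def using T
    by (intro integrable_sign_avg integrable_MAX Bochner_Integration.integrable_add
        Bochner_Integration.integrable_diff int_comp int_S) auto
  have int_G: "integrable (iid_sample (Suc n) M) (\<lambda>\<xi>. MAX t\<in>T. A t + (\<Sum>i<Suc n. \<mu> t - f t (\<xi> i)))"
    using T by (intro integrable_MAX Bochner_Integration.integrable_add Bochner_Integration.integrable_sum
        Bochner_Integration.integrable_diff int_comp) auto
  have S_upd: "S e (\<xi>(n := x)) t = S e \<xi> t" for e \<xi> x t
    unfolding S_def by (intro sum.cong) auto
  have G_upd: "A t + (\<Sum>i<Suc n. \<mu> t - f t ((\<xi>(n := x)) i))
      = (A t + (\<mu> t - f t x)) + (\<Sum>i<n. \<mu> t - f t (\<xi> i))" for t \<xi> x
  proof -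
    have "(\<Sum>i<n. \<mu> t - f t ((\<xi>(n := x)) i)) = (\<Sum>i<n. \<mu> t - f t (\<xi> i))"
      by (intro sum.cong) auto
    then show ?thesis by simp
  qed
  define R where "R \<xi> = sign_avg (Suc n) (\<lambda>e. MAX t\<in>T. A t + (\<Sum>i<Suc n. e i * (2 * f t (\<xi> i))))" for \<xi>
  define K where "K c \<xi> = sign_avg n (\<lambda>e. MAX t\<in>T. (A t + S e \<xi> t) + c * (2 * f t (\<xi> n)))" for c \<xi>
  have R_eq: "R \<xi> = (K 1 \<xi> + K (- 1) \<xi>) / 2" for \<xi>
    unfolding R_def K_def sign_avg.simps sum.lessThan_Suc sum_upd_top S_def by (simp add: add.assoc add_diff_eq)
  have int_K: "integrable (iid_sample (Suc n) M) (K c)" for c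
    unfolding K_def using T
    by (intro integrable_sign_avg integrable_MAX Bochner_Integration.integrable_add
        integrable_mult_right int_comp int_S) auto
  have int_R: "integrable (iid_sample (Suc n) M) R" unfolding R_eq[abs_def] using int_K by simp
  have "(\<integral>\<xi>. (MAX t\<in>T. A t + (\<Sum>i<Suc n. \<mu> t - f t (\<xi> i))) \<partial>iid_sample (Suc n) M)
      = (\<integral>x. \<integral>\<xi>. (MAX t\<in>T. (A t + (\<mu> t - f t x)) + (\<Sum>i<n. \<mu> t - f t (\<xi> i))) \<partial>iid_sample n M \<partial>M)"
    unfolding integral_iid_Suc_outer[OF int_G] G_upd ..
  also have "\<dots> \<le> (\<integral>x. \<integral>\<xi>. H (\<xi>(n := x)) \<partial>iid_sample n M \<partial>M)"
  proof (rule integral_mono)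
    show "integrable M (\<lambda>x. \<integral>\<xi>. (MAX t\<in>T. (A t + (\<mu> t - f t x)) + (\<Sum>i<n. \<mu> t - f t (\<xi> i))) \<partial>iid_sample n M)"
      using integrable_iid_Suc_outer[OF int_G] unfolding G_upd .
    show "integrable M (\<lambda>x. \<integral>\<xi>. H (\<xi>(n := x)) \<partial>iid_sample n M)"
      by (rule integrable_iid_Suc_outer[OF int_H])
    show "(\<integral>\<xi>. (MAX t\<in>T. (A t + (\<mu> t - f t x)) + (\<Sum>i<n. \<mu> t - f t (\<xi> i))) \<partial>iid_sample n M)
        \<le> (\<integral>\<xi>. H (\<xi>(n := x)) \<partial>iid_sample n M)" for x
      using Suc.IH[of "\<lambda>t. A t + (\<mu> t - f t x)"] unfolding H_def S_upd S_def \<mu>_def[symmetric] by simp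
  qed
  also have "\<dots> = (\<integral>\<xi>. \<integral>x. H (\<xi>(n := x)) \<partial>M \<partial>iid_sample n M)"
    using integral_iid_Suc_outer[OF int_H] integral_iid_Suc_inner[OF int_H] by simp
  also have "\<dots> \<le> (\<integral>\<xi>. \<integral>x. R (\<xi>(n := x)) \<partial>M \<partial>iid_sample n M)"
  proof (rule integral_mono)
    fix \<xi>
    have int_M: "integrable M (\<lambda>x. MAX t\<in>T. (A t + S e \<xi> t) + c * (2 * f t x))" for e c
      using T f by (intro integrable_MAX) auto
    have int_M': "integrable M (\<lambda>x. MAX t\<in>T. (A t + S e \<xi> t) + (\<mu> t - f t x))" for e
      using T f by (intro integrable_MAX) auto
    have H_eq: "H (\<xi>(n := x)) = sign_avg n (\<lambda>e. MAX t\<in>T. (A t + S e \<xi> t) + (\<mu> t - f t x))" for x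
      unfolding H_def S_upd by (simp add: ac_simps)
    have K_eq: "K c (\<xi>(n := x)) = sign_avg n (\<lambda>e. MAX t\<in>T. (A t + S e \<xi> t) + c * (2 * f t x))" for c x
      unfolding K_def S_upd by simp
    have int_K': "integrable M (\<lambda>x. K c (\<xi>(n := x)))" for c
      unfolding K_eq by (intro integrable_sign_avg int_M)
    have "(\<integral>x. H (\<xi>(n := x)) \<partial>M) = sign_avg n (\<lambda>e. \<integral>x. (MAX t\<in>T. (A t + S e \<xi> t) + (\<mu> t - f t x)) \<partial>M)"
      unfolding H_eq by (intro integral_sign_avg int_M')
    also have "\<dots> \<le> sign_avg n (\<lambda>e. 1 / 2 * ((\<integral>x. (MAX t\<in>T. (A t + S e \<xi> t) + 1 * (2 * f t x)) \<partial>M)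
        + (\<integral>x. (MAX t\<in>T. (A t + S e \<xi> t) + (- 1) * (2 * f t x)) \<partial>M)))"
    proof (rule sign_avg_mono)
      fix e
      show "(\<integral>x. (MAX t\<in>T. (A t + S e \<xi> t) + (\<mu> t - f t x)) \<partial>M)
        \<le> 1 / 2 * ((\<integral>x. (MAX t\<in>T. (A t + S e \<xi> t) + 1 * (2 * f t x)) \<partial>M)
        + (\<integral>x. (MAX t\<in>T. (A t + S e \<xi> t) + (- 1) * (2 * f t x)) \<partial>M))"
        using integral_MAX_deviation_le[where f = f and B = "\<lambda>t. A t + S e \<xi> t", OF T f] unfolding \<mu>_def by linarith
    qed
    also have "\<dots> = 1 / 2 * ((\<integral>x. K 1 (\<xi>(n := x)) \<partial>M) + (\<integral>x. K (- 1) (\<xi>(n := x)) \<partial>M))"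
      unfolding sign_avg_cmult sign_avg_add K_eq integral_sign_avg[OF int_M] ..
    also have "\<dots> = (\<integral>x. R (\<xi>(n := x)) \<partial>M)"
      unfolding R_eq using int_K' by simp
    finally show "(\<integral>x. H (\<xi>(n := x)) \<partial>M) \<le> (\<integral>x. R (\<xi>(n := x)) \<partial>M)" .
  qed (rule integrable_iid_Suc_inner int_H int_R)+
  also have "\<dots> = (\<integral>\<xi>. R \<xi> \<partial>iid_sample (Suc n) M)"
    using integral_iid_Suc_inner[OF int_R] by simp
  finally show ?case unfolding R_def \<mu>_def .
qed simp

end

section \<open>Concentration around the mean\<close>

context prob_space
begin

lemma upd_in_space_iid:
  "\<lbrakk>\<xi> \<in> space (iid_sample n M); i < n; x \<in> space M\<rbrakk> \<Longrightarrow> \<xi>(i := x) \<in> space (iid_sample n M)"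
  by (auto simp: iid_sample_def space_PiM PiE_iff extensional_def)

lemma snoc_in_space_iid:
  "\<lbrakk>\<xi> \<in> space (iid_sample n M); x \<in> space M\<rbrakk> \<Longrightarrow> \<xi>(n := x) \<in> space (iid_sample (Suc n) M)"
  by (auto simp: iid_sample_def space_PiM PiE_iff extensional_def)

lemma integral_iid_0: "(\<integral>\<xi>. g \<xi> \<partial>iid_sample 0 M) = (g (\<lambda>_. undefined) :: real)"
proof -
  interpret I: prob_space "iid_sample 0 M" by (rule prob_space_iid)
  have "space (iid_sample 0 M) = {\<lambda>_. undefined}" by (simp add: iid_sample_def space_PiM)
  then have "(\<integral>\<xi>. g \<xi> \<partial>iid_sample 0 M) = (\<integral>\<xi>. g (\<lambda>_. undefined) \<partial>iid_sample 0 M)"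
    by (intro Bochner_Integration.integral_cong) auto
  then show ?thesis by (simp add: I.prob_space)
qed

lemma integral_abs_diff_le:
  fixes u v :: "'a \<Rightarrow> real"
  assumes "integrable M u" "integrable M v" "\<And>x. x \<in> space M \<Longrightarrow> \<bar>u x - v x\<bar> \<le> B"
  shows "\<bar>(\<integral>x. u x \<partial>M) - (\<integral>x. v x \<partial>M)\<bar> \<le> B"
proof -
  have "\<bar>(\<integral>x. u x \<partial>M) - (\<integral>x. v x \<partial>M)\<bar> = \<bar>\<integral>x. u x - v x \<partial>M\<bar>"
    using assms by simp
  also have "\<dots> \<le> (\<integral>x. \<bar>u x - v x\<bar> \<partial>M)" by (rule integral_abs_bound)
  also have "\<dots> \<le> (\<integral>x. B \<partial>M)" using assms by (intro integral_mono) auto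
  finally show ?thesis by (simp add: prob_space)
qed

text \<open>
  Hoeffding's lemma on the interval of length \<open>c\<close> that starts at the infimum of \<open>u\<close>.
\<close>

lemma integral_exp_bounded_difference_le:
  fixes u :: "'a \<Rightarrow> real"
  assumes u: "u \<in> borel_measurable M" and l: "l > 0"
    and bd: "\<And>x y. x \<in> space M \<Longrightarrow> y \<in> space M \<Longrightarrow> \<bar>u x - u y\<bar> \<le> c"
  shows "(\<integral>x. exp (l * (u x - expectation u)) \<partial>M) \<le> exp (l\<^sup>2 * c\<^sup>2 / 8)"
proof -
  define a where "a = (INF x\<in>space M. u x)"
  obtain x0 where x0: "x0 \<in> space M" using not_empty by blast
  have bdd: "bdd_below (u ` space M)"
  proof (rule bdd_belowI2)
    show "u x0 - c \<le> u x" if "x \<in> space M" for x using bd[OF x0 that] by linarith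
  qed
  have a: "a \<le> u x" "u x \<le> a + c" if x: "x \<in> space M" for x
  proof -
    show "a \<le> u x" unfolding a_def using bdd x by (intro cINF_lower) auto
    have "u x - c \<le> a" unfolding a_def
    proof (rule cINF_greatest)
      show "u x - c \<le> u y" if "y \<in> space M" for y using bd[OF x that] by linarith
    qed (use x0 in auto)
    then show "u x \<le> a + c" by simp
  qed
  interpret interval_bounded_random_variable M u a "a + c"
    by unfold_locales (use a u in auto)
  have "(\<integral>\<^sup>+x. exp (l * (u x - expectation u)) \<partial>M) \<le> ennreal (exp (l\<^sup>2 * (a + c - a)\<^sup>2 / 8))"
    by (rule Hoeffdings_lemma_nn_integral[OF l])
  then show ?thesis
    using integral_eq_nn_integral[of "\<lambda>x. exp (l * (u x - expectation u))" M] u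
    by (auto intro: enn2real_leI)
qed

text \<open>
  The function \<open>g\<close> obtained by integrating out the last observation inherits measurability, the
  bound and the bounded differences, so the induction hypothesis applies to it; the difference
  \<open>h - g\<close> is handled by Hoeffding's lemma with the first \<open>n\<close> observations fixed.
\<close>

lemma bounded_differences_mgf:
  fixes h :: "(nat \<Rightarrow> 'a) \<Rightarrow> real"
  assumes "h \<in> borel_measurable (iid_sample n M)"
    and "\<And>\<xi>. \<xi> \<in> space (iid_sample n M) \<Longrightarrow> \<bar>h \<xi>\<bar> \<le> C"
    and "\<And>\<xi> i x y. \<lbrakk>\<xi> \<in> space (iid_sample n M); i < n; x \<in> space M; y \<in> space M\<rbrakk>
      \<Longrightarrow> \<bar>h (\<xi>(i := x)) - h (\<xi>(i := y))\<bar> \<le> c"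
    and l: "l > 0"
  shows "(\<integral>\<xi>. exp (l * (h \<xi> - (\<integral>\<xi>. h \<xi> \<partial>iid_sample n M))) \<partial>iid_sample n M)
    \<le> exp (real n * (l\<^sup>2 * c\<^sup>2 / 8))"
  using assms(1-3)
proof (induction n arbitrary: h)
  case 0
  then show ?case by (simp add: integral_iid_0)
next
  case (Suc n)
  interpret I: prob_space "iid_sample n M" by (rule prob_space_iid)
  interpret I': prob_space "iid_sample (Suc n) M" by (rule prob_space_iid)
  note h = Suc.prems
  define g where "g \<xi> = (\<integral>x. h (\<xi>(n := x)) \<partial>M)" for \<xi>
  have int_x: "integrable M (\<lambda>x. h (\<xi>(n := x)))" if "\<xi> \<in> space (iid_sample n M)" for \<xi>
  proof (rule integrable_const_bound[of _ C])
    show "AE x in M. norm (h (\<xi>(n := x))) \<le> C"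
      unfolding real_norm_def by (intro AE_I2 h(2) snoc_in_space_iid that)
  qed (rule measurable_snoc_comp[OF h(1) that])
  have int_h: "integrable (iid_sample (Suc n) M) h"
    using h(1,2) by (intro I'.integrable_const_bound[of _ C]) auto
  have g_meas: "g \<in> borel_measurable (iid_sample n M)"
    unfolding g_def by (rule measurable_integral_snoc[OF h(1)])
  have g_bd: "\<bar>g \<xi>\<bar> \<le> C" if "\<xi> \<in> space (iid_sample n M)" for \<xi>
  proof -
    have "\<bar>(\<integral>x. h (\<xi>(n := x)) \<partial>M) - (\<integral>x. 0 \<partial>M)\<bar> \<le> C"
    proof (intro integral_abs_diff_le int_x that)
      show "\<bar>h (\<xi>(n := x)) - 0\<bar> \<le> C" if "x \<in> space M" for x
        unfolding diff_0_right using \<open>\<xi> \<in> _\<close> that by (intro h(2) snoc_in_space_iid)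
    qed simp
    then show ?thesis by (simp only: g_def Bochner_Integration.integral_zero diff_0_right)
  qed
  have g_diff: "\<bar>g (\<xi>(i := x)) - g (\<xi>(i := y))\<bar> \<le> c"
    if "\<xi> \<in> space (iid_sample n M)" "i < n" "x \<in> space M" "y \<in> space M" for \<xi> i x y
    unfolding g_def
  proof (intro integral_abs_diff_le int_x upd_in_space_iid that)
    fix z assume z: "z \<in> space M"
    have twist: "\<xi>(i := v, n := z) = \<xi>(n := z, i := v)" for v using that(2) by (intro fun_upd_twist) simp
    show "\<bar>h (\<xi>(i := x, n := z)) - h (\<xi>(i := y, n := z))\<bar> \<le> c"
      unfolding twist using that z by (intro h(3) snoc_in_space_iid) auto
  qed
  define E where "E = (\<integral>\<xi>. h \<xi> \<partial>iid_sample (Suc n) M)"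
  have E: "E = (\<integral>\<xi>. g \<xi> \<partial>iid_sample n M)"
    unfolding E_def g_def by (rule integral_iid_Suc_inner[OF int_h])
  have int_exp: "integrable (iid_sample (Suc n) M) (\<lambda>\<xi>. exp (l * (h \<xi> - E)))"
  proof (rule I'.integrable_const_bound[of _ "exp (l * (C - E))"])
    show "AE \<xi> in iid_sample (Suc n) M. norm (exp (l * (h \<xi> - E))) \<le> exp (l * (C - E))"
      using h(2) l by (intro AE_I2) (auto simp: abs_le_iff)
  qed (use h(1) in measurable)
  have int_g: "integrable (iid_sample n M) (\<lambda>\<xi>. exp (l * (g \<xi> - E)))"
  proof (rule I.integrable_const_bound[of _ "exp (l * (C - E))"])
    show "AE \<xi> in iid_sample n M. norm (exp (l * (g \<xi> - E))) \<le> exp (l * (C - E))"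
      using g_bd l by (intro AE_I2) (auto simp: abs_le_iff)
  qed (use g_meas in measurable)
  have "(\<integral>\<xi>. exp (l * (h \<xi> - E)) \<partial>iid_sample (Suc n) M)
      = (\<integral>\<xi>. \<integral>x. exp (l * (h (\<xi>(n := x)) - E)) \<partial>M \<partial>iid_sample n M)"
    by (rule integral_iid_Suc_inner[OF int_exp])
  also have "\<dots> \<le> (\<integral>\<xi>. exp (l\<^sup>2 * c\<^sup>2 / 8) * exp (l * (g \<xi> - E)) \<partial>iid_sample n M)"
  proof (rule integral_mono)
    show "integrable (iid_sample n M) (\<lambda>\<xi>. \<integral>x. exp (l * (h (\<xi>(n := x)) - E)) \<partial>M)"
      by (rule integrable_iid_Suc_inner[OF int_exp])
    show "integrable (iid_sample n M) (\<lambda>\<xi>. exp (l\<^sup>2 * c\<^sup>2 / 8) * exp (l * (g \<xi> - E)))"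
      using int_g by simp
    fix \<xi> assume \<xi>: "\<xi> \<in> space (iid_sample n M)"
    have "(\<integral>x. exp (l * (h (\<xi>(n := x)) - E)) \<partial>M)
        = (\<integral>x. exp (l * (h (\<xi>(n := x)) - g \<xi>)) * exp (l * (g \<xi> - E)) \<partial>M)"
      unfolding exp_add[symmetric] by (simp add: algebra_simps)
    also have "\<dots> = (\<integral>x. exp (l * (h (\<xi>(n := x)) - g \<xi>)) \<partial>M) * exp (l * (g \<xi> - E))"
      by simp
    also have "\<dots> \<le> exp (l\<^sup>2 * c\<^sup>2 / 8) * exp (l * (g \<xi> - E))"
    proof (rule mult_right_mono)
      show "(\<integral>x. exp (l * (h (\<xi>(n := x)) - g \<xi>)) \<partial>M) \<le> exp (l\<^sup>2 * c\<^sup>2 / 8)"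
        unfolding g_def
      proof (rule integral_exp_bounded_difference_le[OF measurable_snoc_comp[OF h(1) \<xi>] l])
        fix x y assume xy: "x \<in> space M" "y \<in> space M"
        show "\<bar>h (\<xi>(n := x)) - h (\<xi>(n := y))\<bar> \<le> c"
          using h(3)[OF snoc_in_space_iid[OF \<xi> xy(1)] lessI xy] unfolding fun_upd_upd .
      qed
    qed simp
    finally show "(\<integral>x. exp (l * (h (\<xi>(n := x)) - E)) \<partial>M) \<le> exp (l\<^sup>2 * c\<^sup>2 / 8) * exp (l * (g \<xi> - E))" .
  qed
  also have "\<dots> = exp (l\<^sup>2 * c\<^sup>2 / 8) * (\<integral>\<xi>. exp (l * (g \<xi> - E)) \<partial>iid_sample n M)"
    by simp
  also have "\<dots> \<le> exp (l\<^sup>2 * c\<^sup>2 / 8) * exp (real n * (l\<^sup>2 * c\<^sup>2 / 8))"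
    unfolding E by (intro mult_left_mono Suc.IH g_meas g_bd g_diff) auto
  also have "\<dots> = exp (real (Suc n) * (l\<^sup>2 * c\<^sup>2 / 8))"
    unfolding exp_add[symmetric] by (simp add: algebra_simps)
  finally show ?case by (simp only: E_def)
qed

text \<open>
  Chernoff's bound, with the exponent \<open>l\<close> that minimizes
  \<open>n l\<^sup>2 c\<^sup>2 / 8 - l u\<close>.
\<close>

lemma McDiarmid:
  fixes h :: "(nat \<Rightarrow> 'a) \<Rightarrow> real"
  assumes h: "h \<in> borel_measurable (iid_sample n M)"
    and C: "\<And>\<xi>. \<xi> \<in> space (iid_sample n M) \<Longrightarrow> \<bar>h \<xi>\<bar> \<le> C"
    and c: "\<And>\<xi> i x y. \<lbrakk>\<xi> \<in> space (iid_sample n M); i < n; x \<in> space M; y \<in> space M\<rbrakk>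
      \<Longrightarrow> \<bar>h (\<xi>(i := x)) - h (\<xi>(i := y))\<bar> \<le> c"
    and pos: "n > 0" "c > 0" "u > 0"
  shows "measure (iid_sample n M) {\<xi> \<in> space (iid_sample n M). h \<xi> \<ge> (\<integral>\<xi>. h \<xi> \<partial>iid_sample n M) + u}
    \<le> exp (- (2 * u\<^sup>2 / (real n * c\<^sup>2)))"
proof -
  let ?I = "iid_sample n M"
  interpret I: prob_space ?I by (rule prob_space_iid)
  define E where "E = (\<integral>\<xi>. h \<xi> \<partial>?I)"
  define l where "l = 4 * u / (real n * c\<^sup>2)"
  have l: "l > 0" using pos by (simp add: l_def)
  have int: "integrable ?I (\<lambda>\<xi>. exp (l * (h \<xi> - E)))"
  proof (rule I.integrable_const_bound[of _ "exp (l * (C - E))"])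
    show "AE \<xi> in ?I. norm (exp (l * (h \<xi> - E))) \<le> exp (l * (C - E))"
      using C l by (intro AE_I2) (auto simp: abs_le_iff)
  qed (use h in measurable)
  have "{\<xi> \<in> space ?I. h \<xi> \<ge> E + u} = {\<xi> \<in> space ?I. exp (l * (h \<xi> - E)) \<ge> exp (l * u)}"
  proof -
    have "h \<xi> \<ge> E + u \<longleftrightarrow> exp (l * (h \<xi> - E)) \<ge> exp (l * u)" for \<xi>
      using l by (simp add: le_diff_eq add.commute)
    then show ?thesis by simp
  qed
  then have "measure ?I {\<xi> \<in> space ?I. h \<xi> \<ge> E + u} \<le> (\<integral>\<xi>. exp (l * (h \<xi> - E)) \<partial>?I) / exp (l * u)"
    using integral_Markov_inequality_measure[OF int sets.top, of "exp (l * u)"] by simp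
  also have "\<dots> \<le> exp (real n * (l\<^sup>2 * c\<^sup>2 / 8)) / exp (l * u)"
    unfolding E_def by (intro divide_right_mono bounded_differences_mgf[OF h C c l]) auto
  also have "\<dots> = exp (real n * (l\<^sup>2 * c\<^sup>2 / 8) - l * u)" by (simp add: exp_diff)
  also have "real n * (l\<^sup>2 * c\<^sup>2 / 8) - l * u = - (2 * u\<^sup>2 / (real n * c\<^sup>2))"
    using pos by (simp add: l_def field_simps power2_eq_square)
  finally show ?thesis by (simp only: E_def)
qed

text \<open>
  A form of the Efron-Stein inequality in which the influence of an observation is not bounded but controlled by
  a square integrable weight \<open>k\<close>. Let \<open>g\<close> be \<open>h\<close> with the last
  observation integrated out. The cross term of \<open>h - g\<close> and \<open>g - E h\<close> integrates
  to 0, and \<open>\<bar>h - g\<bar> \<le> k x + E k\<close> has a square of mean at most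
  \<open>2 E k\<^sup>2 + 2 (E k)\<^sup>2 \<le> 4 E k\<^sup>2\<close>. The growth condition on
  \<open>h\<close> makes all these integrals finite.
\<close>

lemma variance_le_of_weighted_differences:
  fixes h :: "(nat \<Rightarrow> 'a) \<Rightarrow> real"
  assumes k: "k \<in> borel_measurable M" "integrable M (\<lambda>x. (k x)\<^sup>2)" "\<And>x. k x \<ge> (0::real)"
    and "h \<in> borel_measurable (iid_sample n M)"
    and "\<And>\<xi>. \<xi> \<in> space (iid_sample n M) \<Longrightarrow> \<bar>h \<xi>\<bar> \<le> C + (\<Sum>i<n. k (\<xi> i))"
    and "\<And>\<xi> i x y. \<lbrakk>\<xi> \<in> space (iid_sample n M); i < n; x \<in> space M; y \<in> space M\<rbrakk>
      \<Longrightarrow> \<bar>h (\<xi>(i := x)) - h (\<xi>(i := y))\<bar> \<le> k x + k y"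
  shows "integrable (iid_sample n M) (\<lambda>\<xi>. (h \<xi> - c)\<^sup>2)"
    and "(\<integral>\<xi>. (h \<xi> - (\<integral>\<xi>. h \<xi> \<partial>iid_sample n M))\<^sup>2 \<partial>iid_sample n M)
      \<le> real n * (4 * (\<integral>x. (k x)\<^sup>2 \<partial>M))"
proof -
  define K where "K = (\<integral>x. (k x)\<^sup>2 \<partial>M)"
  have int_k: "integrable M k"
    by (rule square_integrable_imp_integrable) (use k in auto)
  have K1: "(\<integral>x. k x \<partial>M)\<^sup>2 \<le> K"
    using variance_positive[of k] variance_eq[OF int_k k(2)] by (simp add: K_def)
  have sq_le: "(a + b)\<^sup>2 \<le> 2 * a\<^sup>2 + 2 * b\<^sup>2" for a b :: real
    using sum_squares_bound[of a b] by (simp add: power2_sum)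
  have int_sq: "integrable (iid_sample m M) (\<lambda>\<xi>. (h \<xi> - c)\<^sup>2)"
    if h: "h \<in> borel_measurable (iid_sample m M)"
      and le: "\<And>\<xi>. \<xi> \<in> space (iid_sample m M) \<Longrightarrow> \<bar>h \<xi>\<bar> \<le> C + (\<Sum>i<m. k (\<xi> i))"
    for m C c and h :: "(nat \<Rightarrow> 'a) \<Rightarrow> real"
  proof -
    interpret I: prob_space "iid_sample m M" by (rule prob_space_iid)
    show ?thesis
    proof (rule Bochner_Integration.integrable_bound)
      show "integrable (iid_sample m M)
          (\<lambda>\<xi>. 2 * (\<bar>C\<bar> + \<bar>c\<bar>)\<^sup>2 + 2 * ((\<Sum>i<m. (k (\<xi> i))\<^sup>2) * real m))"
        by (intro Bochner_Integration.integrable_add integrable_mult_right integrable_mult_left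
            Bochner_Integration.integrable_sum integrable_iid_component[where h = "\<lambda>x. (k x)\<^sup>2"] k(2)) auto
      show "AE \<xi> in iid_sample m M. norm ((h \<xi> - c)\<^sup>2)
          \<le> norm (2 * (\<bar>C\<bar> + \<bar>c\<bar>)\<^sup>2 + 2 * ((\<Sum>i<m. (k (\<xi> i))\<^sup>2) * real m))"
      proof (rule AE_I2)
        fix \<xi> assume "\<xi> \<in> space (iid_sample m M)"
        from le[OF this] have "\<bar>h \<xi> - c\<bar> \<le> (\<bar>C\<bar> + \<bar>c\<bar>) + (\<Sum>i<m. k (\<xi> i))" by linarith
        then have "\<bar>h \<xi> - c\<bar>\<^sup>2 \<le> ((\<bar>C\<bar> + \<bar>c\<bar>) + (\<Sum>i<m. k (\<xi> i)))\<^sup>2" by (intro power_mono) auto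
        also have "\<dots> \<le> 2 * (\<bar>C\<bar> + \<bar>c\<bar>)\<^sup>2 + 2 * (\<Sum>i<m. k (\<xi> i))\<^sup>2" by (rule sq_le)
        also have "(\<Sum>i<m. k (\<xi> i))\<^sup>2 \<le> (\<Sum>i<m. (k (\<xi> i))\<^sup>2) * real m"
          using sum_squared_le_sum_of_squares[of "\<lambda>i. k (\<xi> i)" "{..<m}"] by simp
        finally have "(h \<xi> - c)\<^sup>2 \<le> 2 * (\<bar>C\<bar> + \<bar>c\<bar>)\<^sup>2 + 2 * ((\<Sum>i<m. (k (\<xi> i))\<^sup>2) * real m)" by simp
        then show "norm ((h \<xi> - c)\<^sup>2) \<le> norm (2 * (\<bar>C\<bar> + \<bar>c\<bar>)\<^sup>2 + 2 * ((\<Sum>i<m. (k (\<xi> i))\<^sup>2) * real m))"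
          by simp
      qed
    qed (use h in measurable)
  qed
  show "integrable (iid_sample n M) (\<lambda>\<xi>. (h \<xi> - c)\<^sup>2)" by (rule int_sq[OF assms(4,5)])
  show "(\<integral>\<xi>. (h \<xi> - (\<integral>\<xi>. h \<xi> \<partial>iid_sample n M))\<^sup>2 \<partial>iid_sample n M) \<le> real n * (4 * (\<integral>x. (k x)\<^sup>2 \<partial>M))"
    unfolding K_def[symmetric] using assms(4-6)
  proof (induction n arbitrary: h C)
    case 0
    then show ?case by (simp add: integral_iid_0)
  next
    case (Suc n)
    interpret I: prob_space "iid_sample n M" by (rule prob_space_iid)
    interpret I': prob_space "iid_sample (Suc n) M" by (rule prob_space_iid)
    note h = Suc.prems
    define g where "g \<xi> = (\<integral>x. h (\<xi>(n := x)) \<partial>M)" for \<xi>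
    have h_le: "\<bar>h (\<xi>(n := x))\<bar> \<le> (C + (\<Sum>i<n. k (\<xi> i))) + k x"
      if "\<xi> \<in> space (iid_sample n M)" "x \<in> space M" for \<xi> x
    proof -
      have "(\<Sum>i<n. k ((\<xi>(n := x)) i)) = (\<Sum>i<n. k (\<xi> i))" by (intro sum.cong) auto
      with h(2)[OF snoc_in_space_iid[OF that]] show ?thesis
        unfolding sum.lessThan_Suc fun_upd_same by linarith
    qed
    have meas_x: "(\<lambda>x. h (\<xi>(n := x))) \<in> borel_measurable M" if "\<xi> \<in> space (iid_sample n M)" for \<xi>
      by (rule measurable_snoc_comp[OF h(1) that])
    have int_x: "integrable M (\<lambda>x. h (\<xi>(n := x)))" if "\<xi> \<in> space (iid_sample n M)" for \<xi>
    proof (rule Bochner_Integration.integrable_bound)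
      show "integrable M (\<lambda>x. \<bar>C + (\<Sum>i<n. k (\<xi> i))\<bar> + k x)" using int_k by simp
      show "AE x in M. norm (h (\<xi>(n := x))) \<le> norm (\<bar>C + (\<Sum>i<n. k (\<xi> i))\<bar> + k x)"
      proof (rule AE_I2)
        fix x assume "x \<in> space M"
        from h_le[OF that this] show "norm (h (\<xi>(n := x))) \<le> norm (\<bar>C + (\<Sum>i<n. k (\<xi> i))\<bar> + k x)"
          using k(3)[of x] unfolding real_norm_def by linarith
      qed
    qed (rule meas_x[OF that])
    have int_sq_h: "integrable (iid_sample (Suc n) M) (\<lambda>\<xi>. (h \<xi> - c)\<^sup>2)" for c
      by (rule int_sq[OF h(1,2)])
    have int_h: "integrable (iid_sample (Suc n) M) h"
      using I'.square_integrable_imp_integrable[OF h(1)] int_sq_h[of 0] unfolding diff_0_right .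
    have g_meas: "g \<in> borel_measurable (iid_sample n M)"
      unfolding g_def by (rule measurable_integral_snoc[OF h(1)])
    have g_bd: "\<bar>g \<xi>\<bar> \<le> (C + (\<integral>x. k x \<partial>M)) + (\<Sum>i<n. k (\<xi> i))" if "\<xi> \<in> space (iid_sample n M)" for \<xi>
    proof -
      have "\<bar>g \<xi>\<bar> \<le> (\<integral>x. \<bar>h (\<xi>(n := x))\<bar> \<partial>M)" unfolding g_def by (rule integral_abs_bound)
      also have "\<dots> \<le> (\<integral>x. (C + (\<Sum>i<n. k (\<xi> i))) + k x \<partial>M)"
        by (intro integral_mono integrable_abs int_x that Bochner_Integration.integrable_add
            integrable_const int_k h_le)
      also have "\<dots> = (C + (\<integral>x. k x \<partial>M)) + (\<Sum>i<n. k (\<xi> i))"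
        using int_k by (simp add: prob_space)
      finally show ?thesis .
    qed
    have g_diff: "\<bar>g (\<xi>(i := x)) - g (\<xi>(i := y))\<bar> \<le> k x + k y"
      if "\<xi> \<in> space (iid_sample n M)" "i < n" "x \<in> space M" "y \<in> space M" for \<xi> i x y
      unfolding g_def
    proof (intro integral_abs_diff_le int_x upd_in_space_iid that)
      fix z assume z: "z \<in> space M"
      have twist: "\<xi>(i := v, n := z) = \<xi>(n := z, i := v)" for v using that(2) by (intro fun_upd_twist) simp
      show "\<bar>h (\<xi>(i := x, n := z)) - h (\<xi>(i := y, n := z))\<bar> \<le> k x + k y"
        unfolding twist using that z by (intro h(3) snoc_in_space_iid) auto
    qed
    define E where "E = (\<integral>\<xi>. h \<xi> \<partial>iid_sample (Suc n) M)"
    have E: "E = (\<integral>\<xi>. g \<xi> \<partial>iid_sample n M)"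
      unfolding E_def g_def by (rule integral_iid_Suc_inner[OF int_h])
    have int_sq_g: "integrable (iid_sample n M) (\<lambda>\<xi>. (g \<xi> - E)\<^sup>2)"
      by (rule int_sq[OF g_meas g_bd])
    have "(\<integral>\<xi>. (h \<xi> - E)\<^sup>2 \<partial>iid_sample (Suc n) M)
        = (\<integral>\<xi>. \<integral>x. (h (\<xi>(n := x)) - E)\<^sup>2 \<partial>M \<partial>iid_sample n M)"
      by (rule integral_iid_Suc_inner[OF int_sq_h])
    also have "\<dots> \<le> (\<integral>\<xi>. 4 * K + (g \<xi> - E)\<^sup>2 \<partial>iid_sample n M)"
    proof (rule integral_mono)
      show "integrable (iid_sample n M) (\<lambda>\<xi>. \<integral>x. (h (\<xi>(n := x)) - E)\<^sup>2 \<partial>M)"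
        by (rule integrable_iid_Suc_inner[OF int_sq_h])
      show "integrable (iid_sample n M) (\<lambda>\<xi>. 4 * K + (g \<xi> - E)\<^sup>2)" using int_sq_g by simp
      fix \<xi> assume \<xi>: "\<xi> \<in> space (iid_sample n M)"
      define v where "v x = h (\<xi>(n := x)) - g \<xi>" for x
      have v_int: "integrable M v" unfolding v_def using int_x[OF \<xi>] by simp
      have v_0: "(\<integral>x. v x \<partial>M) = 0"
        unfolding v_def using int_x[OF \<xi>] by (simp add: g_def prob_space)
      have v_sq: "(v x)\<^sup>2 \<le> 2 * (k x)\<^sup>2 + 2 * (\<integral>y. k y \<partial>M)\<^sup>2" if x: "x \<in> space M" for x
      proof -
        have "\<bar>v x\<bar> \<le> k x + (\<integral>y. k y \<partial>M)"
        proof -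
          have "\<bar>v x\<bar> = \<bar>\<integral>y. h (\<xi>(n := x)) - h (\<xi>(n := y)) \<partial>M\<bar>"
            unfolding v_def g_def using int_x[OF \<xi>] by (simp add: prob_space)
          also have "\<dots> \<le> (\<integral>y. \<bar>h (\<xi>(n := x)) - h (\<xi>(n := y))\<bar> \<partial>M)" by (rule integral_abs_bound)
          also have "\<dots> \<le> (\<integral>y. k x + k y \<partial>M)"
          proof (rule integral_mono)
            fix y assume y: "y \<in> space M"
            show "\<bar>h (\<xi>(n := x)) - h (\<xi>(n := y))\<bar> \<le> k x + k y"
              using h(3)[OF snoc_in_space_iid[OF \<xi> x] lessI x y] unfolding fun_upd_upd .
          qed (use int_x[OF \<xi>] int_k in auto)
          finally show ?thesis using int_k by (simp add: prob_space)
        qed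
        then have "\<bar>v x\<bar>\<^sup>2 \<le> (k x + (\<integral>y. k y \<partial>M))\<^sup>2" by (intro power_mono) auto
        also have "\<dots> \<le> 2 * (k x)\<^sup>2 + 2 * (\<integral>y. k y \<partial>M)\<^sup>2" by (rule sq_le)
        finally show ?thesis by simp
      qed
      have v_sq_int: "integrable M (\<lambda>x. (v x)\<^sup>2)"
      proof (rule Bochner_Integration.integrable_bound)
        show "integrable M (\<lambda>x. 2 * (k x)\<^sup>2 + 2 * (\<integral>y. k y \<partial>M)\<^sup>2)" using k(2) by simp
        show "(\<lambda>x. (v x)\<^sup>2) \<in> borel_measurable M"
          using meas_x[OF \<xi>] unfolding v_def by measurable
        show "AE x in M. norm ((v x)\<^sup>2) \<le> norm (2 * (k x)\<^sup>2 + 2 * (\<integral>y. k y \<partial>M)\<^sup>2)"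
          using v_sq by (intro AE_I2) simp
      qed
      have "(\<integral>x. (h (\<xi>(n := x)) - E)\<^sup>2 \<partial>M)
          = (\<integral>x. (v x)\<^sup>2 + 2 * (g \<xi> - E) * v x + (g \<xi> - E)\<^sup>2 \<partial>M)"
        by (intro Bochner_Integration.integral_cong) (auto simp: v_def power2_eq_square algebra_simps)
      also have "\<dots> = (\<integral>x. (v x)\<^sup>2 \<partial>M) + (g \<xi> - E)\<^sup>2"
        using v_sq_int v_int v_0 by (simp add: prob_space)
      also have "(\<integral>x. (v x)\<^sup>2 \<partial>M) \<le> (\<integral>x. 2 * (k x)\<^sup>2 + 2 * (\<integral>y. k y \<partial>M)\<^sup>2 \<partial>M)"
        using v_sq_int v_sq k(2) by (intro integral_mono) auto
      also have "\<dots> = 2 * K + 2 * (\<integral>y. k y \<partial>M)\<^sup>2"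
        using k(2) by (simp add: K_def prob_space)
      finally show "(\<integral>x. (h (\<xi>(n := x)) - E)\<^sup>2 \<partial>M) \<le> 4 * K + (g \<xi> - E)\<^sup>2"
        using K1 by linarith
    qed
    also have "\<dots> = 4 * K + (\<integral>\<xi>. (g \<xi> - E)\<^sup>2 \<partial>iid_sample n M)"
      using int_sq_g by (simp add: I.prob_space)
    also have "\<dots> \<le> 4 * K + real n * (4 * K)"
      unfolding E by (intro add_left_mono Suc.IH[OF g_meas g_bd g_diff])
    finally show ?case by (simp add: E_def algebra_simps)
  qed
qed

end

section \<open>The mean of the largest deviation\<close>

lemma abs_MAX_diff_le:
  fixes u v :: "'t \<Rightarrow> real"
  assumes T: "finite T" "T \<noteq> {}" and le: "\<And>t. t \<in> T \<Longrightarrow> \<bar>u t - v t\<bar> \<le> c"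
  shows "\<bar>(MAX t\<in>T. u t) - (MAX t\<in>T. v t)\<bar> \<le> c"
proof -
  have *: "(MAX t\<in>T. p t) \<le> (MAX t\<in>T. q t) + c" if "\<And>t. t \<in> T \<Longrightarrow> p t \<le> q t + c" for p q :: "'t \<Rightarrow> real"
  proof (intro Max.boundedI)
    fix y assume "y \<in> p ` T"
    then obtain t where t: "t \<in> T" "y = p t" by blast
    have "q t \<le> (MAX t\<in>T. q t)" using T t(1) by (intro Max_ge) auto
    then show "y \<le> (MAX t\<in>T. q t) + c" using that[OF t(1)] t(2) by linarith
  qed (use T in auto)
  have "u t \<le> v t + c" "v t \<le> u t + c" if "t \<in> T" for t
    using le[OF that] by linarith+
  then show ?thesis using *[of u v] *[of v u] by fastforce
qed

lemma sum_upd_split: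
  fixes q :: "'a \<Rightarrow> real" and i n :: nat
  assumes "i < n"
  shows "(\<Sum>j<n. q ((\<xi>(i := x)) j)) = q x + (\<Sum>j\<in>{..<n} - {i}. q (\<xi> j))"
proof -
  have "(\<Sum>j<n. q ((\<xi>(i := x)) j)) = q ((\<xi>(i := x)) i) + (\<Sum>j\<in>{..<n} - {i}. q ((\<xi>(i := x)) j))"
    using assms by (intro sum.remove) auto
  also have "(\<Sum>j\<in>{..<n} - {i}. q ((\<xi>(i := x)) j)) = (\<Sum>j\<in>{..<n} - {i}. q (\<xi> j))"
    by (intro sum.cong) auto
  finally show ?thesis by simp
qed

text \<open>
  A data distribution with a finite \<open>r\<close>-th moment, together with the quantile level. A pair
  \<open>(x, y)\<close> is treated as one vector \<open>z\<close>, with residual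
  \<open>w \<bullet> z - s\<close> with \<open>w = (-\<beta>, 1)\<close>.
\<close>

locale check_loss_sample = prob_space M for M :: "'a::euclidean_space measure" +
  fixes \<nu> :: "'a \<Rightarrow> real" and \<alpha> r :: real
  assumes sets_M: "sets M = sets borel" and \<nu>: "is_norm \<nu>" and r: "r > 2"
    and moment: "integrable M (\<lambda>z. \<nu> z powr r)" and \<alpha>: "0 < \<alpha>" "\<alpha> < 1"
begin

definition slope :: real where "slope = max \<alpha> (1 - \<alpha>)"

definition \<Gamma> :: real where "\<Gamma> = (\<integral>z. \<nu> z powr r \<partial>M)"

abbreviation "\<kappa> \<equiv> 2 / (r - 2)"

abbreviation "loss t z \<equiv> shifted_loss \<alpha> t z"

text \<open>
  Deviations are sums rather than averages over the sample; the division by \<open>n\<close> comes at the end.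
\<close>

definition dev :: "('a \<times> real \<Rightarrow> 'a \<Rightarrow> real) \<Rightarrow> nat \<Rightarrow> (nat \<Rightarrow> 'a) \<Rightarrow> 'a \<times> real \<Rightarrow> real" where
  "dev f n \<xi> t = (\<Sum>i<n. (\<integral>y. f t y \<partial>M) - f t (\<xi> i))"

text \<open>The radial projection onto the unit ball.\<close>

definition trunc :: "'a \<Rightarrow> 'a" where
  "trunc z = (1 / max 1 (\<nu> z)) *\<^sub>R z"

definition excess :: "'a \<Rightarrow> real" where
  "excess z = max 0 (\<nu> z - 1)"

lemma slope_pos: "slope > 0"
  using \<alpha> by (simp add: slope_def)

lemma \<kappa>_pos: "\<kappa> > 0"
  using r by simp

lemma \<Gamma>_nonneg: "\<Gamma> \<ge> 0"
  by (simp add: \<Gamma>_def)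

lemma continuous_measurable_M:
  "continuous_on UNIV f \<Longrightarrow> f \<in> measurable M borel"
  using measurable_cong_sets[OF sets_M refl] borel_measurable_continuous_onI by blast

lemma measurable_\<nu>: "\<nu> \<in> borel_measurable M"
  by (intro continuous_measurable_M is_norm_continuous[OF \<nu>])

lemma loss_lipschitz:
  assumes "dual_norm \<nu> (fst t) \<le> 1"
  shows "\<bar>loss t x - loss t y\<bar> \<le> slope * \<nu> (x - y)"
proof -
  have "\<bar>loss t x - loss t y\<bar> \<le> slope * \<bar>(fst t \<bullet> x - snd t) - (fst t \<bullet> y - snd t)\<bar>"
    using check_loss_lipschitz[OF \<alpha>, of "fst t \<bullet> x - snd t" "fst t \<bullet> y - snd t"]
    by (simp add: shifted_loss_def slope_def)
  also have "\<bar>(fst t \<bullet> x - snd t) - (fst t \<bullet> y - snd t)\<bar> = \<bar>(x - y) \<bullet> fst t\<bar>"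
    unfolding inner_diff_left inner_commute[of "fst t"] by simp
  also have "\<dots> \<le> \<nu> (x - y) * dual_norm \<nu> (fst t)" by (rule abs_inner_le_dual_norm[OF \<nu>])
  also have "\<dots> \<le> \<nu> (x - y) * 1" by (intro mult_left_mono assms is_norm_nonneg[OF \<nu>])
  finally show ?thesis using slope_pos by simp
qed

lemma loss_0: "loss t 0 = 0"
  by (simp add: shifted_loss_def)

lemma abs_loss_le: "dual_norm \<nu> (fst t) \<le> 1 \<Longrightarrow> \<bar>loss t z\<bar> \<le> slope * \<nu> z"
  using loss_lipschitz[of t z 0] by (simp add: loss_0)

lemma measurable_loss: "loss t \<in> borel_measurable M"
  unfolding shifted_loss_def
  by (intro continuous_measurable_M continuous_on_check_loss \<alpha> continuous_intros)

lemma \<nu>_trunc: "\<nu> (trunc z) = \<nu> z / max 1 (\<nu> z)"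
  by (simp add: trunc_def is_norm_scale[OF \<nu>])

lemma \<nu>_trunc_le: "\<nu> (trunc z) \<le> 1" "\<nu> (trunc z) \<le> \<nu> z"
proof -
  have m: "max 1 (\<nu> z) > 0" by simp
  show "\<nu> (trunc z) \<le> 1" unfolding \<nu>_trunc using m by (simp add: divide_le_eq)
  have "\<nu> z * 1 \<le> \<nu> z * max 1 (\<nu> z)" by (intro mult_left_mono is_norm_nonneg[OF \<nu>]) auto
  then show "\<nu> (trunc z) \<le> \<nu> z" unfolding \<nu>_trunc using m by (simp add: divide_le_eq)
qed

lemma \<nu>_diff_trunc: "\<nu> (z - trunc z) = excess z"
proof -
  have m: "max 1 (\<nu> z) > 0" by simp
  have "z - trunc z = (1 - 1 / max 1 (\<nu> z)) *\<^sub>R z" by (simp add: trunc_def scaleR_diff_left)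
  then have "\<nu> (z - trunc z) = \<bar>1 - 1 / max 1 (\<nu> z)\<bar> * \<nu> z" by (simp only: is_norm_scale[OF \<nu>])
  also have "\<dots> = excess z" by (auto simp: excess_def max_def field_simps)
  finally show ?thesis .
qed

lemma excess_nonneg: "excess z \<ge> 0"
  by (simp add: excess_def)

lemma measurable_trunc: "trunc \<in> measurable M M"
proof -
  have "continuous_on UNIV trunc"
    unfolding trunc_def
    by (intro continuous_intros is_norm_continuous[OF \<nu>]) (simp add: max_def)
  then have "trunc \<in> measurable M borel" by (rule continuous_measurable_M)
  then show ?thesis using measurable_cong_sets[OF refl sets_M] by blast
qed

lemma measurable_excess: "excess \<in> borel_measurable M"
  unfolding excess_def using measurable_\<nu> by measurable

lemma integrable_\<nu>: "integrable M \<nu>"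
proof (rule Bochner_Integration.integrable_bound)
  show "integrable M (\<lambda>z. 1 + \<nu> z powr r)" using moment by simp
  show "AE z in M. norm (\<nu> z) \<le> norm (1 + \<nu> z powr r)"
  proof (rule AE_I2)
    fix z
    have "\<nu> z \<le> 1 + \<nu> z powr r"
    proof (cases "\<nu> z \<le> 1")
      case False
      then have "\<nu> z powr 1 \<le> \<nu> z powr r" using r by (intro powr_mono) auto
      then show ?thesis using False by simp
    qed (simp add: add_increasing2)
    then show "norm (\<nu> z) \<le> norm (1 + \<nu> z powr r)" using is_norm_nonneg[OF \<nu>, of z] by simp
  qed
qed (rule measurable_\<nu>)

lemma integrable_loss_comp:
  assumes t: "dual_norm \<nu> (fst t) \<le> 1" and g: "g \<in> measurable M M" "\<And>z. \<nu> (g z) \<le> \<nu> z"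
  shows "integrable M (\<lambda>z. loss t (g z))"
proof (rule Bochner_Integration.integrable_bound)
  show "integrable M (\<lambda>z. slope * \<nu> z)" using integrable_\<nu> by simp
  show "(\<lambda>z. loss t (g z)) \<in> borel_measurable M" by (rule measurable_compose[OF g(1) measurable_loss])
  show "AE z in M. norm (loss t (g z)) \<le> norm (slope * \<nu> z)"
  proof (rule AE_I2)
    fix z
    have "\<bar>loss t (g z)\<bar> \<le> slope * \<nu> (g z)" by (rule abs_loss_le[OF t])
    also have "\<dots> \<le> slope * \<nu> z" using slope_pos g(2) by simp
    finally show "norm (loss t (g z)) \<le> norm (slope * \<nu> z)" by simp
  qed
qed

lemma integrable_loss: "dual_norm \<nu> (fst t) \<le> 1 \<Longrightarrow> integrable M (loss t)"
  using integrable_loss_comp[of t "\<lambda>z. z"] by simp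

lemma integrable_loss_trunc: "dual_norm \<nu> (fst t) \<le> 1 \<Longrightarrow> integrable M (\<lambda>z. loss t (trunc z))"
  by (intro integrable_loss_comp measurable_trunc \<nu>_trunc_le)

lemma excess_square_le: "(excess z)\<^sup>2 \<le> \<kappa>\<^sup>2 * \<nu> z powr r"
proof -
  have "excess z \<le> \<kappa> * \<nu> z powr (r / 2)"
    using diff_one_le_powr[OF r is_norm_nonneg[OF \<nu>, of z]] \<kappa>_pos by (simp add: excess_def)
  then have "(excess z)\<^sup>2 \<le> (\<kappa> * \<nu> z powr (r / 2))\<^sup>2" by (intro power_mono excess_nonneg)
  then show ?thesis by (simp only: power_mult_distrib powr_half_square)
qed

lemma integrable_excess_square: "integrable M (\<lambda>z. (excess z)\<^sup>2)"
proof (rule Bochner_Integration.integrable_bound)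
  show "integrable M (\<lambda>z. \<kappa>\<^sup>2 * \<nu> z powr r)" using moment by simp
  show "(\<lambda>z. (excess z)\<^sup>2) \<in> borel_measurable M" using measurable_excess by measurable
  show "AE z in M. norm ((excess z)\<^sup>2) \<le> norm (\<kappa>\<^sup>2 * \<nu> z powr r)"
    using excess_square_le by (intro AE_I2) simp
qed

lemma integral_excess_square_le: "(\<integral>z. (excess z)\<^sup>2 \<partial>M) \<le> \<kappa>\<^sup>2 * \<Gamma>"
proof -
  have "(\<integral>z. (excess z)\<^sup>2 \<partial>M) \<le> (\<integral>z. \<kappa>\<^sup>2 * \<nu> z powr r \<partial>M)"
    using moment integrable_excess_square excess_square_le by (intro integral_mono) auto
  then show ?thesis by (simp add: \<Gamma>_def)
qed

lemma integrable_dev: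
  assumes "integrable M (f t)"
  shows "integrable (iid_sample n M) (\<lambda>\<xi>. dev f n \<xi> t)"
proof -
  interpret I: prob_space "iid_sample n M" by (rule prob_space_iid)
  show ?thesis
    unfolding dev_def using assms
    by (intro Bochner_Integration.integrable_sum Bochner_Integration.integrable_diff
        I.integrable_const integrable_iid_component) auto
qed

lemma dev_upd_diff:
  assumes "i < n"
  shows "dev f n (\<xi>(i := x)) t - dev f n (\<xi>(i := y)) t = f t y - f t x"
  unfolding dev_def using sum_upd_split[OF assms, of "\<lambda>z. (\<integral>y. f t y \<partial>M) - f t z" \<xi>] by simp

text \<open>
  Jensen's inequality for the square root, in the form that a variance is nonnegative.
\<close>

lemma integral_sqrt_sum_le:
  "integrable (iid_sample n M) (\<lambda>\<xi>. sqrt (\<Sum>i<n. \<nu> (\<xi> i) powr r))"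
  "(\<integral>\<xi>. sqrt (\<Sum>i<n. \<nu> (\<xi> i) powr r) \<partial>iid_sample n M) \<le> sqrt (real n * \<Gamma>)"
proof -
  interpret I: prob_space "iid_sample n M" by (rule prob_space_iid)
  define X where "X = (\<lambda>\<xi> :: nat \<Rightarrow> 'a. sqrt (\<Sum>i<n. \<nu> (\<xi> i) powr r))"
  have sq: "(X \<xi>)\<^sup>2 = (\<Sum>i<n. \<nu> (\<xi> i) powr r)" for \<xi>
    by (simp add: X_def sum_nonneg)
  have int_i: "integrable (iid_sample n M) (\<lambda>\<xi>. \<nu> (\<xi> i) powr r)" if "i < n" for i
    using integrable_iid_component[OF that moment] .
  have meas: "X \<in> borel_measurable (iid_sample n M)"
  proof -
    have "(\<lambda>\<xi>. \<Sum>i<n. \<nu> (\<xi> i) powr r) \<in> borel_measurable (iid_sample n M)"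
      by (intro borel_measurable_integrable Bochner_Integration.integrable_sum int_i) simp
    then show ?thesis unfolding X_def by measurable
  qed
  have int_sq: "integrable (iid_sample n M) (\<lambda>\<xi>. (X \<xi>)\<^sup>2)"
    unfolding sq by (intro Bochner_Integration.integrable_sum int_i) auto
  have int: "integrable (iid_sample n M) X"
    by (rule I.square_integrable_imp_integrable[OF meas int_sq])
  then show "integrable (iid_sample n M) (\<lambda>\<xi>. sqrt (\<Sum>i<n. \<nu> (\<xi> i) powr r))"
    unfolding X_def .
  have "(\<integral>\<xi>. X \<xi> \<partial>iid_sample n M)\<^sup>2 \<le> (\<integral>\<xi>. (X \<xi>)\<^sup>2 \<partial>iid_sample n M)"
    using I.variance_positive[of X] I.variance_eq[OF int int_sq] by simp
  also have "\<dots> = (\<Sum>i<n. \<integral>\<xi>. \<nu> (\<xi> i) powr r \<partial>iid_sample n M)"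
    unfolding sq by (intro Bochner_Integration.integral_sum int_i) auto
  also have "\<dots> = real n * \<Gamma>"
  proof -
    have "(\<integral>\<xi>. \<nu> (\<xi> i) powr r \<partial>iid_sample n M) = \<Gamma>" if "i < n" for i
      unfolding \<Gamma>_def using integral_iid_component[OF that, of "\<lambda>z. \<nu> z powr r"] moment by simp
    then show ?thesis by simp
  qed
  finally show "(\<integral>\<xi>. sqrt (\<Sum>i<n. \<nu> (\<xi> i) powr r) \<partial>iid_sample n M) \<le> sqrt (real n * \<Gamma>)"
    unfolding X_def by (rule real_le_rsqrt)
qed

text \<open>
  Up to the factor \<open>slope\<close>, a bound for the expected Rademacher average of the loss class over a
  sample of size \<open>n\<close>.
\<close>

definition complexity :: "nat \<Rightarrow> real" where
  "complexity n = (4 * sqrt DIM('a) + 2) * (sqrt n + \<kappa> * sqrt (real n * \<Gamma>))"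

text \<open>
  The map \<open>g\<close> will be the identity or the truncation. The case \<open>c = - 1\<close> is needed
  because the part beyond the truncation is a difference of two losses; it reduces to \<open>c = 1\<close>
  since random signs are symmetric.
\<close>

lemma integral_MAX_dev_le:
  assumes T: "finite T" "T \<noteq> {}" "\<And>t. t \<in> T \<Longrightarrow> dual_norm \<nu> (fst t) \<le> 1"
    and g: "g \<in> measurable M M" "\<And>z. \<nu> (g z) \<le> \<nu> z" and c: "c = 1 \<or> c = - 1"
  shows "(\<integral>\<xi>. (MAX t\<in>T. dev (\<lambda>t z. c * loss t (g z)) n \<xi> t) \<partial>iid_sample n M) \<le> 2 * slope * complexity n"
proof -
  interpret I: prob_space "iid_sample n M" by (rule prob_space_iid)
  let ?f = "\<lambda>t z. c * loss t (g z)"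
  have f: "integrable M (?f t)" if "t \<in> T" for t
    using integrable_loss_comp[OF T(3)[OF that] g] by simp
  define H where "H \<xi> e = (MAX t\<in>T. \<Sum>i<n. e i * loss t (g (\<xi> i)))" for \<xi> :: "nat \<Rightarrow> 'a" and e
  define W where "W \<xi> = slope * ((4 * sqrt DIM('a) + 2) * (sqrt n + \<kappa> * sqrt (\<Sum>i<n. \<nu> (\<xi> i) powr r)))"
    for \<xi> :: "nat \<Rightarrow> 'a"
  have avg_le: "sign_avg n (H \<xi>) \<le> W \<xi>" for \<xi>
  proof -
    have "sign_avg n (H \<xi>) \<le> max \<alpha> (1 - \<alpha>) * ((4 * sqrt DIM('a) + 2) *
       (sqrt n + 2 / (r - 2) * sqrt (\<Sum>i<n. \<nu> (g (\<xi> i)) powr r)))"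
      unfolding H_def by (rule sign_avg_Max_shifted_loss_le[OF \<alpha> \<nu> r T])
    also have "\<dots> \<le> W \<xi>"
      unfolding W_def slope_def[symmetric] using slope_pos r
      by (intro mult_left_mono add_left_mono real_sqrt_le_mono sum_mono powr_mono2 g(2)
          is_norm_nonneg[OF \<nu>]) auto
    finally show ?thesis .
  qed
  have sign_le: "sign_avg n (\<lambda>e. MAX t\<in>T. 0 + (\<Sum>i<n. e i * (2 * ?f t (\<xi> i)))) \<le> 2 * W \<xi>" for \<xi>
  proof -
    have "sign_avg n (\<lambda>e. MAX t\<in>T. 0 + (\<Sum>i<n. e i * (2 * ?f t (\<xi> i))))
        \<le> sign_avg n (\<lambda>e. 2 * H \<xi> (\<lambda>i. c * e i))"
    proof (intro sign_avg_mono Max.boundedI)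
      fix e :: "nat \<Rightarrow> real" and x
      assume "x \<in> (\<lambda>t. 0 + (\<Sum>i<n. e i * (2 * ?f t (\<xi> i)))) ` T"
      then obtain t where t: "t \<in> T" "x = (\<Sum>i<n. e i * (2 * ?f t (\<xi> i)))" by auto
      have "x = 2 * (\<Sum>i<n. (c * e i) * loss t (g (\<xi> i)))"
        unfolding t(2) sum_distrib_left by (intro sum.cong) auto
      also have "\<dots> \<le> 2 * H \<xi> (\<lambda>i. c * e i)"
        unfolding H_def using T t by (intro mult_left_mono Max_ge) auto
      finally show "x \<le> 2 * H \<xi> (\<lambda>i. c * e i)" .
    qed (use T in auto)
    also have "\<dots> = 2 * sign_avg n (\<lambda>e. H \<xi> (\<lambda>i. c * e i))" by (rule sign_avg_cmult)
    also have "sign_avg n (\<lambda>e. H \<xi> (\<lambda>i. c * e i)) = sign_avg n (H \<xi>)"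
      using c sign_avg_flip[of n "H \<xi>"] by auto
    finally show ?thesis using avg_le[of \<xi>] by linarith
  qed
  have int_W: "integrable (iid_sample n M) W"
    unfolding W_def using integral_sqrt_sum_le(1)
    by (intro integrable_mult_right Bochner_Integration.integrable_add I.integrable_const)
  have "(\<integral>\<xi>. (MAX t\<in>T. dev ?f n \<xi> t) \<partial>iid_sample n M)
      \<le> (\<integral>\<xi>. sign_avg n (\<lambda>e. MAX t\<in>T. 0 + (\<Sum>i<n. e i * (2 * ?f t (\<xi> i)))) \<partial>iid_sample n M)"
    using integral_symmetrization_le[where f = ?f and A = "\<lambda>_. 0" and n = n, OF T(1,2) f]
    by (simp add: dev_def)
  also have "\<dots> \<le> (\<integral>\<xi>. 2 * W \<xi> \<partial>iid_sample n M)"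
  proof (rule integral_mono)
    show "integrable (iid_sample n M)
        (\<lambda>\<xi>. sign_avg n (\<lambda>e. MAX t\<in>T. 0 + (\<Sum>i<n. e i * (2 * ?f t (\<xi> i)))))"
      using T(1,2) f
      by (intro integrable_sign_avg integrable_MAX Bochner_Integration.integrable_add I.integrable_const
          Bochner_Integration.integrable_sum integrable_mult_right integrable_iid_component[where h = "?f _"])
        auto
  qed (use int_W sign_le in auto)
  also have "\<dots> = 2 * (slope * ((4 * sqrt DIM('a) + 2) *
      (sqrt n + \<kappa> * (\<integral>\<xi>. sqrt (\<Sum>i<n. \<nu> (\<xi> i) powr r) \<partial>iid_sample n M))))"
    unfolding W_def using integral_sqrt_sum_le(1) by (simp add: I.prob_space)
  also have "\<dots> \<le> 2 * (slope * complexity n)"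
    unfolding complexity_def using slope_pos \<kappa>_pos integral_sqrt_sum_le(2)
    by (intro mult_left_mono add_left_mono) auto
  finally show ?thesis by simp
qed

section \<open>Tail bounds for finitely many parameters\<close>

text \<open>
  The first term bounds the two means, the second is the fluctuation of the truncated part and the third that of
  the excess. The summand 1 in the third term keeps it positive when \<open>\<Gamma> = 0\<close>, so that
  Chebyshev's inequality applies.
\<close>

definition threshold :: "nat \<Rightarrow> real \<Rightarrow> real" where
  "threshold n \<eta> = 6 * slope * complexity n + slope * sqrt (2 * real n * ln (3 / \<eta>))
     + slope * (sqrt n * (1 + \<kappa> * sqrt (6 * \<Gamma> / \<eta>)))"

text \<open>
  A truncated observation has norm at most 1, so replacing it changes each deviation by at most
  \<open>2 * slope\<close>.
\<close>

lemma prob_trunc_dev_ge: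
  assumes T: "finite T" "T \<noteq> {}" "\<And>t. t \<in> T \<Longrightarrow> dual_norm \<nu> (fst t) \<le> 1"
    and n: "n > 0" and \<eta>: "0 < \<eta>" "\<eta> < 1"
  defines "S \<equiv> \<lambda>\<xi>. MAX t\<in>T. dev (\<lambda>t z. loss t (trunc z)) n \<xi> t"
  shows "measure (iid_sample n M)
    {\<xi> \<in> space (iid_sample n M). S \<xi> \<ge> (\<integral>\<xi>. S \<xi> \<partial>iid_sample n M) + slope * sqrt (2 * real n * ln (3 / \<eta>))}
    \<le> \<eta> / 3"
proof -
  let ?f = "\<lambda>t z. loss t (trunc z)"
  let ?u = "slope * sqrt (2 * real n * ln (3 / \<eta>))"
  have ln_pos: "ln (3 / \<eta>) > 0" using \<eta> by simp
  have diff: "\<bar>?f t x - ?f t y\<bar> \<le> 2 * slope" if "t \<in> T" for t x y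
  proof -
    have le: "\<bar>?f t z\<bar> \<le> slope" for z
    proof -
      have "\<bar>?f t z\<bar> \<le> slope * \<nu> (trunc z)" by (rule abs_loss_le[OF T(3)[OF that]])
      also have "\<dots> \<le> slope * 1" using slope_pos \<nu>_trunc_le(1) by (intro mult_left_mono) auto
      finally show ?thesis by simp
    qed
    show ?thesis using le[of x] le[of y] by linarith
  qed
  have "measure (iid_sample n M) {\<xi> \<in> space (iid_sample n M). S \<xi> \<ge> (\<integral>\<xi>. S \<xi> \<partial>iid_sample n M) + ?u}
    \<le> exp (- (2 * ?u\<^sup>2 / (real n * (2 * slope)\<^sup>2)))"
  proof (rule McDiarmid)
    have "integrable (iid_sample n M) S"
      unfolding S_def using T by (intro integrable_MAX integrable_dev integrable_loss_trunc) auto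
    then show "S \<in> borel_measurable (iid_sample n M)" by simp
    fix \<xi>
    have "\<bar>dev ?f n \<xi> t\<bar> \<le> real n * (2 * slope)" if t: "t \<in> T" for t
    proof -
      have "\<bar>dev ?f n \<xi> t\<bar> \<le> (\<Sum>i<n. \<bar>(\<integral>y. ?f t y \<partial>M) - ?f t (\<xi> i)\<bar>)"
        unfolding dev_def by (rule sum_abs)
      also have "\<dots> \<le> (\<Sum>i<n. 2 * slope)"
      proof (rule sum_mono)
        fix i
        have "\<bar>(\<integral>y. ?f t y \<partial>M) - (\<integral>y. ?f t (\<xi> i) \<partial>M)\<bar> \<le> 2 * slope"
          using t diff by (intro integral_abs_diff_le integrable_loss_trunc T(3)) auto
        then show "\<bar>(\<integral>y. ?f t y \<partial>M) - ?f t (\<xi> i)\<bar> \<le> 2 * slope" by (simp add: prob_space)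
      qed
      finally show ?thesis by simp
    qed
    then have "\<bar>S \<xi> - (MAX t\<in>T. 0)\<bar> \<le> real n * (2 * slope)"
      unfolding S_def by (intro abs_MAX_diff_le T(1,2)) auto
    then show "\<bar>S \<xi>\<bar> \<le> real n * (2 * slope)" using T by simp
    fix i x y assume i: "i < n"
    show "\<bar>S (\<xi>(i := x)) - S (\<xi>(i := y))\<bar> \<le> 2 * slope"
      unfolding S_def by (intro abs_MAX_diff_le T(1,2)) (simp only: dev_upd_diff[OF i] diff)
  qed (use n slope_pos ln_pos in auto)
  also have "2 * ?u\<^sup>2 / (real n * (2 * slope)\<^sup>2) = ln (3 / \<eta>)"
    using n slope_pos ln_pos by (simp add: power_mult_distrib field_simps)
  also have "exp (- ln (3 / \<eta>)) = \<eta> / 3" using \<eta> by (simp add: exp_minus)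
  finally show ?thesis .
qed

text \<open>
  Replacing an observation \<open>x\<close> by \<open>y\<close> changes each deviation by at most
  \<open>slope * (excess x + excess y)\<close>, and \<open>excess\<close> has second moment at most
  \<open>\<kappa>\<^sup>2 * \<Gamma>\<close>.
\<close>

lemma prob_excess_dev_ge:
  assumes T: "finite T" "T \<noteq> {}" "\<And>t. t \<in> T \<Longrightarrow> dual_norm \<nu> (fst t) \<le> 1"
    and n: "n > 0" and \<eta>: "0 < \<eta>" "\<eta> < 1"
  defines "S \<equiv> \<lambda>\<xi>. MAX t\<in>T. dev (\<lambda>t z. loss t z - loss t (trunc z)) n \<xi> t"
  shows "measure (iid_sample n M)
    {\<xi> \<in> space (iid_sample n M).
      S \<xi> \<ge> (\<integral>\<xi>. S \<xi> \<partial>iid_sample n M) + slope * (sqrt n * (1 + \<kappa> * sqrt (6 * \<Gamma> / \<eta>)))}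
    \<le> 2 * \<eta> / 3"
proof -
  let ?f = "\<lambda>t z. loss t z - loss t (trunc z)"
  let ?u = "slope * (sqrt n * (1 + \<kappa> * sqrt (6 * \<Gamma> / \<eta>)))"
  interpret I: prob_space "iid_sample n M" by (rule prob_space_iid)
  define k where "k z = slope * excess z" for z
  have k: "k \<in> borel_measurable M" "integrable M (\<lambda>z. (k z)\<^sup>2)" "k z \<ge> 0" for z
    using measurable_excess integrable_excess_square slope_pos excess_nonneg
    by (auto simp: k_def[abs_def] power_mult_distrib)
  have int_k: "integrable M k"
    by (rule square_integrable_imp_integrable[OF k(1,2)])
  have f_le: "\<bar>?f t z\<bar> \<le> k z" if "t \<in> T" for t z
    using loss_lipschitz[OF T(3)[OF that], of z "trunc z"] by (simp add: \<nu>_diff_trunc k_def)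
  have int_f: "integrable M (?f t)" if "t \<in> T" for t
    using T(3)[OF that] by (intro Bochner_Integration.integrable_diff integrable_loss integrable_loss_trunc)
  have int_S: "integrable (iid_sample n M) S"
    unfolding S_def using T by (intro integrable_MAX integrable_dev int_f) auto
  have meas: "S \<in> borel_measurable (iid_sample n M)" using int_S by simp
  have bound: "\<bar>S \<xi>\<bar> \<le> real n * (\<integral>z. k z \<partial>M) + (\<Sum>i<n. k (\<xi> i))" for \<xi>
  proof -
    have "\<bar>dev ?f n \<xi> t\<bar> \<le> real n * (\<integral>z. k z \<partial>M) + (\<Sum>i<n. k (\<xi> i))" if t: "t \<in> T" for t
    proof -
      have "\<bar>dev ?f n \<xi> t\<bar> \<le> (\<Sum>i<n. \<bar>(\<integral>y. ?f t y \<partial>M) - ?f t (\<xi> i)\<bar>)"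
        unfolding dev_def by (rule sum_abs)
      also have "\<dots> \<le> (\<Sum>i<n. (\<integral>z. k z \<partial>M) + k (\<xi> i))"
      proof (rule sum_mono)
        fix i
        have "\<bar>\<integral>y. ?f t y \<partial>M\<bar> \<le> (\<integral>y. \<bar>?f t y\<bar> \<partial>M)" by (rule integral_abs_bound)
        also have "\<dots> \<le> (\<integral>z. k z \<partial>M)"
          using int_f[OF t] int_k f_le[OF t] by (intro integral_mono) auto
        finally show "\<bar>(\<integral>y. ?f t y \<partial>M) - ?f t (\<xi> i)\<bar> \<le> (\<integral>z. k z \<partial>M) + k (\<xi> i)"
          using f_le[OF t, of "\<xi> i"] by linarith
      qed
      finally show ?thesis by (simp add: sum.distrib)
    qed
    then have "\<bar>S \<xi> - (MAX t\<in>T. 0)\<bar> \<le> real n * (\<integral>z. k z \<partial>M) + (\<Sum>i<n. k (\<xi> i))"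
      unfolding S_def by (intro abs_MAX_diff_le T(1,2)) auto
    then show ?thesis using T by simp
  qed
  have diff: "\<bar>S (\<xi>(i := x)) - S (\<xi>(i := y))\<bar> \<le> k x + k y" if i: "i < n" for \<xi> i x y
    unfolding S_def
  proof (intro abs_MAX_diff_le T(1,2))
    fix t assume t: "t \<in> T"
    show "\<bar>dev ?f n (\<xi>(i := x)) t - dev ?f n (\<xi>(i := y)) t\<bar> \<le> k x + k y"
      unfolding dev_upd_diff[OF i] using f_le[OF t, of x] f_le[OF t, of y] by linarith
  qed
  note var = variance_le_of_weighted_differences[OF k meas bound diff]
  have sq: "integrable (iid_sample n M) (\<lambda>\<xi>. (S \<xi>)\<^sup>2)" using var(1)[of 0] by simp
  have "sqrt n * (1 + \<kappa> * sqrt (6 * \<Gamma> / \<eta>)) > 0"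
    using n \<kappa>_pos \<Gamma>_nonneg \<eta> by (intro mult_pos_pos add_pos_nonneg mult_nonneg_nonneg) auto
  then have u: "?u > 0" using slope_pos by simp
  have "I.variance S \<le> real n * (4 * (\<integral>z. (k z)\<^sup>2 \<partial>M))" by (rule var(2))
  also have "(\<integral>z. (k z)\<^sup>2 \<partial>M) = slope\<^sup>2 * (\<integral>z. (excess z)\<^sup>2 \<partial>M)"
    by (simp add: k_def power_mult_distrib)
  also have "real n * (4 * (slope\<^sup>2 * (\<integral>z. (excess z)\<^sup>2 \<partial>M))) \<le> real n * (4 * (slope\<^sup>2 * (\<kappa>\<^sup>2 * \<Gamma>)))"
    by (intro mult_left_mono integral_excess_square_le) auto
  also have "\<dots> = 2 * \<eta> / 3 * (slope * (sqrt n * (\<kappa> * sqrt (6 * \<Gamma> / \<eta>))))\<^sup>2"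
  proof -
    have "(slope * (sqrt n * (\<kappa> * sqrt (6 * \<Gamma> / \<eta>))))\<^sup>2 = slope\<^sup>2 * (real n * (\<kappa>\<^sup>2 * (6 * \<Gamma> / \<eta>)))"
      using \<Gamma>_nonneg \<eta> by (simp only: power_mult_distrib) simp
    then show ?thesis using \<eta> by simp
  qed
  also have "\<dots> \<le> 2 * \<eta> / 3 * ?u\<^sup>2"
    using slope_pos \<kappa>_pos \<eta> \<Gamma>_nonneg
    by (intro mult_left_mono power_mono mult_nonneg_nonneg) auto
  finally have V: "I.variance S \<le> 2 * \<eta> / 3 * ?u\<^sup>2" .
  have "measure (iid_sample n M) {\<xi> \<in> space (iid_sample n M). S \<xi> \<ge> (\<integral>\<xi>. S \<xi> \<partial>iid_sample n M) + ?u}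
      \<le> measure (iid_sample n M) {\<xi> \<in> space (iid_sample n M). ?u \<le> \<bar>S \<xi> - (\<integral>\<xi>. S \<xi> \<partial>iid_sample n M)\<bar>}"
    using meas by (intro I.finite_measure_mono) auto
  also have "\<dots> \<le> I.variance S / ?u\<^sup>2"
    by (rule I.Chebyshev_inequality[OF meas sq u])
  also have "\<dots> \<le> 2 * \<eta> / 3"
    using V zero_less_power[OF u, of 2] by (simp only: pos_divide_le_eq)
  finally show ?thesis .
qed

text \<open>
  The loss is the sum of its truncated part and the rest. The mean of the largest deviation is at most
  \<open>2 * slope * complexity n\<close> for the former and twice that for the latter, which is why the
  threshold starts with 6.
\<close>

lemma prob_MAX_dev_ge:
  assumes T: "finite T" "T \<noteq> {}" "\<And>t. t \<in> T \<Longrightarrow> dual_norm \<nu> (fst t) \<le> 1"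
    and n: "n > 0" and \<eta>: "0 < \<eta>" "\<eta> < 1"
  shows "measure (iid_sample n M)
    {\<xi> \<in> space (iid_sample n M). (MAX t\<in>T. dev loss n \<xi> t) \<ge> threshold n \<eta>} \<le> \<eta>"
proof -
  interpret I: prob_space "iid_sample n M" by (rule prob_space_iid)
  let ?f = "\<lambda>t z. loss t (trunc z)" and ?g = "\<lambda>t z. loss t z - loss t (trunc z)"
  define A where "A \<xi> = (MAX t\<in>T. dev ?f n \<xi> t)" for \<xi>
  define B where "B \<xi> = (MAX t\<in>T. dev ?g n \<xi> t)" for \<xi>
  define D where "D \<xi> = (MAX t\<in>T. dev (\<lambda>t z. 1 * loss t z) n \<xi> t)" for \<xi>
  define D' where "D' \<xi> = (MAX t\<in>T. dev (\<lambda>t z. - 1 * ?f t z) n \<xi> t)" for \<xi>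
  have int1: "integrable M (\<lambda>z. loss t z)" "integrable M (?f t)" if "t \<in> T" for t
    by (rule integrable_loss[OF T(3)[OF that]], rule integrable_loss_trunc[OF T(3)[OF that]])
  have int: "integrable (iid_sample n M) A" "integrable (iid_sample n M) B"
    "integrable (iid_sample n M) D" "integrable (iid_sample n M) D'"
    unfolding A_def B_def D_def D'_def
    using T(1,2) int1 by (auto intro!: integrable_MAX integrable_dev)
  have dev_split: "dev loss n \<xi> t = dev ?f n \<xi> t + dev ?g n \<xi> t"
    "dev ?g n \<xi> t = dev (\<lambda>t z. 1 * loss t z) n \<xi> t + dev (\<lambda>t z. - 1 * ?f t z) n \<xi> t"
    if "t \<in> T" for \<xi> t
    using int1[OF that] unfolding dev_def sum.distrib[symmetric]
    by (auto intro!: sum.cong simp: algebra_simps)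
  have MAX_ge: "dev f n \<xi> t \<le> (MAX t\<in>T. dev f n \<xi> t)" if "t \<in> T" for f \<xi> t
    using T(1) that by (intro Max_ge) auto
  have "(\<integral>\<xi>. B \<xi> \<partial>iid_sample n M) \<le> (\<integral>\<xi>. D \<xi> + D' \<xi> \<partial>iid_sample n M)"
  proof (rule integral_mono)
    show "B \<xi> \<le> D \<xi> + D' \<xi>" for \<xi>
      unfolding B_def
    proof (intro Max.boundedI)
      fix x assume "x \<in> dev ?g n \<xi> ` T"
      then obtain t where t: "t \<in> T" "x = dev ?g n \<xi> t" by blast
      show "x \<le> D \<xi> + D' \<xi>"
        unfolding t(2) dev_split(2)[OF t(1)] D_def D'_def by (intro add_mono MAX_ge t(1))
    qed (use T in auto)
  qed (use int in auto)
  also have "\<dots> = (\<integral>\<xi>. D \<xi> \<partial>iid_sample n M) + (\<integral>\<xi>. D' \<xi> \<partial>iid_sample n M)"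
    using int by simp
  also have "(\<integral>\<xi>. D \<xi> \<partial>iid_sample n M) \<le> 2 * slope * complexity n"
    unfolding D_def using integral_MAX_dev_le[where T = T and g = "\<lambda>z. z" and c = 1 and n = n, OF T] by simp
  also have "(\<integral>\<xi>. D' \<xi> \<partial>iid_sample n M) \<le> 2 * slope * complexity n"
    unfolding D'_def
    using integral_MAX_dev_le[where T = T and g = trunc and c = "- 1" and n = n, OF T measurable_trunc \<nu>_trunc_le(2)]
    by simp
  finally have EB: "(\<integral>\<xi>. B \<xi> \<partial>iid_sample n M) \<le> 4 * slope * complexity n" by simp
  have EA: "(\<integral>\<xi>. A \<xi> \<partial>iid_sample n M) \<le> 2 * slope * complexity n"
    unfolding A_def
    using integral_MAX_dev_le[where T = T and g = trunc and c = 1 and n = n, OF T measurable_trunc \<nu>_trunc_le(2)]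
    by simp
  define u where "u = slope * sqrt (2 * real n * ln (3 / \<eta>))"
  define v where "v = slope * (sqrt n * (1 + \<kappa> * sqrt (6 * \<Gamma> / \<eta>)))"
  define EvA where "EvA = {\<xi> \<in> space (iid_sample n M). A \<xi> \<ge> (\<integral>\<xi>. A \<xi> \<partial>iid_sample n M) + u}"
  define EvB where "EvB = {\<xi> \<in> space (iid_sample n M). B \<xi> \<ge> (\<integral>\<xi>. B \<xi> \<partial>iid_sample n M) + v}"
  have sets: "EvA \<in> sets (iid_sample n M)" "EvB \<in> sets (iid_sample n M)"
    unfolding EvA_def EvB_def using int by measurable
  have "{\<xi> \<in> space (iid_sample n M). (MAX t\<in>T. dev loss n \<xi> t) \<ge> threshold n \<eta>} \<subseteq> EvA \<union> EvB"
  proof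
    fix \<xi> assume "\<xi> \<in> {\<xi> \<in> space (iid_sample n M). (MAX t\<in>T. dev loss n \<xi> t) \<ge> threshold n \<eta>}"
    then have \<xi>: "\<xi> \<in> space (iid_sample n M)" "threshold n \<eta> \<le> (MAX t\<in>T. dev loss n \<xi> t)" by auto
    obtain t where t: "t \<in> T" "(MAX t\<in>T. dev loss n \<xi> t) = dev loss n \<xi> t"
      using MAX_attained[OF T(1,2)] by blast
    have "dev loss n \<xi> t \<le> A \<xi> + B \<xi>"
      unfolding dev_split(1)[OF t(1)] A_def B_def by (intro add_mono MAX_ge t(1))
    then have "6 * slope * complexity n + u + v \<le> A \<xi> + B \<xi>"
      using \<xi>(2) t(2) by (simp add: threshold_def u_def v_def)
    then show "\<xi> \<in> EvA \<union> EvB"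
      using EA EB \<xi>(1) unfolding EvA_def EvB_def by auto
  qed
  then have "measure (iid_sample n M) {\<xi> \<in> space (iid_sample n M). (MAX t\<in>T. dev loss n \<xi> t) \<ge> threshold n \<eta>}
      \<le> measure (iid_sample n M) (EvA \<union> EvB)"
    using sets by (intro I.finite_measure_mono) auto
  also have "\<dots> \<le> measure (iid_sample n M) EvA + measure (iid_sample n M) EvB"
    using sets by (rule measure_Un_le)
  also have "measure (iid_sample n M) EvA \<le> \<eta> / 3"
    unfolding EvA_def A_def u_def by (rule prob_trunc_dev_ge[OF T n \<eta>])
  also have "measure (iid_sample n M) EvB \<le> 2 * \<eta> / 3"
    unfolding EvB_def B_def v_def by (rule prob_excess_dev_ge[OF T n \<eta>])
  finally show ?thesis by simp
qed

section \<open>All parameters at once\<close>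

definition risk :: "'a \<times> real \<Rightarrow> real" where
  "risk t = (\<integral>z. check_loss \<alpha> (fst t \<bullet> z - snd t) \<partial>M)"

lemma integrable_norm_M: "integrable M (\<lambda>z. norm z)"
proof -
  obtain c where c: "c > 0" "\<And>x. c * norm x \<le> \<nu> x" using is_norm_lower_bound[OF \<nu>] by blast
  show ?thesis
  proof (rule Bochner_Integration.integrable_bound)
    show "integrable M (\<lambda>z. \<nu> z / c)" using integrable_\<nu> by simp
    show "(\<lambda>z. norm z) \<in> borel_measurable M" by (intro continuous_measurable_M continuous_intros)
    show "AE z in M. norm (norm z) \<le> norm (\<nu> z / c)"
      using c is_norm_nonneg[OF \<nu>] by (intro AE_I2) (simp add: field_simps)
  qed
qed

lemma check_loss_param_lipschitz:
  "\<bar>check_loss \<alpha> (fst t \<bullet> z - snd t) - check_loss \<alpha> (fst t' \<bullet> z - snd t')\<bar>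
    \<le> slope * (dist t t' * (norm z + 1))"
proof -
  have "\<bar>check_loss \<alpha> (fst t \<bullet> z - snd t) - check_loss \<alpha> (fst t' \<bullet> z - snd t')\<bar>
      \<le> slope * \<bar>(fst t \<bullet> z - snd t) - (fst t' \<bullet> z - snd t')\<bar>"
    unfolding slope_def by (rule check_loss_lipschitz[OF \<alpha>])
  also have "\<bar>(fst t \<bullet> z - snd t) - (fst t' \<bullet> z - snd t')\<bar> \<le> dist t t' * (norm z + 1)"
  proof -
    have "\<bar>fst (t - t') \<bullet> z\<bar> \<le> norm (fst (t - t')) * norm z" by (rule Cauchy_Schwarz_ineq2)
    also have "\<dots> \<le> norm (t - t') * norm z"
      using norm_fst_le[of "fst (t - t')" "snd (t - t')", unfolded prod.collapse] by (intro mult_right_mono) auto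
    finally have "\<bar>fst (t - t') \<bullet> z\<bar> \<le> norm (t - t') * norm z" .
    moreover have "\<bar>snd (t - t')\<bar> \<le> norm (t - t')"
      using norm_snd_le[of "snd (t - t')" "fst (t - t')", unfolded prod.collapse] by simp
    moreover have "(fst t \<bullet> z - snd t) - (fst t' \<bullet> z - snd t') = fst (t - t') \<bullet> z - snd (t - t')"
      by (simp add: inner_diff_left)
    ultimately show ?thesis by (simp add: dist_norm distrib_left)
  qed
  finally show ?thesis using slope_pos by simp
qed

lemma measurable_check_loss: "(\<lambda>z. check_loss \<alpha> (fst t \<bullet> z - snd t)) \<in> borel_measurable M"
  by (intro continuous_measurable_M continuous_on_check_loss \<alpha> continuous_intros)

lemma integrable_check_loss: "integrable M (\<lambda>z. check_loss \<alpha> (fst t \<bullet> z - snd t))"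
proof (rule Bochner_Integration.integrable_bound)
  show "integrable M (\<lambda>z. slope * (dist t 0 * (norm z + 1)))" using integrable_norm_M by simp
  show "AE z in M. norm (check_loss \<alpha> (fst t \<bullet> z - snd t)) \<le> norm (slope * (dist t 0 * (norm z + 1)))"
  proof (rule AE_I2)
    fix z
    have "check_loss \<alpha> 0 = 0" by (simp add: check_loss_def)
    then show "norm (check_loss \<alpha> (fst t \<bullet> z - snd t)) \<le> norm (slope * (dist t 0 * (norm z + 1)))"
      using check_loss_param_lipschitz[of t z 0] slope_pos by simp
  qed
qed (rule measurable_check_loss)

text \<open>
  Continuity in the parameters is used twice: to pass from a countable dense set of parameters to all of them,
  and for the measurability of the risk at the estimated parameters.
\<close>

lemma continuous_risk: "continuous_on A risk"
proof -
  let ?L = "slope * ((\<integral>z. norm z \<partial>M) + 1)"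
  have L: "?L \<ge> 0" using slope_pos by (intro mult_nonneg_nonneg add_nonneg_nonneg integral_nonneg) auto
  have "?L-lipschitz_on A risk"
  proof (rule lipschitz_onI[OF _ L])
    fix t t'
    have "dist (risk t) (risk t') = \<bar>\<integral>z. check_loss \<alpha> (fst t \<bullet> z - snd t) - check_loss \<alpha> (fst t' \<bullet> z - snd t') \<partial>M\<bar>"
      unfolding risk_def dist_real_def using integrable_check_loss by simp
    also have "\<dots> \<le> (\<integral>z. \<bar>check_loss \<alpha> (fst t \<bullet> z - snd t) - check_loss \<alpha> (fst t' \<bullet> z - snd t')\<bar> \<partial>M)"
      by (rule integral_abs_bound)
    also have "\<dots> \<le> (\<integral>z. slope * (dist t t' * (norm z + 1)) \<partial>M)"
      by (intro integral_mono integrable_abs Bochner_Integration.integrable_diff integrable_check_loss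
          integrable_mult_right Bochner_Integration.integrable_add integrable_norm_M integrable_const
          check_loss_param_lipschitz)
    also have "\<dots> = ?L * dist t t'"
      using integrable_norm_M by (simp add: prob_space)
    finally show "dist (risk t) (risk t') \<le> ?L * dist t t'" .
  qed
  then show ?thesis by (rule lipschitz_on_continuous_on)
qed

text \<open>The offset of \<open>shifted_loss\<close> cancels.\<close>

lemma dev_eq_risk: "dev loss n \<xi> t = (\<Sum>i<n. risk t - check_loss \<alpha> (fst t \<bullet> \<xi> i - snd t))"
  unfolding dev_def shifted_loss_def using integrable_check_loss[of t]
  by (simp add: risk_def prob_space)

lemma continuous_dev: "continuous_on A (\<lambda>t. dev loss n \<xi> t)"
  unfolding dev_eq_risk by (intro continuous_intros continuous_risk continuous_on_check_loss \<alpha>)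

text \<open>
  The bad events for an increasing sequence of finite parameter sets increase, so their union has probability at
  most \<open>\<eta>\<close>. Outside it the deviation is bounded on a dense set of parameters, and by
  continuity everywhere.
\<close>

lemma uniform_dev_le:
  assumes n: "n > 0" and \<eta>: "0 < \<eta>" "\<eta> < 1"
  obtains N where "N \<in> sets (iid_sample n M)" "measure (iid_sample n M) N \<le> \<eta>"
    "\<And>\<xi> t. \<lbrakk>\<xi> \<in> space (iid_sample n M); \<xi> \<notin> N; dual_norm \<nu> (fst t) \<le> 1\<rbrakk> \<Longrightarrow> dev loss n \<xi> t \<le> threshold n \<eta>"
proof -
  interpret I: prob_space "iid_sample n M" by (rule prob_space_iid)
  define V where "V = {t :: 'a \<times> real. dual_norm \<nu> (fst t) \<le> 1}"
  obtain D where D: "countable D" "D \<subseteq> V" "V \<subseteq> closure D" by (rule separable)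
  have "0 \<in> V" by (simp add: V_def is_norm_zero[OF is_norm_dual_norm[OF \<nu>]])
  then have "D \<noteq> {}" using D(3) by auto
  define T where "T k = from_nat_into D ` {..k}" for k :: nat
  have T: "finite (T k)" "T k \<noteq> {}" "T k \<subseteq> D" for k
    using from_nat_into[OF \<open>D \<noteq> {}\<close>] by (auto simp: T_def)
  have T_dual: "dual_norm \<nu> (fst t) \<le> 1" if "t \<in> T k" for t k
    using that T(3) D(2) by (auto simp: V_def)
  define B where "B k = {\<xi> \<in> space (iid_sample n M). (MAX t\<in>T k. dev loss n \<xi> t) \<ge> threshold n \<eta>}" for k
  have B_sets: "B k \<in> sets (iid_sample n M)" for k
  proof -
    have "integrable (iid_sample n M) (\<lambda>\<xi>. MAX t\<in>T k. dev loss n \<xi> t)"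
      by (intro integrable_MAX integrable_dev integrable_loss T_dual T)
    then have "(\<lambda>\<xi>. MAX t\<in>T k. dev loss n \<xi> t) \<in> borel_measurable (iid_sample n M)" by simp
    then show ?thesis unfolding B_def by measurable
  qed
  have "incseq B"
  proof (rule incseq_SucI)
    fix k
    have "(MAX t\<in>T k. dev loss n \<xi> t) \<le> (MAX t\<in>T (Suc k). dev loss n \<xi> t)" for \<xi>
      using T by (intro Max_mono) (auto simp: T_def)
    then show "B k \<le> B (Suc k)" unfolding B_def by (auto intro: order_trans)
  qed
  show thesis
  proof
    show "(\<Union>k. B k) \<in> sets (iid_sample n M)" using B_sets by auto
    have "(\<lambda>k. measure (iid_sample n M) (B k)) \<longlonglongrightarrow> measure (iid_sample n M) (\<Union>k. B k)"
      using B_sets \<open>incseq B\<close> by (intro I.finite_Lim_measure_incseq) auto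
    moreover have "measure (iid_sample n M) (B k) \<le> \<eta>" for k
      unfolding B_def using T_dual by (intro prob_MAX_dev_ge T n \<eta>) auto
    ultimately show "measure (iid_sample n M) (\<Union>k. B k) \<le> \<eta>"
      by (intro LIMSEQ_le_const2) auto
    fix \<xi> and t :: "'a \<times> real" assume \<xi>: "\<xi> \<in> space (iid_sample n M)" "\<xi> \<notin> (\<Union>k. B k)" and t: "dual_norm \<nu> (fst t) \<le> 1"
    have "dev loss n \<xi> u \<le> threshold n \<eta>" if u: "u \<in> D" for u
    proof -
      obtain k where "u = from_nat_into D k" using from_nat_into_surj[OF D(1) u] by auto
      then have "u \<in> T k" by (auto simp: T_def)
      then have "dev loss n \<xi> u \<le> (MAX t\<in>T k. dev loss n \<xi> t)" using T by (intro Max_ge) auto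
      also have "\<dots> < threshold n \<eta>" using \<xi> by (auto simp: B_def not_le)
      finally show ?thesis by simp
    qed
    moreover have "t \<in> closure D" using t D(3) by (auto simp: V_def)
    ultimately show "dev loss n \<xi> t \<le> threshold n \<eta>"
      using continuous_le_on_closure[OF continuous_dev[of "closure D" n \<xi>]] by blast
  qed
qed

text \<open>
  Dividing \<open>w\<close> and \<open>s\<close> by the dual norm of \<open>w\<close> brings the parameter into
  the unit ball and scales all losses by the same factor.
\<close>

lemma risk_le_of_dev_le:
  assumes n: "n > 0" and w: "w \<noteq> 0"
    and dev: "\<And>t. dual_norm \<nu> (fst t) \<le> 1 \<Longrightarrow> dev loss n \<xi> t \<le> B"
  shows "risk (w, s) \<le> (\<Sum>i<n. check_loss \<alpha> (w \<bullet> \<xi> i - s)) / n + dual_norm \<nu> w * (B / n)"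
proof -
  note \<mu> = is_norm_dual_norm[OF \<nu>]
  define c where "c = dual_norm \<nu> w"
  have c: "c > 0" unfolding c_def by (rule is_norm_pos[OF \<mu> w])
  define t where "t = ((1 / c) *\<^sub>R w, s / c)"
  have eq: "check_loss \<alpha> (w \<bullet> z - s) = c * check_loss \<alpha> (fst t \<bullet> z - snd t)" for z
  proof -
    have "w \<bullet> z - s = c * (fst t \<bullet> z - snd t)" using c by (simp add: t_def right_diff_distrib)
    then show ?thesis by (simp only: check_loss_scale[OF c])
  qed
  have "dual_norm \<nu> (fst t) \<le> 1" using c by (simp add: t_def is_norm_scale[OF \<mu>] c_def[symmetric])
  from dev[OF this] have "real n * risk t \<le> B + (\<Sum>i<n. check_loss \<alpha> (fst t \<bullet> \<xi> i - snd t))"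
    by (simp add: dev_eq_risk sum_subtractf)
  then have "risk t \<le> (B + (\<Sum>i<n. check_loss \<alpha> (fst t \<bullet> \<xi> i - snd t))) / n"
    using n by (simp add: pos_le_divide_eq mult.commute)
  then have "c * risk t \<le> c * ((B + (\<Sum>i<n. check_loss \<alpha> (fst t \<bullet> \<xi> i - snd t))) / n)"
    using c by (intro mult_left_mono) auto
  moreover have "risk (w, s) = c * risk t" unfolding risk_def by (simp add: eq)
  moreover have "(\<Sum>i<n. check_loss \<alpha> (w \<bullet> \<xi> i - s)) = c * (\<Sum>i<n. check_loss \<alpha> (fst t \<bullet> \<xi> i - snd t))"
    by (simp add: eq sum_distrib_left)
  ultimately show ?thesis
    unfolding c_def[symmetric] by (simp add: add_divide_distrib distrib_left)
qed

text \<open>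
  Purely numerical. With \<open>q = sqrt (d + 2)\<close>,
  \<open>h = sqrt (\<Gamma> / \<eta>) / (r - 2)\<close> and
  \<open>l = sqrt (2 * ln (3 / \<eta>))\<close>, the threshold divided by
  \<open>slope * sqrt n\<close> is at most \<open>37 q + 77 q h + l\<close>, against
  \<open>540 q + 96 q h + 3 l\<close> on the right.
\<close>

lemma threshold_le:
  fixes d :: real
  assumes n: "n > 0" and \<eta>: "0 < \<eta>" "\<eta> < 1" and d: "d \<ge> 0" "real DIM('a) \<le> d + 2"
  shows "threshold n \<eta> / n \<le> 3 / 2 * slope *
    ((360 * sqrt (d + 2) + 2 * sqrt (2 * ln (3 / \<eta>)) +
      sqrt (3 * \<Gamma> / \<eta>) * (32 / (r - 2)) * sqrt (ln (24 / \<eta>) + 2 * (d + 2))) / sqrt n)"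
proof -
  define q where "q = sqrt (d + 2)"
  define h where "h = sqrt (\<Gamma> / \<eta>) / (r - 2)"
  define l where "l = sqrt (2 * ln (3 / \<eta>))"
  define X where "X = sqrt (3 * \<Gamma> / \<eta>) * (32 / (r - 2)) * sqrt (ln (24 / \<eta>) + 2 * (d + 2))"
  have q: "q \<ge> 1" using d by (simp add: q_def)
  have Dq: "sqrt DIM('a) \<le> q" using d by (simp add: q_def)
  have h: "h \<ge> 0" using r \<Gamma>_nonneg \<eta> by (simp add: h_def)
  have ln_pos: "ln (3 / \<eta>) > 0" using \<eta> by simp
  have l: "l \<ge> 0" using ln_pos by (simp add: l_def)
  have "sqrt \<Gamma> \<le> sqrt (\<Gamma> / \<eta>)"
    using \<eta> \<Gamma>_nonneg by (intro real_sqrt_le_mono) (simp add: field_simps mult_left_le_one_le)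
  then have gh: "\<kappa> * sqrt \<Gamma> \<le> 2 * h" using r by (simp add: h_def divide_right_mono)
  have "sqrt (6 * \<Gamma> / \<eta>) = sqrt 6 * sqrt (\<Gamma> / \<eta>)" by (simp add: real_sqrt_mult real_sqrt_divide)
  also have "\<dots> \<le> (5 / 2) * sqrt (\<Gamma> / \<eta>)"
    using \<Gamma>_nonneg \<eta> by (intro mult_right_mono real_le_lsqrt) (auto simp: power2_eq_square)
  finally have "\<kappa> * sqrt (6 * \<Gamma> / \<eta>) \<le> \<kappa> * ((5 / 2) * sqrt (\<Gamma> / \<eta>))"
    using \<kappa>_pos by (intro mult_left_mono) auto
  also have "\<dots> = 5 * h" using r by (simp add: h_def field_simps)
  finally have kh: "\<kappa> * sqrt (6 * \<Gamma> / \<eta>) \<le> 5 * h" .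
  have X_ge: "64 * (q * h) \<le> X"
  proof -
    have "2 * q * sqrt (\<Gamma> / \<eta>) \<le> sqrt (3 * \<Gamma> / \<eta>) * sqrt (ln (24 / \<eta>) + 2 * (d + 2))"
    proof -
      have "2 * q * sqrt (\<Gamma> / \<eta>) = sqrt (4 * ((d + 2) * (\<Gamma> / \<eta>)))"
        by (simp add: q_def real_sqrt_mult real_sqrt_divide)
      also have "\<dots> \<le> sqrt ((3 * \<Gamma> / \<eta>) * (ln (24 / \<eta>) + 2 * (d + 2)))"
      proof (rule real_sqrt_le_mono)
        have "0 \<le> ln (24 / \<eta>)" using \<eta> by simp
        then have "(4 * (d + 2)) * (\<Gamma> / \<eta>) \<le> (3 * (ln (24 / \<eta>) + 2 * (d + 2))) * (\<Gamma> / \<eta>)"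
          using d \<Gamma>_nonneg \<eta> by (intro mult_right_mono) auto
        moreover have "(3 * \<Gamma> / \<eta>) * y = (3 * y) * (\<Gamma> / \<eta>)" for y by simp
        ultimately show "4 * ((d + 2) * (\<Gamma> / \<eta>)) \<le> (3 * \<Gamma> / \<eta>) * (ln (24 / \<eta>) + 2 * (d + 2))"
          by (simp only: mult.assoc)
      qed
      also have "\<dots> = sqrt (3 * \<Gamma> / \<eta>) * sqrt (ln (24 / \<eta>) + 2 * (d + 2))" by (rule real_sqrt_mult)
      finally show ?thesis .
    qed
    then have "(2 * q * sqrt (\<Gamma> / \<eta>)) * (32 / (r - 2))
        \<le> (sqrt (3 * \<Gamma> / \<eta>) * sqrt (ln (24 / \<eta>) + 2 * (d + 2))) * (32 / (r - 2))"
      using r by (intro mult_right_mono) auto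
    then show ?thesis by (simp add: X_def h_def mult_ac)
  qed
  define Y where "Y = 6 * (4 * sqrt DIM('a) + 2) * (1 + \<kappa> * sqrt \<Gamma>) + l + (1 + \<kappa> * sqrt (6 * \<Gamma> / \<eta>))"
  have "(6 * (4 * sqrt DIM('a) + 2)) * (1 + \<kappa> * sqrt \<Gamma>) \<le> (36 * q) * (1 + 2 * h)"
  proof (rule mult_mono)
    have "4 * sqrt DIM('a) + 2 \<le> 6 * q" using Dq q by linarith
    then show "6 * (4 * sqrt DIM('a) + 2) \<le> 36 * q" by simp
    show "1 + \<kappa> * sqrt \<Gamma> \<le> 1 + 2 * h" using gh by linarith
    have "0 \<le> \<kappa> * sqrt \<Gamma>" using \<kappa>_pos \<Gamma>_nonneg by (intro mult_nonneg_nonneg) auto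
    then show "0 \<le> 1 + \<kappa> * sqrt \<Gamma>" by linarith
  qed (use q in linarith)
  also have "\<dots> = 36 * q + 72 * (q * h)" by (simp add: algebra_simps)
  finally have "Y \<le> 37 * q + 72 * (q * h) + l + 5 * h"
    using kh q unfolding Y_def by linarith
  moreover have "1 * h \<le> q * h" using q h by (rule mult_right_mono)
  ultimately have "Y \<le> 540 * q + 3 * l + 3 / 2 * X"
    using X_ge q l h by linarith
  also have "\<dots> = 3 / 2 * (360 * q + 2 * l + X)" by (simp add: distrib_left)
  finally have Y: "Y \<le> 3 / 2 * (360 * q + 2 * l + X)" .
  have complexity: "complexity n = sqrt n * ((4 * sqrt DIM('a) + 2) * (1 + \<kappa> * sqrt \<Gamma>))"
  proof -
    have "C * (S + k * (S * G)) = S * (C * (1 + k * G))" for C S k G :: real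
      by (simp add: algebra_simps)
    then show ?thesis unfolding complexity_def real_sqrt_mult .
  qed
  have "sqrt (2 * real n * ln (3 / \<eta>)) = sqrt n * l"
    unfolding l_def real_sqrt_mult[symmetric] by (simp add: mult_ac)
  moreover have "6 * m * (S * (C * G)) + m * (S * L) + m * (S * W) = m * S * (6 * C * G + L + W)"
    for m S C G L W :: real
    by (simp add: algebra_simps)
  ultimately have "threshold n \<eta> = slope * sqrt n * Y"
    unfolding threshold_def complexity Y_def by simp
  then have "threshold n \<eta> / n = slope * Y * (sqrt n / n)" by simp
  also have "sqrt n / n = inverse (sqrt n)" by (rule sqrt_divide_self_eq) simp
  also have "slope * Y * inverse (sqrt n) = slope * (Y / sqrt n)" by (simp add: divide_inverse)
  also have "\<dots> \<le> slope * (3 / 2 * (360 * q + 2 * l + X) / sqrt n)"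
    using Y slope_pos by (intro mult_left_mono divide_right_mono) auto
  also have "\<dots> = 3 / 2 * slope * ((360 * q + 2 * l + X) / sqrt n)" by simp
  finally show ?thesis by (simp only: q_def l_def X_def)
qed

end

section \<open>The out-of-sample bound\<close>

text \<open>
  \<open>c_const \<alpha> p\<close> is the \<open>L\<^sup>q\<close> norm of a variable that takes the value
  \<open>\<alpha>\<close> with probability \<open>1 - \<alpha>\<close> and \<open>1 - \<alpha>\<close> with
  probability \<open>\<alpha>\<close>, and \<open>2 \<alpha> (1 - \<alpha>)\<close> is its mean; here
  \<open>q = \<infinity>\<close> for \<open>p = 1\<close> and \<open>q = 1\<close> for
  \<open>p = \<infinity>\<close>.
\<close>

lemma c_const_ge:
  assumes \<alpha>: "0 < \<alpha>" "\<alpha> < 1" and p: "1 \<le> p"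
  shows "2 * \<alpha> * (1 - \<alpha>) \<le> c_const \<alpha> p"
proof -
  consider "p = 1" | "p = \<infinity>" | "p \<noteq> 1" "p \<noteq> \<infinity>" by blast
  then show ?thesis
  proof cases
    case 1
    have "2 * \<alpha> * (1 - \<alpha>) \<le> max \<alpha> (1 - \<alpha>)"
    proof (cases "\<alpha> \<le> 1 / 2")
      case True
      then have "2 * \<alpha> * (1 - \<alpha>) \<le> 1 * (1 - \<alpha>)" using \<alpha> by (intro mult_right_mono) auto
      then show ?thesis by simp
    next
      case False
      then have "\<alpha> * (2 * (1 - \<alpha>)) \<le> \<alpha> * 1" using \<alpha> by (intro mult_left_mono) auto
      then show ?thesis by (simp add: mult_ac)
    qed
    then show ?thesis by (simp add: c_const_def 1)
  next
    case 2
    then show ?thesis by (simp add: c_const_def)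
  next
    case 3
    then obtain x where x: "p = ereal x" "x > 1"
      using p by (cases p) (auto simp: one_ereal_def)
    define q where "q = x / (x - 1)"
    have q: "q > 1" using x by (simp add: q_def field_simps)
    define S where "S = \<alpha> powr q * (1 - \<alpha>) + \<alpha> * (1 - \<alpha>) powr q"
    have "((1 - \<alpha>) *\<^sub>R \<alpha> + \<alpha> *\<^sub>R (1 - \<alpha>)) powr q \<le> (1 - \<alpha>) * \<alpha> powr q + \<alpha> * (1 - \<alpha>) powr q"
      using \<alpha> q by (intro convex_onD[OF powr_convex]) auto
    then have "(2 * \<alpha> * (1 - \<alpha>)) powr q \<le> S" by (simp add: S_def algebra_simps)
    then have "((2 * \<alpha> * (1 - \<alpha>)) powr q) powr (1 / q) \<le> S powr (1 / q)"
      using q by (intro powr_mono2) auto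
    moreover have "((2 * \<alpha> * (1 - \<alpha>)) powr q) powr (1 / q) = 2 * \<alpha> * (1 - \<alpha>)"
      using q \<alpha> by (simp add: powr_powr)
    moreover have "c_const \<alpha> p = S powr (1 / q)"
      using 3 by (simp add: c_const_def S_def q_def x(1) Let_def)
    ultimately show ?thesis by simp
  qed
qed

text \<open>
  With \<open>k = min \<alpha> (1 - \<alpha>)\<close> the product
  \<open>2 \<alpha> (1 - \<alpha>)\<close> equals \<open>2 m k\<close>, which cancels the factor
  \<open>m / k\<close> of the radius up to \<open>2 m\<^sup>2\<close>; and
  \<open>(1 + m) * 2 m\<^sup>2 \<ge> 3 / 2 * m\<close> because \<open>m \<ge> 1 / 2\<close>.
\<close>

lemma lam_dominates:
  assumes \<alpha>: "0 < \<alpha>" "\<alpha> < 1" and p: "1 \<le> p" and r: "2 < r" and N: "1 \<le> N" and \<eta>: "0 < \<eta>" "\<eta> < 1"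
    and \<Gamma>: "0 \<le> \<Gamma>"
  defines "m \<equiv> max \<alpha> (1 - \<alpha>)"
  shows "3 / 2 * m * ((360 * sqrt (real d + 2) + 2 * sqrt (2 * ln (3 / \<eta>)) +
      sqrt (3 * \<Gamma> / \<eta>) * (32 / (r - 2)) * sqrt (ln (24 / \<eta>) + 2 * (real d + 2))) / sqrt (real N))
    \<le> (1 + m) * (c_const \<alpha> p * eps_radius \<alpha> r \<Gamma> d N \<eta>)"
proof -
  define E where "E = 360 * sqrt (real d + 2) + 2 * sqrt (2 * ln (3 / \<eta>)) +
      sqrt (3 * \<Gamma> / \<eta>) * (32 / (r - 2)) * sqrt (ln (24 / \<eta>) + 2 * (real d + 2))"
  define L where "L = ln (2 * real N + 1) powr (1 / r)"
  define k where "k = min \<alpha> (1 - \<alpha>)"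
  have "0 \<le> ln (3 / \<eta>)" "0 \<le> ln (24 / \<eta>)" using \<eta> by simp_all
  then have E: "E \<ge> 0"
    unfolding E_def using r \<Gamma> \<eta> by (intro add_nonneg_nonneg mult_nonneg_nonneg) auto
  have L: "L \<ge> 1"
  proof -
    have "exp 1 \<le> 2 * real N + 1" using exp_le N by simp
    then have "1 \<le> ln (2 * real N + 1)" by (subst ln_ge_iff) auto
    then show ?thesis unfolding L_def using r by (intro ge_one_powr_ge_zero) auto
  qed
  have k: "k > 0" using \<alpha> by (simp add: k_def)
  have m: "m \<ge> 1 / 2" unfolding m_def le_max_iff_disj by linarith
  have "m * k = \<alpha> * (1 - \<alpha>)" by (simp add: m_def k_def max_def min_def)
  then have c: "2 * m * k \<le> c_const \<alpha> p" using c_const_ge[OF \<alpha> p] by (simp add: mult.assoc)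
  have "3 / 2 * m \<le> (1 + m) * (2 * m * m)"
  proof -
    have "3 / 2 * (1 * m) \<le> (1 + m) * ((2 * m) * m)"
      using m by (intro mult_mono) auto
    then show ?thesis by simp
  qed
  also have "\<dots> = (1 + m) * (2 * m * k * (m / k))" using k by simp
  also have "\<dots> \<le> (1 + m) * (c_const \<alpha> p * (m / k))"
    using c k m by (intro mult_left_mono mult_right_mono) auto
  finally have main: "3 / 2 * m \<le> (1 + m) * (c_const \<alpha> p * (m / k))" .
  have "3 / 2 * m * (E / sqrt N) \<le> (1 + m) * (c_const \<alpha> p * (m / k)) * (E / sqrt N)"
    using main E by (intro mult_right_mono) auto
  also have "\<dots> \<le> (1 + m) * (c_const \<alpha> p * (m / k)) * (E * (L / sqrt N))"
  proof (rule mult_left_mono)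
    have "E * 1 \<le> E * L" using L E by (intro mult_left_mono) auto
    then have "E * 1 / sqrt N \<le> E * L / sqrt N" by (intro divide_right_mono) auto
    then show "E / sqrt N \<le> E * (L / sqrt N)" by simp
    show "0 \<le> (1 + m) * (c_const \<alpha> p * (m / k))" using main m by linarith
  qed
  also have "\<dots> = (1 + m) * (c_const \<alpha> p * eps_radius \<alpha> r \<Gamma> d N \<eta>)"
    unfolding eps_radius_def E_def[symmetric] L_def[symmetric] m_def[symmetric] k_def[symmetric]
    by (simp only: mult.assoc)
  finally show ?thesis unfolding E_def .
qed

theorem proposition4:
  fixes \<alpha> r \<Gamma> \<eta> lam :: real
    and p :: ereal
    and N :: nat
    and \<nu> :: "(real ^ 'd) \<times> real \<Rightarrow> real"
    and F :: "((real ^ 'd) \<times> real) measure"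
    and b :: "(nat \<Rightarrow> (real ^ 'd) \<times> real) \<Rightarrow> real ^ 'd"
    and s :: "(nat \<Rightarrow> (real ^ 'd) \<times> real) \<Rightarrow> real"
  assumes "0 < \<alpha>" and "\<alpha> < 1"
    and "1 \<le> p"
    and "is_norm \<nu>"
    and "prob_space F" and "sets F = sets borel"
    and "2 < r"
    and "integrable F (\<lambda>z. \<nu> z powr r)"
    and "\<Gamma> = (\<integral>z. \<nu> z powr r \<partial>F)"
    and "0 < \<eta>" and "\<eta> < 1"
    and "1 \<le> N"
    and "lam = c_const \<alpha> p * eps_radius \<alpha> r \<Gamma> CARD('d) N \<eta>"
    and "b \<in> borel_measurable (iid_sample N F)"
    and "s \<in> borel_measurable (iid_sample N F)"
    and "\<And>\<omega>. \<omega> \<in> space (iid_sample N F) \<Longrightarrow>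
      is_arg_min (\<lambda>(\<beta>, t). regularized_loss \<alpha> \<nu> lam (empirical N \<omega>) \<beta> t) (\<lambda>_. True) (b \<omega>, s \<omega>)"
  shows "measure (iid_sample N F)
      {\<omega> \<in> space (iid_sample N F).
         expected_loss \<alpha> F (b \<omega>) (s \<omega>)
           \<le> regularized_loss \<alpha> \<nu> lam (empirical N \<omega>) (b \<omega>) (s \<omega>)
              + (max \<alpha> (1 - \<alpha>) * dual_norm \<nu> (- b \<omega>, 1)) * lam} \<ge> 1 - \<eta>"
proof -
  interpret S: check_loss_sample F \<nu> \<alpha> r
    using assms(1-8) by (intro check_loss_sample.intro check_loss_sample_axioms.intro) auto
  interpret I: prob_space "iid_sample N F" by (rule S.prob_space_iid)
  let ?m = "max \<alpha> (1 - \<alpha>)"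
  let ?\<mu> = "dual_norm \<nu>"
  have \<mu>: "is_norm ?\<mu>" by (rule is_norm_dual_norm[OF assms(4)])
  have N: "N > 0" using assms(12) by simp
  have \<Gamma>: "S.\<Gamma> = \<Gamma>" using assms(9) by (simp add: S.\<Gamma>_def)
  have inner: "(- \<beta>, 1) \<bullet> z - t = snd z - \<beta> \<bullet> fst z - t" for \<beta> :: "real ^ 'd" and z t
    by (cases z) (simp add: inner_prod_def)
  have risk: "expected_loss \<alpha> F \<beta> t = S.risk ((- \<beta>, 1), t)" for \<beta> t
    unfolding expected_loss_def S.risk_def case_prod_beta fst_conv snd_conv inner ..
  have emp: "expected_loss \<alpha> (empirical N \<omega>) \<beta> t = (\<Sum>i<N. check_loss \<alpha> ((- \<beta>, 1) \<bullet> \<omega> i - t)) / N"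
    for \<omega> and \<beta> :: "real ^ 'd" and t
    by (simp only: expected_loss_empirical[OF N] inner)
  have dual_eq: "?\<mu> (\<beta>, - 1) = ?\<mu> (- \<beta>, 1)" for \<beta>
    using is_norm_uminus[OF \<mu>, of "(\<beta>, - 1)"] by simp
  have thr: "S.threshold N \<eta> / N \<le> (1 + ?m) * lam"
  proof -
    have "S.threshold N \<eta> / N \<le> 3 / 2 * S.slope *
      ((360 * sqrt (real CARD('d) + 2) + 2 * sqrt (2 * ln (3 / \<eta>)) +
        sqrt (3 * S.\<Gamma> / \<eta>) * (32 / (r - 2)) * sqrt (ln (24 / \<eta>) + 2 * (real CARD('d) + 2))) / sqrt N)"
      using N assms(10,11) by (intro S.threshold_le) auto
    also have "\<dots> \<le> (1 + ?m) * (c_const \<alpha> p * eps_radius \<alpha> r \<Gamma> CARD('d) N \<eta>)"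
      unfolding \<Gamma> S.slope_def using assms S.\<Gamma>_nonneg \<Gamma> by (intro lam_dominates) auto
    finally show ?thesis by (simp only: assms(13))
  qed
  \<comment> \<open>one event serves all parameters, and so in particular the estimates, which depend on the sample\<close>
  obtain Bad where Bad: "Bad \<in> sets (iid_sample N F)" "measure (iid_sample N F) Bad \<le> \<eta>"
    "\<And>\<omega> t. \<lbrakk>\<omega> \<in> space (iid_sample N F); \<omega> \<notin> Bad; ?\<mu> (fst t) \<le> 1\<rbrakk>
      \<Longrightarrow> S.dev S.loss N \<omega> t \<le> S.threshold N \<eta>"
    using S.uniform_dev_le[OF N assms(10,11)] by blast
  define G where "G = {\<omega> \<in> space (iid_sample N F).
         expected_loss \<alpha> F (b \<omega>) (s \<omega>)
           \<le> regularized_loss \<alpha> \<nu> lam (empirical N \<omega>) (b \<omega>) (s \<omega>)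
              + (?m * ?\<mu> (- b \<omega>, 1)) * lam}"
  have "space (iid_sample N F) - Bad \<subseteq> G"
  proof
    fix \<omega> assume \<omega>: "\<omega> \<in> space (iid_sample N F) - Bad"
    let ?w = "(- b \<omega>, 1 :: real)"
    have "?w \<noteq> 0" by (simp add: zero_prod_def)
    then have "S.risk (?w, s \<omega>)
        \<le> (\<Sum>i<N. check_loss \<alpha> (?w \<bullet> \<omega> i - s \<omega>)) / N + ?\<mu> ?w * (S.threshold N \<eta> / N)"
      using \<omega> by (intro S.risk_le_of_dev_le N Bad(3)) auto
    also have "?\<mu> ?w * (S.threshold N \<eta> / N) \<le> ?\<mu> ?w * ((1 + ?m) * lam)"
      by (intro mult_left_mono thr is_norm_nonneg[OF \<mu>])
    finally have "S.risk (?w, s \<omega>) \<le> (\<Sum>i<N. check_loss \<alpha> (?w \<bullet> \<omega> i - s \<omega>)) / N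
        + lam * ?\<mu> ?w + (?m * ?\<mu> ?w) * lam"
      by (simp add: algebra_simps)
    then show "\<omega> \<in> G"
      using \<omega> by (simp add: G_def regularized_loss_def risk emp dual_eq)
  qed
  \<comment> \<open>otherwise \<open>measure\<close> would assign the default value 0 to this event\<close>
  moreover have "G \<in> sets (iid_sample N F)"
  proof -
    have comp: "(\<lambda>\<omega>. \<omega> i) \<in> borel_measurable (iid_sample N F)" if "i < N" for i
      using S.measurable_iid_component[OF that] measurable_cong_sets[OF refl assms(6)] by blast
    have w: "(\<lambda>\<omega>. (- b \<omega>, 1 :: real)) \<in> borel_measurable (iid_sample N F)"
      unfolding borel_prod[symmetric] using assms(14) by measurable
    have dual_meas: "(\<lambda>\<omega>. ?\<mu> (- b \<omega>, 1)) \<in> borel_measurable (iid_sample N F)"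
      by (rule measurable_compose[OF w borel_measurable_continuous_onI[OF is_norm_continuous[OF \<mu>]]])
    have "(\<lambda>\<omega>. ((- b \<omega>, 1 :: real), s \<omega>)) \<in> borel_measurable (iid_sample N F)"
      unfolding borel_prod[symmetric] using w assms(15) unfolding borel_prod[symmetric] by measurable
    then have risk_meas: "(\<lambda>\<omega>. S.risk ((- b \<omega>, 1), s \<omega>)) \<in> borel_measurable (iid_sample N F)"
      by (rule measurable_compose[OF _ borel_measurable_continuous_onI[OF S.continuous_risk]])
    have "check_loss \<alpha> \<in> borel_measurable borel"
      by (intro borel_measurable_continuous_onI continuous_on_check_loss assms continuous_on_id)
    moreover have "(\<lambda>\<omega>. (- b \<omega>, 1) \<bullet> \<omega> i - s \<omega>) \<in> borel_measurable (iid_sample N F)" if "i < N" for i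
      by (intro borel_measurable_diff borel_measurable_inner w comp that assms(15))
    ultimately have "(\<lambda>\<omega>. check_loss \<alpha> ((- b \<omega>, 1) \<bullet> \<omega> i - s \<omega>)) \<in> borel_measurable (iid_sample N F)"
      if "i < N" for i
      using that measurable_compose by blast
    then have "(\<lambda>\<omega>. (\<Sum>i<N. check_loss \<alpha> ((- b \<omega>, 1) \<bullet> \<omega> i - s \<omega>)) / N) \<in> borel_measurable (iid_sample N F)"
      by (intro borel_measurable_divide borel_measurable_sum borel_measurable_const) auto
    then show ?thesis
      unfolding G_def regularized_loss_def risk emp dual_eq
      using risk_meas dual_meas by measurable
  qed
  ultimately have "measure (iid_sample N F) (space (iid_sample N F) - Bad) \<le> measure (iid_sample N F) G"
    by (rule I.finite_measure_mono)
  moreover have "measure (iid_sample N F) (space (iid_sample N F) - Bad) = 1 - measure (iid_sample N F) Bad"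
    by (rule I.prob_compl[OF Bad(1)])
  ultimately show ?thesis using Bad(2) unfolding G_def by linarith
qed

end
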